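(* Let $\Omega\subset\mathbb R^N$ be a bounded Lipschitz domain, $s\in(0,1)$, and let $\omega\subset\Omega$ be a measurable subset of positive measure. Let $K:H_0^s(\Omega)\to L^2(\omega)$, $Ku=u|_\omega$, be the restriction operator. Let $u^\dagger\in H_0^s(\Omega)$, $\delta>0$, and $y^\delta=u^\dagger|_\omega+\eta^\delta$, where the random noise $\eta^\delta$ (with values in $L^2(\omega)$) satisfies $\mathbb E\|\eta^\delta\|_{L^2(\omega)}^2\le\delta^2$. For $\alpha>0$ let $$u_\alpha^\delta=\arg\min_{u\in H_0^s(\Omega)}\left\{\frac12\|u-y^\delta\|_{L^2(\omega)}^2+\frac{\alpha}{2}\|u\|_{H_0^s(\Omega)}^2\right\}.$$ Set $B=KA_s^{-1/2}:L^2(\Omega)\to L^2(\omega)$ and $z^\dagger=A_s^{1/2}u^\dagger$, and assume the source condition $z^\dagger=(B^*B)^\beta w$ with $w\in L^2(\Omega)$ and $0<\beta\le1$. Then $$\mathbb E\|u_\alpha^\delta-u^\dagger\|_{H_0^s(\Omega)}^2\le C_1\alpha^{2\beta}+C_2\frac{\delta^2}{\alpha},\qquad C_1=2c_\beta^2\|w\|_{L^2(\Omega)}^2,\quad C_2=\tfrac12 .$$ In particular, choosing $\alpha=\delta^{\frac{2}{2\beta+1}}$ gives $$\mathbb E\|u_\alpha^\delta-u^\dagger\|_{H_0^s(\Omega)}^2\le C_{\rm opt}\,\delta^{\frac{4\beta}{2\beta+1}},\qquad C_{\rm opt}=2c_\beta^2\|w\|_{L^2(\Omega)}^2+\tfrac12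 .$$ Here $c_\beta=\beta^\beta(1-\beta)^{1-\beta}$ for $0<\beta<1$ and $c_1=1$.
   Context: All spaces are real. $H_0^s(\Omega)$ is the space of functions $u\in H^s(\mathbb R^N)$ with $u=0$ a.e. in $\mathbb R^N\setminus\Omega$ (also regarded as functions on $\Omega$). On it consider the closed, symmetric, coercive bilinear form $$a_s(u,v)=\int_\Omega uv\,dx+\frac{C_{N,s}}{2}\iint_{\mathbb R^{2N}}\frac{(u(x)-u(y))(v(x)-v(y))}{|x-y|^{N+2s}}\,dx\,dy,$$ where $C_{N,s}>0$ is the standard normalization constant of the integral fractional Laplacian, $C_{N,s}=\frac{4^s s\,\Gamma(N/2+s)}{\pi^{N/2}\Gamma(1-s)}$. $H_0^s(\Omega)$ is a Hilbert space with norm $\|u\|_{H_0^s(\Omega)}^2=a_s(u,u)$. $A_s=I+(-\Delta)^s$ is the unique positive self-adjoint operator on $L^2(\Omega)$ associated with $a_s$; powers are defined by the spectral theorem. $A_s^{1/2}$ is an isometric isomorphism of $D(A_s^{1/2})=H_0^s(\Omega)$ onto $L^2(\Omega)$ with inverse $A_s^{-1/2}:L^2(\Omega)\to H_0^s(\Omega)$. $B^*:L^2(\omega)\to L^2(\Omega)$ is the adjoint of $B$. *)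

theory Defs
  imports "HOL-Probability.Probability"
begin

section \<open>Real L2 spaces\<close>

text \<open>
  Elements of L2 are represented by functions; two representatives are the same element iff they
  agree almost everywhere.  The space L2(S) for \<open>S \<subseteq> \<real>\<^sup>N\<close> is \<open>L2_space (lebesgue_on S)\<close>, for which the
  values of a representative outside \<open>S\<close> are irrelevant.
\<close>

definition L2_space :: "'x measure \<Rightarrow> ('x \<Rightarrow> real) set" where
  "L2_space M = {f \<in> borel_measurable M. integrable M (\<lambda>x. (f x)\<^sup>2)}"

definition L2_inner :: "'x measure \<Rightarrow> ('x \<Rightarrow> real) \<Rightarrow> ('x \<Rightarrow> real) \<Rightarrow> real" where
  "L2_inner M f g = (LINT x|M. f x * g x)"

definition L2_norm :: "'x measure \<Rightarrow> ('x \<Rightarrow> real) \<Rightarrow> real" where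
  "L2_norm M f = sqrt (L2_inner M f f)"

definition L2_open :: "'x measure \<Rightarrow> ('x \<Rightarrow> real) set \<Rightarrow> bool" where
  "L2_open M U \<longleftrightarrow> U \<subseteq> L2_space M \<and>
     (\<forall>f\<in>U. \<exists>e>0. \<forall>g\<in>L2_space M. L2_norm M (\<lambda>x. g x - f x) < e \<longrightarrow> g \<in> U)"

text \<open>L2(M) as a measurable space, with its Borel sigma-algebra.\<close>

definition L2_borel :: "'x measure \<Rightarrow> ('x \<Rightarrow> real) measure" where
  "L2_borel M = sigma (L2_space M) {U. L2_open M U}"


section \<open>Operators and spectral powers\<close>

text \<open>
  A (possibly unbounded) operator between L2 spaces is its graph, a set of pairs
  (argument, value) that is closed under almost everywhere equality in both components.
  The product of operators \<open>S T\<close> is the relational composition \<open>T O S\<close>.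
\<close>

type_synonym 'x L2_op = "(('x \<Rightarrow> real) \<times> ('x \<Rightarrow> real)) set"

text \<open>The Hilbert space adjoint of a densely defined operator from L2(M) to L2(M').\<close>

definition L2_adjoint :: "'x measure \<Rightarrow> 'x measure \<Rightarrow> 'x L2_op \<Rightarrow> 'x L2_op" where
  "L2_adjoint M M' T = {(g, f). g \<in> L2_space M' \<and> f \<in> L2_space M \<and>
     (\<forall>(h, k)\<in>T. L2_inner M' k g = L2_inner M h f)}"

text \<open>
  Projection-valued measures on the Borel sets of the real line.  The first and third conditions
  say that every \<open>E A\<close> is symmetric and idempotent, i.e. an orthogonal projection: a symmetric map
  defined on all of L2(M) is automatically linear and respects almost everywhere equality.
  Countable additivity is stated in the weak operator topology.
\<close>

definition projection_valued_measure ::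
    "'x measure \<Rightarrow> (real set \<Rightarrow> ('x \<Rightarrow> real) \<Rightarrow> 'x \<Rightarrow> real) \<Rightarrow> bool" where
  "projection_valued_measure M E \<longleftrightarrow>
     (\<forall>A\<in>sets borel. \<forall>f\<in>L2_space M. E A f \<in> L2_space M) \<and>
     (\<forall>A\<in>sets borel. \<forall>f\<in>L2_space M. \<forall>g\<in>L2_space M. L2_inner M (E A f) g = L2_inner M f (E A g)) \<and>
     (\<forall>A\<in>sets borel. \<forall>B\<in>sets borel. \<forall>f\<in>L2_space M. AE x in M. E (A \<inter> B) f x = E A (E B f) x) \<and>
     (\<forall>f\<in>L2_space M. AE x in M. E UNIV f x = f x) \<and>
     (\<forall>A :: nat \<Rightarrow> real set. range A \<subseteq> sets borel \<longrightarrow> disjoint_family A \<longrightarrow>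
        (\<forall>f\<in>L2_space M. \<forall>g\<in>L2_space M.
           (\<lambda>n. L2_inner M (E (A n) f) g) sums L2_inner M (E (\<Union>n. A n) f) g))"

text \<open>The finite measure \<open>A \<mapsto> \<langle>E A f, f\<rangle>\<close>.\<close>

definition spectral_measure ::
    "'x measure \<Rightarrow> (real set \<Rightarrow> ('x \<Rightarrow> real) \<Rightarrow> 'x \<Rightarrow> real) \<Rightarrow> ('x \<Rightarrow> real) \<Rightarrow> real measure" where
  "spectral_measure M E f =
     measure_of UNIV (sets borel) (\<lambda>A. ennreal (L2_inner M (E A f) f))"

definition spectral_domain ::
    "'x measure \<Rightarrow> (real set \<Rightarrow> ('x \<Rightarrow> real) \<Rightarrow> 'x \<Rightarrow> real) \<Rightarrow> (real \<Rightarrow> real) \<Rightarrow> ('x \<Rightarrow> real) set" where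
  "spectral_domain M E \<phi> =
     {u \<in> L2_space M. integrable (spectral_measure M E u) (\<lambda>t. (\<phi> t)\<^sup>2)}"

text \<open>
  The self-adjoint operator \<open>\<integral> \<phi> dE\<close>.  For \<open>u\<close>, \<open>g\<close> in the (dense) domain, the right-hand side is
  \<open>\<integral> \<phi>(t) d\<langle>E(t) u, g\<rangle>\<close>, the signed measure \<open>A \<mapsto> \<langle>E A u, g\<rangle>\<close> being written by polarization as a
  difference of positive measures.
\<close>

definition spectral_integral ::
    "'x measure \<Rightarrow> (real set \<Rightarrow> ('x \<Rightarrow> real) \<Rightarrow> 'x \<Rightarrow> real) \<Rightarrow> (real \<Rightarrow> real) \<Rightarrow> 'x L2_op" where
  "spectral_integral M E \<phi> = {(u, v). u \<in> spectral_domain M E \<phi> \<and> v \<in> L2_space M \<and>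
     (\<forall>g\<in>spectral_domain M E \<phi>. L2_inner M v g =
        ((LINT t|spectral_measure M E (\<lambda>x. u x + g x). \<phi> t) -
         (LINT t|spectral_measure M E (\<lambda>x. u x - g x). \<phi> t)) / 4)}"

text \<open>\<open>T = \<integral> t dE(t)\<close>; by the spectral theorem a self-adjoint \<open>T\<close> has exactly one such \<open>E\<close>.\<close>

definition spectral_resolution ::
    "'x measure \<Rightarrow> (real set \<Rightarrow> ('x \<Rightarrow> real) \<Rightarrow> 'x \<Rightarrow> real) \<Rightarrow> 'x L2_op \<Rightarrow> bool" where
  "spectral_resolution M E T \<longleftrightarrow>
     projection_valued_measure M E \<and> T = spectral_integral M E (\<lambda>t. t)"

text \<open>
  The power \<open>T\<^sup>p = \<integral> t\<^sup>p dE(t)\<close> of a positive self-adjoint operator \<open>T\<close> on L2(M), where \<open>T\<close> has to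
  be injective if \<open>p < 0\<close>.  As \<open>E\<close> is then concentrated on \<open>[0,\<infinity>)\<close>, respectively on \<open>(0,\<infinity>)\<close>, only
  values \<open>t powr p\<close> with \<open>t \<ge> 0\<close>, respectively \<open>t > 0\<close>, matter (and \<open>0 powr p = 0\<close> for \<open>p > 0\<close>).
\<close>

definition L2_op_power :: "'x measure \<Rightarrow> 'x L2_op \<Rightarrow> real \<Rightarrow> 'x L2_op" where
  "L2_op_power M T p =
     {(u, v). \<exists>E. spectral_resolution M E T \<and> (u, v) \<in> spectral_integral M E (\<lambda>t. t powr p)}"


section \<open>Bounded Lipschitz domains\<close>

text \<open>
  Near every boundary point, \<open>\<Omega>\<close> is the part above the graph of a Lipschitz function \<open>h\<close> over the
  hyperplane orthogonal to some unit vector \<open>e\<close>; \<open>x - (x \<bullet> e) *\<^sub>R e\<close> is the projection of \<open>x\<close>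
  to that hyperplane.
\<close>

definition bounded_Lipschitz_domain :: "'a::euclidean_space set \<Rightarrow> bool" where
  "bounded_Lipschitz_domain \<Omega> \<longleftrightarrow> open \<Omega> \<and> connected \<Omega> \<and> \<Omega> \<noteq> {} \<and> bounded \<Omega> \<and>
     (\<forall>p\<in>frontier \<Omega>. \<exists>r>0. \<exists>e h L. norm e = 1 \<and> L-lipschitz_on {y. y \<bullet> e = 0} h \<and>
        \<Omega> \<inter> ball p r = {x \<in> ball p r. h (x - (x \<bullet> e) *\<^sub>R e) < x \<bullet> e})"


section \<open>Fractional Sobolev spaces and the operator \<open>I + (-\<Delta>)\<^sup>s\<close>\<close>

definition fracSobolev :: "real \<Rightarrow> ('a::euclidean_space \<Rightarrow> real) set" where
  "fracSobolev s = {u \<in> L2_space lebesgue.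
     integrable (lebesgue \<Otimes>\<^sub>M lebesgue)
       (\<lambda>(x, y). (u x - u y)\<^sup>2 / norm (x - y) powr (real DIM('a) + 2 * s))}"

definition H0s :: "'a::euclidean_space set \<Rightarrow> real \<Rightarrow> ('a \<Rightarrow> real) set" where
  "H0s \<Omega> s = {u \<in> fracSobolev s. AE x in lebesgue. x \<notin> \<Omega> \<longrightarrow> u x = 0}"

text \<open>The normalization constant of the integral fractional Laplacian in dimension \<open>N\<close>.\<close>

definition fracLap_const :: "nat \<Rightarrow> real \<Rightarrow> real" where
  "fracLap_const N s = 4 powr s * s * Gamma (real N / 2 + s) / (pi powr (real N / 2) * Gamma (1 - s))"

definition H0s_form ::
    "'a::euclidean_space set \<Rightarrow> real \<Rightarrow> ('a \<Rightarrow> real) \<Rightarrow> ('a \<Rightarrow> real) \<Rightarrow> real" where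
  "H0s_form \<Omega> s u v = (LINT x|lebesgue_on \<Omega>. u x * v x) +
     fracLap_const DIM('a) s / 2 *
       integral\<^sup>L (lebesgue \<Otimes>\<^sub>M lebesgue) (\<lambda>(x, y).
          (u x - u y) * (v x - v y) / norm (x - y) powr (real DIM('a) + 2 * s))"

definition H0s_norm :: "'a::euclidean_space set \<Rightarrow> real \<Rightarrow> ('a \<Rightarrow> real) \<Rightarrow> real" where
  "H0s_norm \<Omega> s u = sqrt (H0s_form \<Omega> s u u)"

text \<open>Passes from a function on \<open>\<Omega>\<close> to the corresponding function on the whole space.\<close>

definition zero_ext :: "'a set \<Rightarrow> ('a \<Rightarrow> real) \<Rightarrow> 'a \<Rightarrow> real" where
  "zero_ext \<Omega> u = (\<lambda>x. if x \<in> \<Omega> then u x else 0)"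

text \<open>
  The operator \<open>A\<^sub>s\<close> on L2(\<open>\<Omega>\<close>) associated with the form: \<open>A\<^sub>s u = f\<close> iff \<open>u \<in> H0s \<Omega> s\<close> and
  \<open>a\<^sub>s(u, v) = \<langle>f, v\<rangle>\<close> for all \<open>v \<in> H0s \<Omega> s\<close>.
\<close>

definition A_op :: "'a::euclidean_space set \<Rightarrow> real \<Rightarrow> 'a L2_op" where
  "A_op \<Omega> s = {(u, f). u \<in> L2_space (lebesgue_on \<Omega>) \<and> f \<in> L2_space (lebesgue_on \<Omega>) \<and>
     zero_ext \<Omega> u \<in> H0s \<Omega> s \<and>
     (\<forall>v\<in>H0s \<Omega> s. H0s_form \<Omega> s (zero_ext \<Omega> u) v = L2_inner (lebesgue_on \<Omega>) f v)}"


section \<open>The observation operators and Tikhonov regularization\<close>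

text \<open>The restriction \<open>K\<close> from \<open>H0s \<Omega> s\<close> (regarded as functions on \<open>\<Omega>\<close>) to L2(\<open>\<omega>\<close>).\<close>

definition K_op :: "'a::euclidean_space set \<Rightarrow> real \<Rightarrow> 'a set \<Rightarrow> 'a L2_op" where
  "K_op \<Omega> s \<omega> = {(u, g). u \<in> L2_space (lebesgue_on \<Omega>) \<and> zero_ext \<Omega> u \<in> H0s \<Omega> s \<and>
     g \<in> L2_space (lebesgue_on \<omega>) \<and> (AE x in lebesgue_on \<omega>. g x = u x)}"

text \<open>\<open>B = K A\<^sub>s\<^sup>-\<^sup>1\<^sup>/\<^sup>2\<close>\<close>

definition B_op :: "'a::euclidean_space set \<Rightarrow> real \<Rightarrow> 'a set \<Rightarrow> 'a L2_op" where
  "B_op \<Omega> s \<omega> = L2_op_power (lebesgue_on \<Omega>) (A_op \<Omega> s) (- 1 / 2) O K_op \<Omega> s \<omega>"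

text \<open>\<open>B\<^sup>* B\<close>\<close>

definition BB_op :: "'a::euclidean_space set \<Rightarrow> real \<Rightarrow> 'a set \<Rightarrow> 'a L2_op" where
  "BB_op \<Omega> s \<omega> =
     B_op \<Omega> s \<omega> O L2_adjoint (lebesgue_on \<Omega>) (lebesgue_on \<omega>) (B_op \<Omega> s \<omega>)"

text \<open>The minimizer is unique up to almost everywhere equality; \<open>arg_min\<close> selects a representative.\<close>

definition tikhonov ::
    "'a::euclidean_space set \<Rightarrow> real \<Rightarrow> 'a set \<Rightarrow> real \<Rightarrow> ('a \<Rightarrow> real) \<Rightarrow> 'a \<Rightarrow> real" where
  "tikhonov \<Omega> s \<omega> \<alpha> y = arg_min
     (\<lambda>u. 1 / 2 * (L2_norm (lebesgue_on \<omega>) (\<lambda>x. u x - y x))\<^sup>2 + \<alpha> / 2 * (H0s_norm \<Omega> s u)\<^sup>2)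
     (\<lambda>u. u \<in> H0s \<Omega> s)"

text \<open>The case distinction is needed since \<open>0 powr 0 = 0\<close>.\<close>

definition c_beta :: "real \<Rightarrow> real" where
  "c_beta \<beta> = (if \<beta> = 1 then 1 else \<beta> powr \<beta> * (1 - \<beta>) powr (1 - \<beta>))"

end

theory Submission
  imports Defs
begin

text \<open>
  Euler--Lagrange splits the error \<open>u\<^sub>\<alpha> - u\<close> into a bias \<open>e\<close> and a noise part \<open>n\<close>, the solutions in
  \<open>H\<^sub>0\<^sup>s\<close> of \<open>Q e v = - \<alpha> a(u, v)\<close> and \<open>Q n v = \<langle>\<eta>, v\<rangle>\<^sub>\<omega>\<close>, where \<open>Q = \<langle>\<cdot>, \<cdot>\<rangle>\<^sub>\<omega> + \<alpha> a\<close>. Testing the second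
  equation with \<open>n\<close> gives \<open>a(n, n) \<le> \<parallel>\<eta>\<parallel>\<^sup>2 / (4 \<alpha>)\<close>. For the first, \<open>e = A\<^sup>-\<^sup>1\<^sup>/\<^sup>2 f\<close> with
  \<open>f = - \<alpha> (B\<^sup>* B + \<alpha>)\<^sup>-\<^sup>1 (B\<^sup>* B)\<^sup>\<beta> w\<close>, so that \<open>a(e, e) \<le> \<parallel>f\<parallel>\<^sup>2\<close> is controlled by the supremum
  \<open>c\<^sub>\<beta> \<alpha>\<^sup>\<beta>\<close> of \<open>\<alpha> t\<^sup>\<beta> / (t + \<alpha>)\<close> over \<open>t \<ge> 0\<close>. The spectral resolutions of \<open>A\<close> and \<open>B\<^sup>* B\<close> are provided by
  the hypotheses, and only a bounded functional calculus for them is needed. The error depends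
  on the noise in a Lipschitz way, hence is measurable.
\<close>

section \<open>Hilbert spaces of functions\<close>

text \<open>Functions stand for their classes, so the forms are only positive semidefinite, and
  vectors are compared through inner products with arbitrary test vectors rather than pointwise. An
  element of \<open>H0s\<close> vanishes outside \<Omega> only almost everywhere, so it may differ
  from the extension by zero of its values on \<Omega>; lower semicontinuity of the energy absorbs
  this difference. \<open>L2_op_power\<close> hides a spectral resolution under an existential
  quantifier. The resolution behind z = A^(1/2) u and the one inside \<open>B_op\<close> may
  therefore differ; the unbounded power A^(1/2) is traded for the bounded A^(-1/2), which is shown
  to be the same for both. That A^(-1/2) maps into \<open>H0s\<close> with a(e, e) \<le> ||f||^2 is
  itself to be proved: on the range of the resolvent the form is known, and the estimate reaches the
  other vectors by approximation from there.\<close>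

lemma quadratic_nonneg_imp_zero:
  fixes q d :: real
  assumes "\<And>t. 0 \<le> t\<^sup>2 * q + 2 * t * d" "0 \<le> q"
  shows "d = 0"
proof -
  \<comment> \<open>The optimal t is - d / q; adding 1 to the denominator covers q = 0 as well and
    still gives a negative value unless d = 0.\<close>
  have "0 \<le> (- d / (q + 1))\<^sup>2 * q + 2 * (- d / (q + 1)) * d" by (rule assms)
  also have "\<dots> = - d\<^sup>2 * (q + 2) / (q + 1)\<^sup>2"
    using assms(2) by (simp add: divide_simps power2_eq_square) (simp add: algebra_simps)
  finally have "d\<^sup>2 * (q + 2) / (q + 1)\<^sup>2 \<le> 0" by simp
  then have "d\<^sup>2 * (q + 2) \<le> 0" using assms(2) by (simp add: divide_le_0_iff)
  then show ?thesis using assms(2) by (simp add: mult_le_0_iff)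
qed

text \<open>Definiteness is left out because members are representatives of classes. The instances
  are the L2 spaces, \<open>H0s\<close> with the energy form and with \<open>Q\<close>, and the
  forms \<open>bil\<close> of nonnegative bounded functions, for which even nonzero classes may be
  null.\<close>

locale semi_ip =
  fixes C :: "('x \<Rightarrow> real) set" and Q :: "('x \<Rightarrow> real) \<Rightarrow> ('x \<Rightarrow> real) \<Rightarrow> real"
  assumes zero_in: "(\<lambda>x. 0) \<in> C"
    and lin_in: "\<And>f g a b. f \<in> C \<Longrightarrow> g \<in> C \<Longrightarrow> (\<lambda>x. a * f x + b * g x) \<in> C"
    and sym: "\<And>f g. f \<in> C \<Longrightarrow> g \<in> C \<Longrightarrow> Q f g = Q g f"
    and lin: "\<And>f g h a b. f \<in> C \<Longrightarrow> g \<in> C \<Longrightarrow> h \<in> C \<Longrightarrow>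
        Q (\<lambda>x. a * f x + b * g x) h = a * Q f h + b * Q g h"
    and nonneg: "\<And>f. f \<in> C \<Longrightarrow> 0 \<le> Q f f"
begin

lemma add_in: "f \<in> C \<Longrightarrow> g \<in> C \<Longrightarrow> (\<lambda>x. f x + g x) \<in> C"
  using lin_in[of f g 1 1] by simp

lemma diff_in: "f \<in> C \<Longrightarrow> g \<in> C \<Longrightarrow> (\<lambda>x. f x - g x) \<in> C"
  using lin_in[of f g 1 "-1"] by simp

lemma scale_in: "f \<in> C \<Longrightarrow> (\<lambda>x. a * f x) \<in> C"
  using lin_in[of f f a 0] by simp

lemma lin_right:
  assumes "f \<in> C" "g \<in> C" "h \<in> C"
  shows "Q h (\<lambda>x. a * f x + b * g x) = a * Q h f + b * Q h g"
  using assms by (simp add: sym[of h] lin lin_in)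

lemma add_left: "f \<in> C \<Longrightarrow> g \<in> C \<Longrightarrow> h \<in> C \<Longrightarrow> Q (\<lambda>x. f x + g x) h = Q f h + Q g h"
  using lin[of f g h 1 1] by simp

lemma diff_left: "f \<in> C \<Longrightarrow> g \<in> C \<Longrightarrow> h \<in> C \<Longrightarrow> Q (\<lambda>x. f x - g x) h = Q f h - Q g h"
  using lin[of f g h 1 "-1"] by simp

lemma scale_left: "f \<in> C \<Longrightarrow> h \<in> C \<Longrightarrow> Q (\<lambda>x. a * f x) h = a * Q f h"
  using lin[of f f h a 0] by simp

lemma add_right: "f \<in> C \<Longrightarrow> g \<in> C \<Longrightarrow> h \<in> C \<Longrightarrow> Q h (\<lambda>x. f x + g x) = Q h f + Q h g"
  using lin_right[of f g h 1 1] by simp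

lemma diff_right: "f \<in> C \<Longrightarrow> g \<in> C \<Longrightarrow> h \<in> C \<Longrightarrow> Q h (\<lambda>x. f x - g x) = Q h f - Q h g"
  using lin_right[of f g h 1 "-1"] by simp

lemma scale_right: "f \<in> C \<Longrightarrow> h \<in> C \<Longrightarrow> Q h (\<lambda>x. a * f x) = a * Q h f"
  using lin_right[of f f h a 0] by simp

lemma zero_left: "h \<in> C \<Longrightarrow> Q (\<lambda>x. 0) h = 0"
  using scale_left[of h h 0] by simp

lemmas closed = zero_in lin_in add_in diff_in scale_in

lemmas expand = lin lin_right add_left diff_left scale_left add_right diff_right scale_right closed

lemma square_lin:
  "f \<in> C \<Longrightarrow> g \<in> C \<Longrightarrow> Q (\<lambda>x. a * f x + b * g x) (\<lambda>x. a * f x + b * g x)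
    = a\<^sup>2 * Q f f + 2 * a * b * Q f g + b\<^sup>2 * Q g g"
  by (simp add: expand sym[of g f] algebra_simps power2_eq_square)

lemma square_add:
  "f \<in> C \<Longrightarrow> g \<in> C \<Longrightarrow> Q (\<lambda>x. f x + g x) (\<lambda>x. f x + g x) = Q f f + 2 * Q f g + Q g g"
  using square_lin[of f g 1 1] by simp

lemma square_diff:
  "f \<in> C \<Longrightarrow> g \<in> C \<Longrightarrow> Q (\<lambda>x. f x - g x) (\<lambda>x. f x - g x) = Q f f - 2 * Q f g + Q g g"
  using square_lin[of f g 1 "-1"] by simp

lemma square_add_le:
  assumes "f \<in> C" "g \<in> C"
  shows "Q (\<lambda>x. f x + g x) (\<lambda>x. f x + g x) \<le> 2 * Q f f + 2 * Q g g"
  using nonneg[OF diff_in[OF assms]] assms by (simp add: square_add square_diff)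

lemma square_diff_le:
  assumes "f \<in> C" "g \<in> C"
  shows "Q (\<lambda>x. f x - g x) (\<lambda>x. f x - g x) \<le> 2 * Q f f + 2 * Q g g"
  using nonneg[OF add_in[OF assms]] assms by (simp add: square_add square_diff)

lemma Cauchy_Schwarz:
  assumes "f \<in> C" "g \<in> C"
  shows "(Q f g)\<^sup>2 \<le> Q f f * Q g g"
proof (cases "Q g g = 0")
  case True
  have "0 \<le> t\<^sup>2 * Q f f + 2 * t * Q f g" for t
    using nonneg[of "\<lambda>x. t * f x + 1 * g x"] square_lin[of f g t 1] True assms lin_in[of f g t 1] by simp
  then have "Q f g = 0" using quadratic_nonneg_imp_zero nonneg assms by blast
  then show ?thesis using True by simp
next
  case False
  let ?a = "Q g g" and ?b = "- Q f g"
  have "0 \<le> ?a\<^sup>2 * Q f f + 2 * ?a * ?b * Q f g + ?b\<^sup>2 * Q g g"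
    using nonneg[of "\<lambda>x. ?a * f x + ?b * g x"] square_lin[of f g ?a ?b] assms lin_in[of f g ?a ?b] by simp
  also have "\<dots> = ?a * (Q f f * Q g g - (Q f g)\<^sup>2)"
    by (simp add: algebra_simps power2_eq_square)
  finally show ?thesis using False nonneg[OF assms(2)] by (simp add: zero_le_mult_iff)
qed

lemma Cauchy_Schwarz_abs:
  assumes "f \<in> C" "g \<in> C"
  shows "\<bar>Q f g\<bar> \<le> sqrt (Q f f) * sqrt (Q g g)"
  using real_sqrt_le_mono[OF Cauchy_Schwarz[OF assms]] by (simp add: real_sqrt_mult)

lemma null_left:
  assumes "f \<in> C" "g \<in> C" "Q f f = 0"
  shows "Q f g = 0"
  using Cauchy_Schwarz[OF assms(1,2)] assms(3) by simp

lemma norm_triangle: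
  assumes "f \<in> C" "g \<in> C"
  shows "sqrt (Q (\<lambda>x. f x + g x) (\<lambda>x. f x + g x)) \<le> sqrt (Q f f) + sqrt (Q g g)"
proof (rule real_le_lsqrt)
  have "Q f g \<le> sqrt (Q f f) * sqrt (Q g g)" using Cauchy_Schwarz_abs[OF assms] by simp
  then show "Q (\<lambda>x. f x + g x) (\<lambda>x. f x + g x) \<le> (sqrt (Q f f) + sqrt (Q g g))\<^sup>2"
    using assms nonneg by (simp add: square_add power2_sum)
qed (use assms nonneg closed in auto)

lemma tendsto_left:
  assumes X: "\<And>n. X n \<in> C" and "f \<in> C" "g \<in> C"
    and lim: "(\<lambda>n. Q (\<lambda>x. X n x - f x) (\<lambda>x. X n x - f x)) \<longlonglongrightarrow> 0"
  shows "(\<lambda>n. Q (X n) g) \<longlonglongrightarrow> Q f g"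
proof -
  have "(\<lambda>n. Q (X n) g - Q f g) \<longlonglongrightarrow> 0"
  proof (rule Lim_null_comparison)
    show "\<forall>\<^sub>F n in sequentially. norm (Q (X n) g - Q f g)
        \<le> sqrt (Q (\<lambda>x. X n x - f x) (\<lambda>x. X n x - f x)) * sqrt (Q g g)"
      using Cauchy_Schwarz_abs[OF diff_in[OF X assms(2)] assms(3)] assms
      by (intro always_eventually) (simp add: expand)
    show "(\<lambda>n. sqrt (Q (\<lambda>x. X n x - f x) (\<lambda>x. X n x - f x)) * sqrt (Q g g)) \<longlonglongrightarrow> 0"
      using tendsto_mult_left_zero[OF tendsto_real_sqrt[OF lim, simplified]] by simp
  qed
  then show ?thesis by (simp add: LIM_zero_iff)
qed

text \<open>Scaling: replacing g by t g bounds |F g| by K (1 / t + t Q g g), and t = 1 / sqrt (Q g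
  g) balances the two terms. It serves \<open>fc_ex\<close>, where polarization gives a bound that
  is not homogeneous in g.\<close>

lemma bounded_functional:
  assumes F: "\<And>g t. g \<in> C \<Longrightarrow> F (\<lambda>x. t * g x) = t * F g"
    and K: "\<And>g. g \<in> C \<Longrightarrow> \<bar>F g\<bar> \<le> K * (1 + Q g g)" and "g \<in> C"
  shows "(F g)\<^sup>2 \<le> 4 * K\<^sup>2 * Q g g"
proof -
  have *: "t * \<bar>F g\<bar> \<le> K * (1 + t\<^sup>2 * Q g g)" if "t > 0" for t
    using K[OF scale_in[OF assms(3), of t]] F[OF assms(3), of t] that assms(3)
    by (simp add: abs_mult expand power2_eq_square algebra_simps)
  show ?thesis
  proof (cases "Q g g = 0")
    case True
    have "\<bar>F g\<bar> = 0"
    proof (rule ccontr)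
      assume "\<bar>F g\<bar> \<noteq> 0"
      \<comment> \<open>This scaling would give |K| + 1 \<le> K.\<close>
      then show False using *[of "(\<bar>K\<bar> + 1) / \<bar>F g\<bar>"] True by simp
    qed
    then show ?thesis using True by simp
  next
    case False
    then have q: "Q g g > 0" using nonneg[OF assms(3)] by simp
    then have "\<bar>F g\<bar> / sqrt (Q g g) \<le> 2 * K"
      using *[of "1 / sqrt (Q g g)"] by (simp add: power_divide)
    then have "\<bar>F g\<bar> \<le> 2 * K * sqrt (Q g g)" using q by (simp add: divide_simps)
    then have "\<bar>F g\<bar>\<^sup>2 \<le> (2 * K * sqrt (Q g g))\<^sup>2" by (intro power_mono) auto
    then show ?thesis using q by (simp add: power_mult_distrib)
  qed
qed

end

locale semi_hilbert = semi_ip +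
  assumes complete: "\<And>X. (\<And>n. X n \<in> C) \<Longrightarrow>
      (\<And>e. 0 < e \<Longrightarrow> \<exists>N. \<forall>m\<ge>N. \<forall>n\<ge>N. Q (\<lambda>x. X m x - X n x) (\<lambda>x. X m x - X n x) < e) \<Longrightarrow>
      \<exists>f\<in>C. (\<lambda>n. Q (\<lambda>x. X n x - f x) (\<lambda>x. X n x - f x)) \<longlonglongrightarrow> 0"
begin

text \<open>The representer is the limit of a minimizing sequence of the functional
  \<open>J\<close>; the parallelogram identity makes such a sequence Cauchy. This variational route
  involves neither orthogonal complements nor a quotient by null vectors.\<close>

lemma Riesz:
  assumes F: "\<And>f g a b. f \<in> C \<Longrightarrow> g \<in> C \<Longrightarrow> F (\<lambda>x. a * f x + b * g x) = a * F f + b * F g"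
    and K: "\<And>g. g \<in> C \<Longrightarrow> (F g)\<^sup>2 \<le> K * Q g g"
  shows "\<exists>v\<in>C. \<forall>g\<in>C. Q v g = F g"
proof -
  define J where "J g = Q g g - 2 * F g" for g
  define m where "m = Inf (J ` C)"
  \<comment> \<open>With c = |K| + 1 and q = Q g g: (2 F g)^2 \<le> 4 c q \<le> (c + q)^2, hence 2 F
    g - q \<le> c.\<close>
  have "- (\<bar>K\<bar> + 1) \<le> J g" if "g \<in> C" for g
  proof -
    have "(F g)\<^sup>2 \<le> (\<bar>K\<bar> + 1) * Q g g"
      using K[OF that] nonneg[OF that] by (smt (verit) mult_right_mono)
    then have "(2 * F g)\<^sup>2 \<le> 4 * ((\<bar>K\<bar> + 1) * Q g g) + ((\<bar>K\<bar> + 1) - Q g g)\<^sup>2"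
      by (simp add: power_mult_distrib add_increasing2)
    also have "\<dots> = ((\<bar>K\<bar> + 1) + Q g g)\<^sup>2"
      by (simp add: power2_eq_square algebra_simps)
    finally have "(2 * F g)\<^sup>2 \<le> ((\<bar>K\<bar> + 1) + Q g g)\<^sup>2" .
    then have "2 * F g \<le> (\<bar>K\<bar> + 1) + Q g g"
      using nonneg[OF that] abs_le_square_iff[of "2 * F g" "(\<bar>K\<bar> + 1) + Q g g"] by simp
    then show ?thesis by (simp add: J_def)
  qed
  then have bdd: "bdd_below (J ` C)" by (meson bdd_belowI2)
  then have mle: "m \<le> J g" if "g \<in> C" for g
    unfolding m_def using that by (simp add: cInf_lower)
  have "\<exists>g\<in>C. J g < m + 1 / real (Suc n)" for n
  proof -
    have "Inf (J ` C) < m + 1 / real (Suc n)" by (simp add: m_def)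
    then show ?thesis using cInf_less_iff[of "J ` C"] bdd zero_in by auto
  qed
  then obtain X where X: "\<And>n. X n \<in> C" "\<And>n. J (X n) < m + 1 / real (Suc n)" by metis
  have dist: "Q (\<lambda>x. X i x - X j x) (\<lambda>x. X i x - X j x) \<le> 2 / real (Suc i) + 2 / real (Suc j)" for i j
  proof -
    \<comment> \<open>The midpoint cannot go below m, so the parallelogram identity bounds the
      distance of \<open>X i\<close> and \<open>X j\<close> by their excess over m.\<close>
    let ?h = "\<lambda>x. (1/2) * X i x + (1/2) * X j x"
    have "m \<le> J ?h" using mle lin_in X(1) by blast
    also have "J ?h = (J (X i) + J (X j)) / 2 - Q (\<lambda>x. X i x - X j x) (\<lambda>x. X i x - X j x) / 4"
      unfolding J_def square_lin[OF X(1) X(1)] square_diff[OF X(1) X(1)] F[OF X(1) X(1)]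
      by (simp add: field_simps power2_eq_square)
    finally have "Q (\<lambda>x. X i x - X j x) (\<lambda>x. X i x - X j x)
        \<le> 2 * (J (X i) - m) + 2 * (J (X j) - m)" by (simp add: field_simps)
    also have "\<dots> \<le> 2 * (1 / real (Suc i)) + 2 * (1 / real (Suc j))"
      using X(2)[of i] X(2)[of j] by (intro add_mono mult_left_mono) auto
    finally show ?thesis by simp
  qed
  have "\<exists>N. \<forall>m\<ge>N. \<forall>n\<ge>N. Q (\<lambda>x. X m x - X n x) (\<lambda>x. X m x - X n x) < e" if "e > 0" for e
  proof -
    obtain N where N: "4 / e < real N" using reals_Archimedean2 by blast
    have small: "2 / real (Suc i) < e / 2" if "N \<le> i" for i
    proof -
      have "4 / e < real (Suc i)" using N that by linarith
      then show ?thesis using \<open>e > 0\<close> by (simp add: field_simps)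
    qed
    show ?thesis
    proof (intro exI[of _ N] allI impI)
      fix i j assume "N \<le> i" "N \<le> j"
      then show "Q (\<lambda>x. X i x - X j x) (\<lambda>x. X i x - X j x) < e"
        using dist[of i j] small[of i] small[of j] by linarith
    qed
  qed
  from complete[OF X(1) this] obtain v where v: "v \<in> C"
    "(\<lambda>n. Q (\<lambda>x. X n x - v x) (\<lambda>x. X n x - v x)) \<longlonglongrightarrow> 0" by blast
  have "Q v g = F g" if g: "g \<in> C" for g
  proof -
    \<comment> \<open>The variation along t g is taken at the almost minimizers \<open>X n\<close>,
      where it is at least - 1 / (n + 1), and only then passed to the limit.\<close>
    have "0 \<le> t\<^sup>2 * Q g g + 2 * t * (Q v g - F g)" for t
    proof (rule LIMSEQ_le[OF _ _ exI[of _ 0]])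
      show "(\<lambda>n. - 1 / real (Suc n)) \<longlonglongrightarrow> 0"
        using tendsto_minus[OF LIMSEQ_inverse_real_of_nat] by (simp add: inverse_eq_divide)
      show "(\<lambda>n. t\<^sup>2 * Q g g + 2 * t * (Q (X n) g - F g)) \<longlonglongrightarrow> t\<^sup>2 * Q g g + 2 * t * (Q v g - F g)"
        by (intro tendsto_intros tendsto_left X v g)
      show "\<forall>n\<ge>0. - 1 / real (Suc n) \<le> t\<^sup>2 * Q g g + 2 * t * (Q (X n) g - F g)"
      proof (intro allI impI)
        fix n
        have "m \<le> J (\<lambda>x. 1 * X n x + t * g x)" using mle lin_in X(1) g by blast
        also have "\<dots> = J (X n) + t\<^sup>2 * Q g g + 2 * t * (Q (X n) g - F g)"
          unfolding J_def square_lin[OF X(1) g] F[OF X(1) g] by (simp add: algebra_simps)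
        finally show "- 1 / real (Suc n) \<le> t\<^sup>2 * Q g g + 2 * t * (Q (X n) g - F g)"
          using X(2)[of n] by simp
      qed
    qed
    then show ?thesis using quadratic_nonneg_imp_zero nonneg[OF g] by fastforce
  qed
  then show ?thesis using v by blast
qed

end

section \<open>L2 spaces: completeness and a.e. convergent subsequences\<close>

lemma L2_spaceD:
  assumes "f \<in> L2_space M"
  shows "f \<in> borel_measurable M" "integrable M (\<lambda>x. (f x)\<^sup>2)"
  using assms by (auto simp: L2_space_def)

lemma integrable_square_lin:
  fixes f g :: "'x \<Rightarrow> real"
  assumes [measurable]: "f \<in> borel_measurable M" "g \<in> borel_measurable M"
    and "integrable M (\<lambda>x. (f x)\<^sup>2)" "integrable M (\<lambda>x. (g x)\<^sup>2)"
  shows "integrable M (\<lambda>x. (a * f x + b * g x)\<^sup>2)"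
proof (rule Bochner_Integration.integrable_bound)
  show "integrable M (\<lambda>x. 2 * a\<^sup>2 * (f x)\<^sup>2 + 2 * b\<^sup>2 * (g x)\<^sup>2)"
    using assms by simp
  have "(a * f x + b * g x)\<^sup>2 \<le> 2 * a\<^sup>2 * (f x)\<^sup>2 + 2 * b\<^sup>2 * (g x)\<^sup>2" for x
    using sum_squares_bound[of "a * f x" "b * g x"] by (simp add: power2_sum power_mult_distrib)
  then show "AE x in M. norm ((a * f x + b * g x)\<^sup>2) \<le> norm (2 * a\<^sup>2 * (f x)\<^sup>2 + 2 * b\<^sup>2 * (g x)\<^sup>2)"
    by simp
qed measurable

lemma integrable_mult_square:
  fixes f g :: "'x \<Rightarrow> real"
  assumes [measurable]: "f \<in> borel_measurable M" "g \<in> borel_measurable M"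
    and "integrable M (\<lambda>x. (f x)\<^sup>2)" "integrable M (\<lambda>x. (g x)\<^sup>2)"
  shows "integrable M (\<lambda>x. f x * g x)"
proof (rule Bochner_Integration.integrable_bound)
  show "integrable M (\<lambda>x. (f x)\<^sup>2 + (g x)\<^sup>2)" using assms by simp
  have "\<bar>f x * g x\<bar> \<le> (f x)\<^sup>2 + (g x)\<^sup>2" for x
    using sum_squares_bound[of "\<bar>f x\<bar>" "\<bar>g x\<bar>"] mult_nonneg_nonneg[of "\<bar>f x\<bar>" "\<bar>g x\<bar>"]
    unfolding abs_mult power2_abs by linarith
  then show "AE x in M. norm (f x * g x) \<le> norm ((f x)\<^sup>2 + (g x)\<^sup>2)"
    by simp
qed measurable

lemma L2_integrable_mult: "f \<in> L2_space M \<Longrightarrow> g \<in> L2_space M \<Longrightarrow> integrable M (\<lambda>x. f x * g x)"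
  by (auto simp: L2_space_def intro: integrable_mult_square)

lemma L2_semi_ip: "semi_ip (L2_space M) (L2_inner M)"
proof
  show "(\<lambda>x. 0) \<in> L2_space M" by (simp add: L2_space_def)
  show "(\<lambda>x. a * f x + b * g x) \<in> L2_space M" if "f \<in> L2_space M" "g \<in> L2_space M" for f g a b
    using that by (auto simp: L2_space_def integrable_square_lin)
  show "L2_inner M f g = L2_inner M g f" for f g
    by (simp add: L2_inner_def mult.commute)
  show "L2_inner M (\<lambda>x. a * f x + b * g x) h = a * L2_inner M f h + b * L2_inner M g h"
    if "f \<in> L2_space M" "g \<in> L2_space M" "h \<in> L2_space M" for f g h a b
    unfolding L2_inner_def
    using L2_integrable_mult[OF that(1,3)] L2_integrable_mult[OF that(2,3)]
    by (simp add: distrib_right mult.assoc)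
  show "0 \<le> L2_inner M f f" for f
    by (simp add: L2_inner_def)
qed

text \<open>For an infinite measure, L2 bounds do not control the integrals of the increments
  \<open>D n\<close>. Instead the series of 2^n (D n)^2 has finite integral, hence a finite sum S
  a.e.; each term is at most S, so |D n| is dominated by the geometric sequence sqrt S * 2^(- n /
  2).\<close>

lemma AE_convergent_of_fast_L2_Cauchy:
  assumes X: "\<And>n. X n \<in> L2_space M"
    and fast: "\<And>n. L2_inner M (\<lambda>x. X (Suc n) x - X n x) (\<lambda>x. X (Suc n) x - X n x) \<le> (1/4) ^ n"
  shows "AE x in M. convergent (\<lambda>n. X n x)"
proof -
  interpret L: semi_ip "L2_space M" "L2_inner M" by (rule L2_semi_ip)
  define D where "D n x = X (Suc n) x - X n x" for n x
  have D: "D n \<in> L2_space M" for n unfolding D_def by (rule L.diff_in[OF X X])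
  have [measurable]: "D n \<in> borel_measurable M" for n using D L2_spaceD by blast
  have "(\<integral>\<^sup>+ x. (\<Sum>n. ennreal (2 ^ n * (D n x)\<^sup>2)) \<partial>M) = (\<Sum>n. \<integral>\<^sup>+ x. ennreal (2 ^ n * (D n x)\<^sup>2) \<partial>M)"
    by (rule nn_integral_suminf) measurable
  also have "\<dots> \<le> (\<Sum>n. ennreal ((1/2) ^ n))"
  proof (rule suminf_le)
    fix n
    have "(\<integral>\<^sup>+ x. ennreal (2 ^ n * (D n x)\<^sup>2) \<partial>M) = ennreal (2 ^ n * L2_inner M (D n) (D n))"
      using L2_spaceD(2)[OF D[of n]]
      by (subst nn_integral_eq_integral) (auto simp: L2_inner_def power2_eq_square)
    also have "\<dots> \<le> ennreal (2 ^ n * (1/4) ^ n)"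
      using fast[of n] by (intro ennreal_leI mult_left_mono) (auto simp: D_def[abs_def])
    also have "(2::real) ^ n * (1/4) ^ n = (1/2) ^ n" by (simp flip: power_mult_distrib)
    finally show "(\<integral>\<^sup>+ x. ennreal (2 ^ n * (D n x)\<^sup>2) \<partial>M) \<le> ennreal ((1/2) ^ n)" .
  qed auto
  also have "\<dots> = ennreal (\<Sum>n. (1/2) ^ n)" by (intro suminf_ennreal2 summable_geometric) auto
  also have "\<dots> < \<infinity>" by simp
  finally have "(\<integral>\<^sup>+ x. (\<Sum>n. ennreal (2 ^ n * (D n x)\<^sup>2)) \<partial>M) \<noteq> \<infinity>" by simp
  then have "AE x in M. (\<Sum>n. ennreal (2 ^ n * (D n x)\<^sup>2)) \<noteq> \<infinity>"
    by (intro nn_integral_PInf_AE) auto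
  then show ?thesis
  proof (eventually_elim)
    case (elim x)
    have s: "summable (\<lambda>n. 2 ^ n * (D n x)\<^sup>2)"
      using elim by (intro summable_suminf_not_top) auto
    define S where "S = (\<Sum>n. 2 ^ n * (D n x)\<^sup>2)"
    have le: "2 ^ n * (D n x)\<^sup>2 \<le> S" for n
      unfolding S_def using sum_le_suminf[OF s, of "{n}"] by simp
    have "summable (\<lambda>n. D n x)"
    proof (rule summable_comparison_test')
      show "summable (\<lambda>n. sqrt S * (sqrt (1/2)) ^ n)"
        by (intro summable_mult summable_geometric) simp
      show "norm (D n x) \<le> sqrt S * (sqrt (1/2)) ^ n" for n
      proof -
        have "(D n x)\<^sup>2 \<le> S * (1/2) ^ n" using le[of n] by (simp add: field_simps power_divide)
        then have "\<bar>D n x\<bar> \<le> sqrt (S * (1/2) ^ n)" by (intro real_le_rsqrt) simp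
        then show ?thesis by (simp only: real_sqrt_mult real_sqrt_power real_norm_def)
      qed
    qed
    then have "convergent (\<lambda>n. \<Sum>k<n. D k x)" by (simp add: summable_iff_convergent)
    moreover have "(\<Sum>k<n. D k x) = X n x - X 0 x" for n
      unfolding D_def by (rule sum_lessThan_telescope)
    ultimately have "convergent (\<lambda>n. (X n x - X 0 x) + X 0 x)"
      by (intro convergent_add) (auto intro: convergent_const)
    then show ?case by simp
  qed
qed

text \<open>Membership in L2 is part of the conclusion, since the pointwise limit is at first only
  measurable. The bound is asked from \<open>N\<close> on only, as it comes from tails of Cauchy
  sequences.\<close>

lemma L2_Fatou:
  assumes X: "\<And>n. X n \<in> L2_space M" and f[measurable]: "f \<in> borel_measurable M"
    and lim: "AE x in M. (\<lambda>n. X n x) \<longlonglongrightarrow> f x"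
    and c: "\<And>n. N \<le> n \<Longrightarrow> L2_inner M (X n) (X n) \<le> c"
  shows "f \<in> L2_space M" "L2_inner M f f \<le> c"
proof -
  have [measurable]: "X n \<in> borel_measurable M" for n using X L2_spaceD by blast
  have c0: "0 \<le> c" using c[of N] semi_ip.nonneg[OF L2_semi_ip X, of N] by simp
  have "(\<integral>\<^sup>+ x. ennreal ((f x)\<^sup>2) \<partial>M) = (\<integral>\<^sup>+ x. liminf (\<lambda>n. ennreal ((X n x)\<^sup>2)) \<partial>M)"
    using lim
  proof (intro nn_integral_cong_AE, eventually_elim)
    case (elim x)
    then have "(\<lambda>n. ennreal ((X n x)\<^sup>2)) \<longlonglongrightarrow> ennreal ((f x)\<^sup>2)"
      by (intro tendsto_ennrealI tendsto_intros)
    from lim_imp_Liminf[OF sequentially_bot this] show ?case by (rule sym)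
  qed
  also have "\<dots> \<le> liminf (\<lambda>n. \<integral>\<^sup>+ x. ennreal ((X n x)\<^sup>2) \<partial>M)"
    by (intro nn_integral_liminf) measurable
  also have "\<dots> \<le> liminf (\<lambda>n. ennreal c)"
  proof (intro Liminf_mono eventually_sequentiallyI[of N])
    fix n assume "N \<le> n"
    have "(\<integral>\<^sup>+ x. ennreal ((X n x)\<^sup>2) \<partial>M) = ennreal (L2_inner M (X n) (X n))"
      using L2_spaceD(2)[OF X[of n]]
      by (subst nn_integral_eq_integral) (auto simp: L2_inner_def power2_eq_square)
    then show "(\<integral>\<^sup>+ x. ennreal ((X n x)\<^sup>2) \<partial>M) \<le> ennreal c"
      using c[OF \<open>N \<le> n\<close>] by (simp add: ennreal_leI)
  qed
  finally have *: "(\<integral>\<^sup>+ x. ennreal ((f x)\<^sup>2) \<partial>M) \<le> ennreal c" by (simp add: Liminf_const)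
  then have int: "integrable M (\<lambda>x. (f x)\<^sup>2)"
    by (intro integrableI_bounded) (auto simp: le_less_trans)
  then show "f \<in> L2_space M" by (simp add: L2_space_def)
  show "L2_inner M f f \<le> c"
    using * int c0 by (subst (asm) nn_integral_eq_integral) (auto simp: L2_inner_def power2_eq_square)
qed

lemma Cauchy_fast_subseq:
  fixes d :: "nat \<Rightarrow> nat \<Rightarrow> real"
  assumes "\<And>e. 0 < e \<Longrightarrow> \<exists>N. \<forall>m\<ge>N. \<forall>n\<ge>N. d m n < e"
  obtains r :: "nat \<Rightarrow> nat" where "strict_mono r" "\<And>n m. r n \<le> m \<Longrightarrow> d m (r n) \<le> (1/4) ^ n"
proof -
  obtain N where N: "\<And>k m n. N k \<le> m \<Longrightarrow> N k \<le> n \<Longrightarrow> d m n < (1/4) ^ k"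
    using assms[of "(1/4) ^ k" for k] by (metis zero_less_divide_1_iff zero_less_numeral zero_less_power)
  \<comment> \<open>The maximum forces strict growth and at the same time keeps \<open>r k\<close>
    above the threshold \<open>N k\<close>.\<close>
  define r where "r = rec_nat (N 0) (\<lambda>k i. max (Suc i) (N (Suc k)))"
  have r: "r (Suc k) = max (Suc (r k)) (N (Suc k))" "N k \<le> r k" for k
    by (simp_all add: r_def) (cases k; simp)
  show ?thesis
  proof
    show "strict_mono r" by (rule strict_monoI_Suc) (simp add: r)
    show "d m (r n) \<le> (1/4) ^ n" if "r n \<le> m" for n m
      using N[of n m "r n"] r(2)[of n] that by simp
  qed
qed

lemma L2_AE_subseq:
  assumes X: "\<And>n. X n \<in> L2_space M"
    and Cauchy: "\<And>e. 0 < e \<Longrightarrow>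
      \<exists>N. \<forall>m\<ge>N. \<forall>n\<ge>N. L2_inner M (\<lambda>x. X m x - X n x) (\<lambda>x. X m x - X n x) < e"
  obtains r :: "nat \<Rightarrow> nat" and f where "strict_mono r" "f \<in> borel_measurable M"
    "AE x in M. (\<lambda>n. X (r n) x) \<longlonglongrightarrow> f x"
proof -
  from Cauchy_fast_subseq[OF Cauchy] obtain r where r: "strict_mono r"
    "\<And>n m. r n \<le> m \<Longrightarrow> L2_inner M (\<lambda>x. X m x - X (r n) x) (\<lambda>x. X m x - X (r n) x) \<le> (1/4) ^ n"
    by metis
  have [measurable]: "X n \<in> borel_measurable M" for n using X L2_spaceD by blast
  have "AE x in M. convergent (\<lambda>n. X (r n) x)"
    using r(1) by (intro AE_convergent_of_fast_L2_Cauchy X r(2)) (simp add: strict_mono_less_eq)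
  then have "AE x in M. (\<lambda>n. X (r n) x) \<longlonglongrightarrow> lim (\<lambda>n. X (r n) x)"
    by (simp add: convergent_LIMSEQ_iff)
  moreover have "(\<lambda>x. lim (\<lambda>n. X (r n) x)) \<in> borel_measurable M" by measurable
  ultimately show ?thesis using that r(1) by blast
qed

lemma L2_semi_hilbert: "semi_hilbert (L2_space M) (L2_inner M)"
proof -
  interpret L: semi_ip "L2_space M" "L2_inner M" by (rule L2_semi_ip)
  show ?thesis
  proof
    fix X :: "nat \<Rightarrow> 'a \<Rightarrow> real" assume X: "\<And>n. X n \<in> L2_space M"
      and Cauchy: "\<And>e. 0 < e \<Longrightarrow>
        \<exists>N. \<forall>m\<ge>N. \<forall>n\<ge>N. L2_inner M (\<lambda>x. X m x - X n x) (\<lambda>x. X m x - X n x) < e"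
    obtain r :: "nat \<Rightarrow> nat" and f where r: "strict_mono r" and [measurable]: "f \<in> borel_measurable M"
      and lim: "AE x in M. (\<lambda>n. X (r n) x) \<longlonglongrightarrow> f x"
      using L2_AE_subseq[OF X Cauchy] by metis
    have [measurable]: "X n \<in> borel_measurable M" for n using X L2_spaceD by blast
    \<comment> \<open>With m fixed, Fatou along the subsequence puts \<open>X m - f\<close> into L2
      and bounds its norm; f itself then lies in L2 as a difference.\<close>
    have close: "(\<lambda>x. X m x - f x) \<in> L2_space M \<and>
        L2_inner M (\<lambda>x. X m x - f x) (\<lambda>x. X m x - f x) \<le> e"
      if "\<And>n. N \<le> n \<Longrightarrow> L2_inner M (\<lambda>x. X m x - X n x) (\<lambda>x. X m x - X n x) \<le> e" for m N e
    proof -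
      have 1: "AE x in M. (\<lambda>n. X m x - X (r n) x) \<longlonglongrightarrow> X m x - f x"
        using lim by eventually_elim (intro tendsto_intros)
      have 2: "L2_inner M (\<lambda>x. X m x - X (r n) x) (\<lambda>x. X m x - X (r n) x) \<le> e" if "N \<le> n" for n
        using that seq_suble[OF r, of n] by (intro \<open>\<And>n. N \<le> n \<Longrightarrow> _\<close>) simp
      show ?thesis using L2_Fatou[OF _ _ 1 2] X L.diff_in by auto
    qed
    obtain N where N: "\<And>m n. N \<le> m \<Longrightarrow> N \<le> n \<Longrightarrow>
        L2_inner M (\<lambda>x. X m x - X n x) (\<lambda>x. X m x - X n x) < 1"
      using Cauchy[of 1] by auto
    have "(\<lambda>x. X N x - f x) \<in> L2_space M" using close[of N N 1] N by (simp add: less_imp_le)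
    from L.diff_in[OF X[of N] this] have "f \<in> L2_space M" by simp
    moreover have "(\<lambda>n. L2_inner M (\<lambda>x. X n x - f x) (\<lambda>x. X n x - f x)) \<longlonglongrightarrow> 0"
    proof (rule LIMSEQ_I)
      fix e :: real assume "0 < e"
      then obtain N where N: "\<And>m n. N \<le> m \<Longrightarrow> N \<le> n \<Longrightarrow>
          L2_inner M (\<lambda>x. X m x - X n x) (\<lambda>x. X m x - X n x) < e / 2"
        using Cauchy[of "e/2"] by auto
      have "norm (L2_inner M (\<lambda>x. X m x - f x) (\<lambda>x. X m x - f x) - 0) < e" if "N \<le> m" for m
      proof -
        have "L2_inner M (\<lambda>x. X m x - f x) (\<lambda>x. X m x - f x) \<le> e / 2"
          using close[of N m "e/2"] N[OF that] by (simp add: less_imp_le)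
        then show ?thesis using \<open>0 < e\<close> by (simp add: L2_inner_def)
      qed
      then show "\<exists>no. \<forall>n\<ge>no. norm (L2_inner M (\<lambda>x. X n x - f x) (\<lambda>x. X n x - f x) - 0) < e"
        by blast
    qed
    ultimately show "\<exists>f\<in>L2_space M. (\<lambda>n. L2_inner M (\<lambda>x. X n x - f x) (\<lambda>x. X n x - f x)) \<longlonglongrightarrow> 0"
      by blast
  qed
qed

lemma L2_inner_self_eq_0:
  assumes "f \<in> L2_space M"
  shows "L2_inner M f f = 0 \<longleftrightarrow> (AE x in M. f x = 0)"
  using integral_nonneg_eq_0_iff_AE[of M "\<lambda>x. (f x)\<^sup>2"] L2_spaceD[OF assms]
  by (simp add: L2_inner_def power2_eq_square)

lemma L2_inner_cong_AE:
  assumes "AE x in M. f x = f' x" "AE x in M. g x = g' x"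
    and "f \<in> borel_measurable M" "f' \<in> borel_measurable M" "g \<in> borel_measurable M" "g' \<in> borel_measurable M"
  shows "L2_inner M f g = L2_inner M f' g'"
  unfolding L2_inner_def using assms by (intro integral_cong_AE) auto

lemma L2_weak_eqD:
  assumes "f \<in> L2_space M" "g \<in> L2_space M"
    and "\<And>h. h \<in> L2_space M \<Longrightarrow> L2_inner M f h = L2_inner M g h"
  shows "AE x in M. f x = g x"
proof -
  interpret L: semi_ip "L2_space M" "L2_inner M" by (rule L2_semi_ip)
  have d: "(\<lambda>x. f x - g x) \<in> L2_space M" by (rule L.diff_in[OF assms(1,2)])
  have "L2_inner M (\<lambda>x. f x - g x) (\<lambda>x. f x - g x) = 0"
    using assms d by (subst L.diff_left) auto
  then show ?thesis using L2_inner_self_eq_0[OF d] by simp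
qed

section \<open>Functional calculus of a projection-valued measure\<close>

definition bdd_borel :: "(real \<Rightarrow> real) set" where
  "bdd_borel = {\<phi> \<in> borel_measurable borel. \<exists>K. \<forall>t. \<bar>\<phi> t\<bar> \<le> K}"

lemma bdd_borelI: "\<phi> \<in> borel_measurable borel \<Longrightarrow> (\<And>t. \<bar>\<phi> t\<bar> \<le> K) \<Longrightarrow> \<phi> \<in> bdd_borel"
  by (auto simp: bdd_borel_def)

lemma bdd_borelD: "\<phi> \<in> bdd_borel \<Longrightarrow> \<phi> \<in> borel_measurable borel"
  by (auto simp: bdd_borel_def)

lemma bdd_borelE:
  assumes "\<phi> \<in> bdd_borel"
  obtains K where "0 \<le> K" "\<And>t. \<bar>\<phi> t\<bar> \<le> K"
proof -
  obtain K where "\<And>t. \<bar>\<phi> t\<bar> \<le> K" using assms by (auto simp: bdd_borel_def)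
  moreover from this[of 0] have "0 \<le> K" by (rule order_trans[OF abs_ge_zero])
  ultimately show ?thesis using that by blast
qed

lemma bdd_borel_indicator [simp]: "A \<in> sets borel \<Longrightarrow> indicator A \<in> bdd_borel"
  by (rule bdd_borelI[of _ 1]) (auto simp: indicator_def)

lemma bdd_borel_const [simp]: "(\<lambda>t. c) \<in> bdd_borel"
  by (rule bdd_borelI[of _ "\<bar>c\<bar>"]) auto

lemma bdd_borel_mult [simp]:
  assumes "\<phi> \<in> bdd_borel" "\<psi> \<in> bdd_borel"
  shows "(\<lambda>t. \<phi> t * \<psi> t) \<in> bdd_borel"
proof -
  obtain K where "0 \<le> K" "\<And>t. \<bar>\<phi> t\<bar> \<le> K" using bdd_borelE[OF assms(1)] by blast
  moreover obtain L where "0 \<le> L" "\<And>t. \<bar>\<psi> t\<bar> \<le> L" using bdd_borelE[OF assms(2)] by blast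
  ultimately show ?thesis using assms
    by (intro bdd_borelI[of _ "K * L"])
      (auto simp: abs_mult intro!: mult_mono borel_measurable_times dest: bdd_borelD)
qed

lemma bdd_borel_lin [simp]:
  assumes "\<phi> \<in> bdd_borel" "\<psi> \<in> bdd_borel"
  shows "(\<lambda>t. c * \<phi> t + d * \<psi> t) \<in> bdd_borel"
proof -
  have "(\<lambda>t. \<phi> t + \<psi> t) \<in> bdd_borel" if p: "\<phi> \<in> bdd_borel" "\<psi> \<in> bdd_borel" for \<phi> \<psi>
  proof -
    obtain K where "0 \<le> K" "\<And>t. \<bar>\<phi> t\<bar> \<le> K" using bdd_borelE[OF p(1)] by blast
    moreover obtain L where "0 \<le> L" "\<And>t. \<bar>\<psi> t\<bar> \<le> L" using bdd_borelE[OF p(2)] by blast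
    ultimately show ?thesis using p
      by (intro bdd_borelI[of _ "K + L"])
        (auto intro!: abs_triangle_ineq[THEN order_trans] add_mono borel_measurable_add dest: bdd_borelD)
  qed
  then show ?thesis using assms by simp
qed

lemma bdd_borel_power [simp]: "\<phi> \<in> bdd_borel \<Longrightarrow> (\<lambda>t. \<phi> t ^ n) \<in> bdd_borel"
proof (induction n)
  case (Suc n)
  then show ?case using bdd_borel_mult[of \<phi> "\<lambda>t. \<phi> t ^ n"] by simp
qed (simp only: power_0 bdd_borel_const)

text \<open>Identities between the forms \<open>bil\<close> are checked on indicators, where they
  reduce to properties of the projections; both sides are linear in the function and continuous
  under bounded pointwise convergence. The limit case has one bound for the whole sequence, as
  dominated convergence for a finite measure requires.\<close>

lemma bdd_borel_induct [consumes 1, case_names indicator lin lim]: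
  assumes \<phi>: "\<phi> \<in> bdd_borel"
    and indicator: "\<And>A. A \<in> sets borel \<Longrightarrow> P (indicator A)"
    and lin: "\<And>f g c d. f \<in> bdd_borel \<Longrightarrow> g \<in> bdd_borel \<Longrightarrow> P f \<Longrightarrow> P g \<Longrightarrow> P (\<lambda>t. c * f t + d * g t)"
    and lim: "\<And>F f K. (\<And>n. F n \<in> borel_measurable borel) \<Longrightarrow> (\<And>n t. \<bar>F n t\<bar> \<le> K) \<Longrightarrow>
      (\<And>t. (\<lambda>n. F n t) \<longlonglongrightarrow> f t) \<Longrightarrow> f \<in> bdd_borel \<Longrightarrow> (\<And>n. P (F n)) \<Longrightarrow> P f"
  shows "P \<phi>"
proof -
  \<comment> \<open>The induction for nonnegative measurable functions knows no bound, so
    boundedness is carried as a premise and recovered for each part.\<close>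
  have pos: "(\<exists>K. \<forall>t. f t \<le> K) \<longrightarrow> P f" if "f \<in> borel_measurable borel" "\<And>t. 0 \<le> f t" for f :: "real \<Rightarrow> real"
    using that
  proof (induction rule: borel_measurable_induct_real)
    case (set A)
    then show ?case using indicator by simp
  next
    case (mult u c)
    show ?case
    proof (cases "c = 0")
      \<comment> \<open>For c = 0 a bound for c u says nothing about u.\<close>
      case True
      have "(\<lambda>t. c * u t) = indicator {}" using True by auto
      then show ?thesis using indicator by simp
    next
      case False
      show ?thesis
      proof
        assume "\<exists>K. \<forall>t. c * u t \<le> K"
        then obtain K where "\<And>t. c * u t \<le> K" by auto
        then have K: "u t \<le> K / c" for t using False mult by (simp add: field_simps)
        then have "u \<in> bdd_borel" using mult by (intro bdd_borelI[of _ "K / c"]) auto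
        moreover have "P u" using mult K by blast
        ultimately show "P (\<lambda>t. c * u t)" using lin[of u u c 0] by simp
      qed
    qed
  next
    case (add u v)
    show ?case
    proof
      assume "\<exists>K. \<forall>t. v t + u t \<le> K"
      then obtain K where K': "\<And>t. v t + u t \<le> K" by auto
      have K: "u t \<le> K" "v t \<le> K" for t
        using add(2)[of t] add(4)[of t] K'[of t] by auto
      then have "u \<in> bdd_borel" "v \<in> bdd_borel" using add by (auto intro!: bdd_borelI[of _ K])
      moreover have "P u" "P v" using add K by blast+
      ultimately show "P (\<lambda>t. v t + u t)" using lin[of v u 1 1] by simp
    qed
  next
    case (seq U)
    show ?case
    proof
      assume "\<exists>K. \<forall>t. f t \<le> K"
      then obtain K where K: "\<And>t. f t \<le> K" by auto
      have "U i t \<le> f t" for i t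
      proof (rule incseq_le)
        show "incseq (\<lambda>i. U i t)" using \<open>incseq U\<close> by (simp add: incseq_def le_fun_def)
        show "(\<lambda>i. U i t) \<longlonglongrightarrow> f t" by (simp add: seq)
      qed
      then have UK: "U i t \<le> K" for i t using K order_trans by blast
      have "f \<in> bdd_borel" by (rule bdd_borelI[of _ K]) (simp_all add: that K)
      moreover have "\<bar>U i t\<bar> \<le> K" for i t using UK[of i t] seq(2)[of i t] by simp
      moreover have "P (U i)" for i using seq UK by blast
      moreover have "U i \<in> borel_measurable borel" "(\<lambda>i. U i t) \<longlonglongrightarrow> f t" for i t by (simp_all add: seq)
      ultimately show "P f" by (intro lim[of U K f])
    qed
  qed
  obtain K where K: "0 \<le> K" "\<And>t. \<bar>\<phi> t\<bar> \<le> K" using \<phi> bdd_borelE by metis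
  note [measurable] = bdd_borelD[OF \<phi>]
  define f g where "f t = max 0 (\<phi> t)" and "g t = max 0 (- \<phi> t)" for t
  have le: "f t \<le> K" "g t \<le> K" "0 \<le> f t" "0 \<le> g t" for t using K(2)[of t] K(1) by (auto simp: f_def g_def)
  have m: "f \<in> borel_measurable borel" "g \<in> borel_measurable borel"
    unfolding f_def[abs_def] g_def[abs_def] by measurable
  have "P f" using pos[OF m(1) le(3)] le(1) by blast
  moreover have "P g" using pos[OF m(2) le(4)] le(2) by blast
  moreover have "f \<in> bdd_borel" "g \<in> bdd_borel" using le m by (auto intro!: bdd_borelI[of _ K])
  ultimately have "P (\<lambda>t. 1 * f t + (-1) * g t)" by (intro lin)
  moreover have "(\<lambda>t. 1 * f t + (-1) * g t) = \<phi>" by (auto simp: f_def g_def max_def)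
  ultimately show ?thesis by simp
qed

section \<open>Bounded Borel functions of a self-adjoint operator\<close>

locale pvm =
  fixes M :: "'x measure" and E :: "real set \<Rightarrow> ('x \<Rightarrow> real) \<Rightarrow> 'x \<Rightarrow> real"
  assumes pvm: "projection_valued_measure M E"
begin

sublocale L: semi_hilbert "L2_space M" "L2_inner M" by (rule L2_semi_hilbert)

abbreviation "H \<equiv> L2_space M"
abbreviation "ip \<equiv> L2_inner M"
abbreviation "mu \<equiv> spectral_measure M E"

lemma E_in [simp]: "A \<in> sets borel \<Longrightarrow> f \<in> H \<Longrightarrow> E A f \<in> H"
  using pvm by (simp add: projection_valued_measure_def)

lemma E_sym: "A \<in> sets borel \<Longrightarrow> f \<in> H \<Longrightarrow> g \<in> H \<Longrightarrow> ip (E A f) g = ip f (E A g)"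
  using pvm by (simp add: projection_valued_measure_def)

lemma E_E:
  assumes "A \<in> sets borel" "B \<in> sets borel" "f \<in> H" "g \<in> H"
  shows "ip (E A (E B f)) g = ip (E (A \<inter> B) f) g"
proof (rule sym, rule L2_inner_cong_AE)
  show "AE x in M. E (A \<inter> B) f x = E A (E B f) x"
    using pvm assms unfolding projection_valued_measure_def by blast
qed (use assms in \<open>auto intro!: L2_spaceD\<close>)

lemma E_UNIV:
  assumes "f \<in> H" "g \<in> H"
  shows "ip (E UNIV f) g = ip f g"
proof (rule L2_inner_cong_AE)
  show "AE x in M. E UNIV f x = f x"
    using pvm assms unfolding projection_valued_measure_def by blast
qed (use assms in \<open>auto intro!: L2_spaceD\<close>)

lemma E_inner:
  assumes "A \<in> sets borel" "B \<in> sets borel" "f \<in> H" "g \<in> H"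
  shows "ip (E A f) (E B g) = ip (E (A \<inter> B) f) g"
  using assms by (simp add: E_sym[of _ f] L.sym[of f] E_E)

lemma E_nonneg: "A \<in> sets borel \<Longrightarrow> f \<in> H \<Longrightarrow> 0 \<le> ip (E A f) f"
  using L.nonneg[of "E A f"] E_inner[of A A f f] by simp

lemma E_sums:
  fixes A :: "nat \<Rightarrow> real set"
  assumes "range A \<subseteq> sets borel" "disjoint_family A" "f \<in> H" "g \<in> H"
  shows "(\<lambda>n. ip (E (A n) f) g) sums ip (E (\<Union>n. A n) f) g"
  using pvm assms unfolding projection_valued_measure_def by blast

lemma E_lin:
  assumes "A \<in> sets borel" "u \<in> H" "v \<in> H" "g \<in> H"
  shows "ip (E A (\<lambda>x. a * u x + b * v x)) g = a * ip (E A u) g + b * ip (E A v) g"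
  using assms by (simp add: E_sym L.expand)

lemma sets_mu [simp, measurable_cong]: "sets (mu u) = sets borel"
  using sets.sigma_sets_eq[of "borel :: real measure"] by (simp add: spectral_measure_def)

lemma space_mu [simp]: "space (mu u) = UNIV"
  by (simp add: spectral_measure_def)

lemma emeasure_mu:
  assumes u: "u \<in> H" and A: "A \<in> sets borel"
  shows "emeasure (mu u) A = ennreal (ip (E A u) u)"
proof (rule emeasure_measure_of[OF spectral_measure_def])
  \<comment> \<open>The empty set as a disjoint union of empty sets gives a convergent series with
    constant terms, which must vanish.\<close>
  have "ip (E {} u) u = 0"
  proof -
    have "(\<lambda>n::nat. ip (E {} u) u) sums ip (E (\<Union>n::nat. {}) u) u"
      using u by (intro E_sums) (auto simp: disjoint_family_on_def)
    then have "(\<lambda>n::nat. ip (E {} u) u) \<longlonglongrightarrow> 0" using summable_LIMSEQ_zero sums_summable by blast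
    then show ?thesis by (simp add: LIMSEQ_const_iff)
  qed
  then show "positive (sets (mu u)) (\<lambda>A. ennreal (ip (E A u) u))" by (simp add: positive_def)
  show "countably_additive (sets (mu u)) (\<lambda>A. ennreal (ip (E A u) u))"
  proof (rule countably_additiveI)
    fix B :: "nat \<Rightarrow> real set"
    assume B: "range B \<subseteq> sets (mu u)" "disjoint_family B"
    then have "(\<lambda>n. ip (E (B n) u) u) sums ip (E (\<Union>n. B n) u) u"
      using u by (intro E_sums) auto
    moreover have "0 \<le> ip (E (B n) u) u" for n using B u by (intro E_nonneg) auto
    ultimately show "(\<Sum>n. ennreal (ip (E (B n) u) u)) = ennreal (ip (E (\<Union>n. B n) u) u)"
      by (simp add: suminf_ennreal2 sums_iff)
  qed
qed (use A in auto)

lemma measure_mu: "u \<in> H \<Longrightarrow> A \<in> sets borel \<Longrightarrow> measure (mu u) A = ip (E A u) u"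
  by (simp add: measure_def emeasure_mu E_nonneg)

lemma finite_mu: "u \<in> H \<Longrightarrow> finite_measure (mu u)"
  by (rule finite_measureI) (simp add: emeasure_mu)

lemma integrable_bdd:
  assumes "u \<in> H" "\<phi> \<in> bdd_borel"
  shows "integrable (mu u) \<phi>"
proof -
  interpret finite_measure "mu u" by (rule finite_mu) fact
  obtain K where "\<And>t. \<bar>\<phi> t\<bar> \<le> K" using bdd_borelE[OF assms(2)] by metis
  then show ?thesis using bdd_borelD[OF assms(2)]
    by (intro integrable_const_bound[where B=K]) auto
qed

text \<open>Integration against the signed measure of u and g, by polarization, in exactly the form
  used in \<open>spectral_integral\<close>. Its bilinearity is proved for bounded
  \<open>\<phi>\<close>; unbounded functions are reached by truncation.\<close>

definition bil :: "(real \<Rightarrow> real) \<Rightarrow> ('x \<Rightarrow> real) \<Rightarrow> ('x \<Rightarrow> real) \<Rightarrow> real" where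
  "bil \<phi> u g = ((LINT t|mu (\<lambda>x. u x + g x). \<phi> t) - (LINT t|mu (\<lambda>x. u x - g x). \<phi> t)) / 4"

lemma integral_indicator_mu:
  "u \<in> H \<Longrightarrow> A \<in> sets borel \<Longrightarrow> (LINT t|mu u. indicator A t) = ip (E A u) u"
  by (simp add: measure_mu)

lemma bil_indicator:
  assumes "A \<in> sets borel" "u \<in> H" "g \<in> H"
  shows "bil (indicator A) u g = ip (E A u) g"
proof -
  have *: "ip (E A (\<lambda>x. a * u x + b * g x)) (\<lambda>x. a * u x + b * g x)
      = a\<^sup>2 * ip (E A u) u + 2 * a * b * ip (E A u) g + b\<^sup>2 * ip (E A g) g" for a b
    using assms E_sym[of A u g] L.sym[of u "E A g"]
    by (simp add: E_lin L.lin_right L.closed algebra_simps power2_eq_square)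
  show ?thesis
    using *[of 1 1] *[of 1 "-1"] assms
    by (simp add: bil_def integral_indicator_mu L.closed del: Bochner_Integration.integral_indicator)
qed

lemma bil_lin_fun:
  assumes "\<phi> \<in> bdd_borel" "\<psi> \<in> bdd_borel" "u \<in> H" "g \<in> H"
  shows "bil (\<lambda>t. c * \<phi> t + d * \<psi> t) u g = c * bil \<phi> u g + d * bil \<psi> u g"
  using assms by (simp add: bil_def integrable_bdd L.closed algebra_simps add_divide_distrib diff_divide_distrib)

lemma integral_lim:
  fixes F :: "nat \<Rightarrow> real \<Rightarrow> real"
  assumes F: "\<And>n. F n \<in> borel_measurable borel" "\<And>n t. \<bar>F n t\<bar> \<le> K"
    and lim: "\<And>t. (\<lambda>n. F n t) \<longlonglongrightarrow> f t" and u: "u \<in> H"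
  shows "(\<lambda>n. LINT t|mu u. F n t) \<longlonglongrightarrow> (LINT t|mu u. f t)"
proof -
  have [measurable]: "f \<in> borel_measurable borel"
    by (rule borel_measurable_LIMSEQ_real[where u=F]) (simp_all add: lim F(1))
  show ?thesis
    using F lim by (intro integral_dominated_convergence[where w="\<lambda>_. K"] integrable_bdd u) auto
qed

lemma bil_lim:
  assumes "\<And>n. F n \<in> borel_measurable borel" "\<And>n t. \<bar>F n t\<bar> \<le> K"
    and "\<And>t. (\<lambda>n. F n t) \<longlonglongrightarrow> f t" and "u \<in> H" "g \<in> H"
  shows "(\<lambda>n. bil (F n) u g) \<longlonglongrightarrow> bil f u g"
  unfolding bil_def using assms by (intro tendsto_intros integral_lim L.closed) auto

lemma bil_sym: "bil \<phi> u g = bil \<phi> g u" if "\<phi> \<in> bdd_borel" "u \<in> H" "g \<in> H"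
  using that
proof (induction rule: bdd_borel_induct)
  case (indicator A)
  then show ?case by (simp add: bil_indicator E_sym L.sym[of g "E A u"])
next
  case (lin f h c d)
  then show ?case by (simp add: bil_lin_fun)
next
  case (lim F f K)
  have "(\<lambda>n. bil (F n) u g) \<longlonglongrightarrow> bil f u g" "(\<lambda>n. bil (F n) g u) \<longlonglongrightarrow> bil f g u"
    using lim.prems by (auto intro!: bil_lim[OF lim(1-3)])
  then show ?case using lim LIMSEQ_unique by simp
qed

lemma bil_lin_left:
  assumes "\<phi> \<in> bdd_borel" "u \<in> H" "v \<in> H" "g \<in> H"
  shows "bil \<phi> (\<lambda>x. a * u x + b * v x) g = a * bil \<phi> u g + b * bil \<phi> v g"
  using assms
proof (induction rule: bdd_borel_induct)
  case (indicator A)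
  then show ?case by (simp add: bil_indicator E_lin L.closed)
next
  case (lin f h c d)
  then show ?case by (simp add: bil_lin_fun L.closed algebra_simps)
next
  case (lim F f K)
  have "(\<lambda>n. bil (F n) (\<lambda>x. a * u x + b * v x) g) \<longlonglongrightarrow> bil f (\<lambda>x. a * u x + b * v x) g"
    "(\<lambda>n. a * bil (F n) u g + b * bil (F n) v g) \<longlonglongrightarrow> a * bil f u g + b * bil f v g"
    using lim.prems by (auto intro!: bil_lim[OF lim(1-3)] tendsto_intros L.closed)
  then show ?case using lim LIMSEQ_unique by simp
qed

lemma bil_self: "bil \<phi> u u = (LINT t|mu u. \<phi> t)" if "\<phi> \<in> bdd_borel" "u \<in> H"
  using that
proof (induction rule: bdd_borel_induct)
  case (indicator A)
  then show ?case by (simp add: bil_indicator integral_indicator_mu del: Bochner_Integration.integral_indicator)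
next
  case (lin f h c d)
  then show ?case by (simp add: bil_lin_fun integrable_bdd)
next
  case (lim F f K)
  have "(\<lambda>n. bil (F n) u u) \<longlonglongrightarrow> bil f u u" "(\<lambda>n. LINT t|mu u. F n t) \<longlonglongrightarrow> (LINT t|mu u. f t)"
    using lim.prems by (auto intro!: bil_lim[OF lim(1-3)] integral_lim[OF lim(1-3)])
  then show ?case using lim LIMSEQ_unique by simp
qed

text \<open>Multiplicativity with an indicator as one factor: for two indicators it is E B E A = E
  (B \<inter> A). The general product follows in \<open>bil_fc\<close>.\<close>

lemma bil_E_right:
  assumes "\<phi> \<in> bdd_borel" "A \<in> sets borel" "u \<in> H" "g \<in> H"
  shows "bil \<phi> u (E A g) = bil (\<lambda>t. \<phi> t * indicator A t) u g"
  using assms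
proof (induction rule: bdd_borel_induct)
  case (indicator B)
  have "(\<lambda>t. indicator B t * indicator A t) = (indicator (B \<inter> A) :: real \<Rightarrow> real)"
    by (auto simp: indicator_def)
  with indicator show ?case by (simp add: bil_indicator E_inner)
next
  case (lin f h c d)
  then show ?case using bil_lin_fun[of "\<lambda>t. f t * indicator A t" "\<lambda>t. h t * indicator A t" u g c d]
    by (simp add: bil_lin_fun algebra_simps)
next
  case (lim F f K)
  note [measurable] = \<open>A \<in> sets borel\<close> lim(1)
  have "(\<lambda>n. bil (F n) u (E A g)) \<longlonglongrightarrow> bil f u (E A g)"
    using lim.prems by (auto intro!: bil_lim[OF lim(1-3)])
  moreover have "(\<lambda>n. bil (\<lambda>t. F n t * indicator A t) u g) \<longlonglongrightarrow> bil (\<lambda>t. f t * indicator A t) u g"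
    using lim.prems order_trans[OF lim(2) abs_ge_self]
    by (intro bil_lim[of _ "\<bar>K\<bar>"] tendsto_intros lim(3)) (auto simp: indicator_def)
  ultimately show ?case using lim LIMSEQ_unique by simp
qed

lemma bil_semi_ip:
  assumes "\<phi> \<in> bdd_borel" "\<And>t. 0 \<le> \<phi> t"
  shows "semi_ip H (bil \<phi>)"
proof
  show "0 \<le> bil \<phi> f f" if "f \<in> H" for f using that assms by (simp add: bil_self)
qed (use assms(1) in \<open>auto intro: L.closed bil_sym bil_lin_left\<close>)

lemma bil_const_one: "bil (\<lambda>t. 1) u g = ip u g" if "u \<in> H" "g \<in> H"
  using bil_indicator[of UNIV u g] that by (simp add: indicator_def[abs_def] E_UNIV)

lemma bil_self_le:
  assumes "\<phi> \<in> bdd_borel" "u \<in> H" "\<And>t. \<phi> t \<le> K"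
  shows "bil \<phi> u u \<le> K * ip u u"
proof -
  have "(LINT t|mu u. \<phi> t) \<le> (LINT t|mu u. K)"
    using assms by (intro integral_mono integrable_bdd) auto
  also have "\<dots> = K * measure (mu u) UNIV" by simp
  finally show ?thesis using assms by (simp add: bil_self measure_mu E_UNIV)
qed

lemma abs_bil_self_le:
  assumes "\<phi> \<in> bdd_borel" "u \<in> H" "\<And>t. \<bar>\<phi> t\<bar> \<le> K"
  shows "\<bar>bil \<phi> u u\<bar> \<le> K * ip u u"
proof -
  have "\<phi> t \<le> K" "- \<phi> t \<le> K" for t using assms(3)[of t] by auto
  then show ?thesis
    using bil_self_le[of \<phi> u K] bil_self_le[of "\<lambda>t. (-1) * \<phi> t + 0 * \<phi> t" u K] assms
      bdd_borel_lin[of \<phi> \<phi> "-1" 0] bil_lin_fun[of \<phi> \<phi> u u "-1" 0]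
    by (simp add: abs_le_iff)
qed

text \<open>Riesz for the functional \<open>bil \<phi> u\<close>. Polarization bounds it by the
  diagonal values at u + g and u - g, each controlled by K times the squared norm, and the
  parallelogram identity leaves K (||u||^2 + ||g||^2) / 2.\<close>

lemma fc_ex:
  assumes "\<phi> \<in> bdd_borel" "u \<in> H"
  shows "\<exists>v\<in>H. \<forall>g\<in>H. ip v g = bil \<phi> u g"
proof -
  obtain K where K: "0 \<le> K" "\<And>t. \<bar>\<phi> t\<bar> \<le> K" using bdd_borelE[OF assms(1)] by metis
  define K' where "K' = K * (1 + ip u u)"
  have F: "bil \<phi> u (\<lambda>x. a * f x + b * g x) = a * bil \<phi> u f + b * bil \<phi> u g"
    if "f \<in> H" "g \<in> H" for f g a b
    using that \<open>u \<in> H\<close> \<open>\<phi> \<in> bdd_borel\<close> by (simp add: bil_sym[of \<phi> u] bil_lin_left L.closed)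
  have b: "\<bar>bil \<phi> u g\<bar> \<le> K' * (1 + ip g g)" if g: "g \<in> H" for g
  proof -
    have "\<bar>bil \<phi> u g\<bar> \<le> (\<bar>bil \<phi> (\<lambda>x. u x + g x) (\<lambda>x. u x + g x)\<bar> + \<bar>bil \<phi> (\<lambda>x. u x - g x) (\<lambda>x. u x - g x)\<bar>) / 4"
      using \<open>u \<in> H\<close> g \<open>\<phi> \<in> bdd_borel\<close> by (simp add: bil_self L.closed) (simp add: bil_def)
    also have "\<dots> \<le> (K * ip (\<lambda>x. u x + g x) (\<lambda>x. u x + g x) + K * ip (\<lambda>x. u x - g x) (\<lambda>x. u x - g x)) / 4"
      using \<open>u \<in> H\<close> g \<open>\<phi> \<in> bdd_borel\<close> K
      by (intro divide_right_mono add_mono abs_bil_self_le L.closed) auto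
    also have "\<dots> = K * (ip u u + ip g g) / 2"
      using \<open>u \<in> H\<close> g by (simp add: L.square_add L.square_diff L.sym[of g u] algebra_simps)
    also have "\<dots> \<le> K * (ip u u + ip g g)"
      using K L.nonneg \<open>u \<in> H\<close> g by simp
    also have "\<dots> \<le> K * ((1 + ip u u) * (1 + ip g g))"
      using K L.nonneg \<open>u \<in> H\<close> g by (intro mult_left_mono) (auto simp: algebra_simps)
    finally show ?thesis by (simp add: K'_def mult.assoc)
  qed
  have s: "bil \<phi> u (\<lambda>x. t * g x) = t * bil \<phi> u g" if "g \<in> H" for g t
    using F[of g g t 0] that by simp
  show ?thesis
    by (rule L.Riesz[of "bil \<phi> u" "4 * K'\<^sup>2"]) (auto intro: F L.bounded_functional[OF s b])
qed

text \<open>The operator \<phi>(T) applied to u. Only its class is determined, so it is accessed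
  through \<open>fc_inner\<close>.\<close>

definition fc :: "(real \<Rightarrow> real) \<Rightarrow> ('x \<Rightarrow> real) \<Rightarrow> 'x \<Rightarrow> real" where
  "fc \<phi> u = (SOME v. v \<in> H \<and> (\<forall>g\<in>H. ip v g = bil \<phi> u g))"

lemma
  assumes "\<phi> \<in> bdd_borel" "u \<in> H"
  shows fc_in [simp]: "fc \<phi> u \<in> H"
    and fc_inner: "g \<in> H \<Longrightarrow> ip (fc \<phi> u) g = bil \<phi> u g"
  using someI_ex[of "\<lambda>v. v \<in> H \<and> (\<forall>g\<in>H. ip v g = bil \<phi> u g)"] fc_ex[OF assms]
  unfolding fc_def by blast+

text \<open>This is \<phi>(T) \<psi>(T) = (\<phi> \<psi>)(T) in weak form. For an indicator \<phi>
  the projection is moved onto g, where \<open>bil_E_right\<close> applies.\<close>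

lemma bil_fc:
  assumes "\<phi> \<in> bdd_borel" "\<psi> \<in> bdd_borel" "u \<in> H" "g \<in> H"
  shows "bil \<phi> (fc \<psi> u) g = bil (\<lambda>t. \<phi> t * \<psi> t) u g"
  using assms
proof (induction rule: bdd_borel_induct)
  case (indicator A)
  then show ?case by (simp add: bil_indicator E_sym fc_inner bil_E_right mult.commute)
next
  case (lin f h c d)
  then show ?case using bil_lin_fun[of "\<lambda>t. f t * \<psi> t" "\<lambda>t. h t * \<psi> t" u g c d]
    by (simp add: bil_lin_fun algebra_simps)
next
  case (lim F f K)
  note [measurable] = lim(1) bdd_borelD[OF \<open>\<psi> \<in> bdd_borel\<close>]
  obtain L where L: "0 \<le> L" "\<And>t. \<bar>\<psi> t\<bar> \<le> L" using bdd_borelE[OF \<open>\<psi> \<in> bdd_borel\<close>] by metis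
  have "(\<lambda>n. bil (F n) (fc \<psi> u) g) \<longlonglongrightarrow> bil f (fc \<psi> u) g"
    using lim.prems by (auto intro!: bil_lim[OF lim(1-3)])
  moreover have "(\<lambda>n. bil (\<lambda>t. F n t * \<psi> t) u g) \<longlonglongrightarrow> bil (\<lambda>t. f t * \<psi> t) u g"
    using lim L order_trans[OF abs_ge_zero lim(2)] by (intro bil_lim[of _ "K * L"] tendsto_intros lim)
      (auto simp: abs_mult intro!: mult_mono)
  ultimately show ?case using lim LIMSEQ_unique by simp
qed

lemma fc_fc_inner:
  assumes "\<phi> \<in> bdd_borel" "\<psi> \<in> bdd_borel" "u \<in> H" "g \<in> H"
  shows "ip (fc \<phi> u) (fc \<psi> g) = bil (\<lambda>t. \<phi> t * \<psi> t) u g"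
  using assms by (simp add: fc_inner bil_sym[of \<phi> u] bil_fc bil_sym[of _ g u])

lemma bil_cong:
  assumes "\<phi> \<in> borel_measurable borel" "\<psi> \<in> borel_measurable borel" "u \<in> H" "g \<in> H"
    and "\<And>h. h \<in> H \<Longrightarrow> AE t in mu h. \<phi> t = \<psi> t"
  shows "bil \<phi> u g = bil \<psi> u g"
proof -
  have "(LINT t|mu h. \<phi> t) = (LINT t|mu h. \<psi> t)" if "h \<in> H" for h
    using assms that by (intro integral_cong_AE) auto
  then show ?thesis using assms by (simp add: bil_def L.closed)
qed

section \<open>Unbounded Borel functions by truncation\<close>

definition trunc :: "(real \<Rightarrow> real) \<Rightarrow> nat \<Rightarrow> real set" where
  "trunc \<phi> n = {t. \<bar>\<phi> t\<bar> \<le> real n}"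

lemma trunc_sets [measurable, simp]: "\<phi> \<in> borel_measurable borel \<Longrightarrow> trunc \<phi> n \<in> sets borel"
  unfolding trunc_def by measurable

lemma bdd_trunc [simp]:
  "\<phi> \<in> borel_measurable borel \<Longrightarrow> (\<lambda>t. \<phi> t * indicator (trunc \<phi> n) t) \<in> bdd_borel"
  by (rule bdd_borelI[of _ "real n"]) (auto simp: trunc_def indicator_def)

lemma tendsto_trunc: "(\<lambda>n. f t * indicator (trunc \<phi> n) t :: real) \<longlonglongrightarrow> f t"
proof (rule tendsto_eventually)
  obtain N where "\<bar>\<phi> t\<bar> \<le> real N" using real_arch_simple by blast
  then show "\<forall>\<^sub>F n in sequentially. f t * indicator (trunc \<phi> n) t = f t"
    by (intro eventually_sequentiallyI[of N]) (auto simp: trunc_def indicator_def)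
qed

text \<open>By Fatou, as the truncations converge pointwise to \<phi>. The bound is phrased with
  \<open>bil\<close> so that the algebra of the bounded calculus can supply it.\<close>

lemma spectral_domainI:
  assumes [measurable]: "\<phi> \<in> borel_measurable borel" and u: "u \<in> H"
    and c: "\<And>n. bil (\<lambda>t. (\<phi> t * indicator (trunc \<phi> n) t)\<^sup>2) u u \<le> c"
  shows "u \<in> spectral_domain M E \<phi>"
proof -
  have [simp]: "(\<lambda>t. (\<phi> t * indicator (trunc \<phi> n) t)\<^sup>2) \<in> bdd_borel" for n
    by (intro bdd_borel_power bdd_trunc) simp
  have "(\<integral>\<^sup>+ t. ennreal ((\<phi> t)\<^sup>2) \<partial>mu u) = (\<integral>\<^sup>+ t. liminf (\<lambda>n. ennreal ((\<phi> t * indicator (trunc \<phi> n) t)\<^sup>2)) \<partial>mu u)"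
  proof (intro nn_integral_cong)
    fix t
    have "(\<lambda>n. ennreal ((\<phi> t * indicator (trunc \<phi> n) t)\<^sup>2)) \<longlonglongrightarrow> ennreal ((\<phi> t)\<^sup>2)"
      by (intro tendsto_ennrealI tendsto_intros tendsto_trunc)
    from lim_imp_Liminf[OF sequentially_bot this]
    show "ennreal ((\<phi> t)\<^sup>2) = liminf (\<lambda>n. ennreal ((\<phi> t * indicator (trunc \<phi> n) t)\<^sup>2))" by (rule sym)
  qed
  also have "\<dots> \<le> liminf (\<lambda>n. \<integral>\<^sup>+ t. ennreal ((\<phi> t * indicator (trunc \<phi> n) t)\<^sup>2) \<partial>mu u)"
    by (intro nn_integral_liminf) measurable
  also have "\<dots> \<le> liminf (\<lambda>n. ennreal c)"
  proof (intro Liminf_mono always_eventually allI)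
    fix n
    have "(\<integral>\<^sup>+ t. ennreal ((\<phi> t * indicator (trunc \<phi> n) t)\<^sup>2) \<partial>mu u)
        = ennreal (LINT t|mu u. (\<phi> t * indicator (trunc \<phi> n) t)\<^sup>2)"
      using u by (intro nn_integral_eq_integral integrable_bdd) auto
    then show "(\<integral>\<^sup>+ t. ennreal ((\<phi> t * indicator (trunc \<phi> n) t)\<^sup>2) \<partial>mu u) \<le> ennreal c"
      using c[of n] u by (simp add: ennreal_leI bil_self)
  qed
  finally have "(\<integral>\<^sup>+ t. ennreal ((\<phi> t)\<^sup>2) \<partial>mu u) \<le> ennreal c" by (simp add: Liminf_const)
  then have "integrable (mu u) (\<lambda>t. (\<phi> t)\<^sup>2)"
    by (intro integrableI_bounded) (auto simp: le_less_trans)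
  then show ?thesis using u by (simp add: spectral_domain_def)
qed

lemma spectral_domainD:
  assumes [measurable]: "\<phi> \<in> borel_measurable borel" and u: "u \<in> spectral_domain M E \<phi>"
  shows "u \<in> H" "bil (\<lambda>t. (\<phi> t * indicator (trunc \<phi> n) t)\<^sup>2) u u \<le> (LINT t|mu u. (\<phi> t)\<^sup>2)"
    "integrable (mu u) \<phi>"
proof -
  show H: "u \<in> H" using u by (simp add: spectral_domain_def)
  have int: "integrable (mu u) (\<lambda>t. (\<phi> t)\<^sup>2)" using u by (simp add: spectral_domain_def)
  have b: "(\<lambda>t. (\<phi> t * indicator (trunc \<phi> n) t)\<^sup>2) \<in> bdd_borel"
    by (intro bdd_borel_power bdd_trunc) simp
  then show "bil (\<lambda>t. (\<phi> t * indicator (trunc \<phi> n) t)\<^sup>2) u u \<le> (LINT t|mu u. (\<phi> t)\<^sup>2)"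
    using H int by (subst bil_self) (auto intro!: integral_mono integrable_bdd simp: indicator_def)
  show "integrable (mu u) \<phi>"
  proof (rule finite_measure.square_integrable_imp_integrable[OF finite_mu[OF H]])
    show "\<phi> \<in> borel_measurable (mu u)" by measurable
  qed (use int in auto)
qed

text \<open>The spectral measure of a sum is not the sum of the spectral measures. For each
  truncation, however, \<open>bil\<close> of the bounded function \<phi>^2 is a semi inner product,
  and the parallelogram inequality bounds its values uniformly in n.\<close>

lemma spectral_domain_add_diff:
  assumes m: "\<phi> \<in> borel_measurable borel"
    and u: "u \<in> spectral_domain M E \<phi>" and g: "g \<in> spectral_domain M E \<phi>"
  shows "(\<lambda>x. u x + g x) \<in> spectral_domain M E \<phi>" "(\<lambda>x. u x - g x) \<in> spectral_domain M E \<phi>"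
proof -
  let ?c = "2 * (LINT t|mu u. (\<phi> t)\<^sup>2) + 2 * (LINT t|mu g. (\<phi> t)\<^sup>2)"
  have H: "u \<in> H" "g \<in> H" using spectral_domainD[OF m] u g by auto
  have "bil (\<lambda>t. (\<phi> t * indicator (trunc \<phi> n) t)\<^sup>2) (\<lambda>x. u x + g x) (\<lambda>x. u x + g x) \<le> ?c \<and>
    bil (\<lambda>t. (\<phi> t * indicator (trunc \<phi> n) t)\<^sup>2) (\<lambda>x. u x - g x) (\<lambda>x. u x - g x) \<le> ?c" for n
  proof -
    have b: "(\<lambda>t. (\<phi> t * indicator (trunc \<phi> n) t)\<^sup>2) \<in> bdd_borel"
      by (intro bdd_borel_power bdd_trunc m)
    interpret B: semi_ip H "bil (\<lambda>t. (\<phi> t * indicator (trunc \<phi> n) t)\<^sup>2)"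
      by (rule bil_semi_ip[OF b]) simp
    show ?thesis
      using B.square_add_le[OF H] B.square_diff_le[OF H] spectral_domainD(2)[OF m u, of n]
        spectral_domainD(2)[OF m g, of n] by linarith
  qed
  then show "(\<lambda>x. u x + g x) \<in> spectral_domain M E \<phi>" "(\<lambda>x. u x - g x) \<in> spectral_domain M E \<phi>"
    using H by (auto intro!: spectral_domainI[OF m] L.closed)
qed

lemma bil_trunc_tendsto:
  assumes m[measurable]: "\<phi> \<in> borel_measurable borel"
    and u: "u \<in> spectral_domain M E \<phi>" and g: "g \<in> spectral_domain M E \<phi>"
  shows "(\<lambda>n. bil (\<lambda>t. \<phi> t * indicator (trunc \<phi> n) t) u g) \<longlonglongrightarrow> bil \<phi> u g"
proof -
  have "(\<lambda>n. LINT t|mu h. \<phi> t * indicator (trunc \<phi> n) t) \<longlonglongrightarrow> (LINT t|mu h. \<phi> t)"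
    if "h \<in> spectral_domain M E \<phi>" for h
  proof (rule integral_dominated_convergence[where w="\<lambda>t. \<bar>\<phi> t\<bar>"])
    show "integrable (mu h) (\<lambda>t. \<bar>\<phi> t\<bar>)" using spectral_domainD(3)[OF m that] by simp
    show "AE t in mu h. (\<lambda>n. \<phi> t * indicator (trunc \<phi> n) t) \<longlonglongrightarrow> \<phi> t" by (simp add: tendsto_trunc)
    show "AE t in mu h. norm (\<phi> t * indicator (trunc \<phi> n) t) \<le> \<bar>\<phi> t\<bar>" for n
      by (simp add: indicator_def)
  qed measurable
  then show ?thesis unfolding bil_def
    using spectral_domain_add_diff[OF assms] by (intro tendsto_intros) auto
qed

lemma spectral_integral_iff:
  "(u, v) \<in> spectral_integral M E \<phi> \<longleftrightarrow> u \<in> spectral_domain M E \<phi> \<and> v \<in> H \<and>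
     (\<forall>g\<in>spectral_domain M E \<phi>. ip v g = bil \<phi> u g)"
  by (simp add: spectral_integral_def bil_def)

text \<open>It suffices to test on the ranges of spectral projections where \<phi> is bounded; that
  u lies in the domain is part of the conclusion. The converse is
  \<open>spectral_integral_trunc\<close>.\<close>

lemma spectral_integralI:
  assumes m[measurable]: "\<phi> \<in> borel_measurable borel" and u: "u \<in> H" and v: "v \<in> H"
    and eq: "\<And>n g. g \<in> H \<Longrightarrow> ip v (E (trunc \<phi> n) g) = bil (\<lambda>t. \<phi> t * indicator (trunc \<phi> n) t) u g"
  shows "(u, v) \<in> spectral_integral M E \<phi>"
proof -
  have uD: "u \<in> spectral_domain M E \<phi>"
  proof (rule spectral_domainI[OF m u])
    fix n
    let ?p = "\<lambda>t. \<phi> t * indicator (trunc \<phi> n) t"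
    \<comment> \<open>The chain evaluates the squared norm of the truncated operator at u: it equals
      \<open>ip v (E (trunc \<phi> n) v)\<close>, hence is at most ||v||^2 uniformly in n.\<close>
    have "bil (\<lambda>t. (?p t)\<^sup>2) u u = ip (fc ?p u) (fc ?p u)"
      using u by (simp only: power2_eq_square fc_fc_inner bdd_trunc m)
    also have "\<dots> = bil ?p u (fc ?p u)" using u by (simp add: fc_inner)
    also have "\<dots> = ip v (E (trunc \<phi> n) (fc ?p u))" using u by (simp add: eq)
    also have "\<dots> = ip (fc ?p u) (E (trunc \<phi> n) v)" using u v by (simp add: E_sym[symmetric] L.sym)
    also have "\<dots> = bil (\<lambda>t. ?p t * indicator (trunc \<phi> n) t) u v" using u v by (simp add: fc_inner bil_E_right)
    also have "(\<lambda>t. ?p t * indicator (trunc \<phi> n) t) = ?p" by (auto simp: indicator_def)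
    also have "bil ?p u v = ip v (E (trunc \<phi> n) v)" using v by (simp add: eq)
    also have "\<dots> = bil (indicator (trunc \<phi> n)) v v" using v by (simp add: bil_indicator E_sym)
    also have "\<dots> \<le> 1 * ip v v" using v by (intro bil_self_le) (auto simp: indicator_def)
    finally show "bil (\<lambda>t. (?p t)\<^sup>2) u u \<le> ip v v" by simp
  qed
  have "ip v g = bil \<phi> u g" if g: "g \<in> spectral_domain M E \<phi>" for g
  proof (rule LIMSEQ_unique)
    have gH: "g \<in> H" using spectral_domainD(1)[OF m g] .
    show "(\<lambda>n. bil (\<lambda>t. \<phi> t * indicator (trunc \<phi> n) t) u g) \<longlonglongrightarrow> bil \<phi> u g"
      by (rule bil_trunc_tendsto[OF m uD g])
    have "(\<lambda>n. bil (\<lambda>t. 1 * indicator (trunc \<phi> n) t) v g) \<longlonglongrightarrow> bil (\<lambda>t. 1) v g"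
      using v gH by (intro bil_lim[of _ 1] tendsto_trunc) (auto simp: indicator_def)
    then show "(\<lambda>n. bil (\<lambda>t. \<phi> t * indicator (trunc \<phi> n) t) u g) \<longlonglongrightarrow> ip v g"
      using v gH by (simp add: bil_const_one bil_indicator E_sym eq)
  qed
  then show ?thesis using uD v by (simp add: spectral_integral_iff)
qed

text \<open>Since \<phi> is bounded on \<open>A\<close>, the range of \<open>E A\<close> lies in the
  spectral domain, and the defining identity can be tested there.\<close>

lemma spectral_integral_trunc:
  assumes m[measurable]: "\<phi> \<in> borel_measurable borel" and uv: "(u, v) \<in> spectral_integral M E \<phi>"
    and A[measurable]: "A \<in> sets borel" and K: "\<And>t. t \<in> A \<Longrightarrow> \<bar>\<phi> t\<bar> \<le> K" and g: "g \<in> H"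
  shows "ip v (E A g) = bil (\<lambda>t. \<phi> t * indicator A t) u g"
proof -
  have uD: "u \<in> spectral_domain M E \<phi>" and v: "v \<in> H" using uv by (auto simp: spectral_integral_iff)
  have u: "u \<in> H" using spectral_domainD(1)[OF m uD] .
  have bA: "\<bar>\<phi> t * indicator A t\<bar> \<le> \<bar>K\<bar>" for t using K[of t] by (auto simp: indicator_def)
  have gD: "E A g \<in> spectral_domain M E \<phi>"
  proof (rule spectral_domainI[OF m])
    fix n
    let ?p = "\<lambda>t. (\<phi> t * indicator (trunc \<phi> n) t)\<^sup>2"
    have b: "?p \<in> bdd_borel" by (intro bdd_borel_power bdd_trunc m)
    have "bil ?p (E A g) (E A g) = bil (\<lambda>t. ?p t * indicator A t) (E A g) g"
      using b g by (simp add: bil_E_right)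
    also have "\<dots> = bil (\<lambda>t. ?p t * indicator A t) g (E A g)"
      using b g by (intro bil_sym) auto
    also have "\<dots> = bil (\<lambda>t. ?p t * indicator A t * indicator A t) g g"
      using b g by (simp add: bil_E_right)
    also have "\<dots> \<le> \<bar>K\<bar>\<^sup>2 * ip g g"
    proof (intro bil_self_le g)
      show "?p t * indicator A t * indicator A t \<le> \<bar>K\<bar>\<^sup>2" for t
        using power_mono[OF bA abs_ge_zero, of t 2] by (cases "t \<in> A"; cases "t \<in> trunc \<phi> n") auto
    qed (use b in simp)
    finally show "bil ?p (E A g) (E A g) \<le> \<bar>K\<bar>\<^sup>2 * ip g g" .
  qed (use g in simp)
  have "(\<lambda>n. bil (\<lambda>t. \<phi> t * indicator (trunc \<phi> n) t) u (E A g)) \<longlonglongrightarrow> bil \<phi> u (E A g)"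
    by (rule bil_trunc_tendsto[OF m uD gD])
  also have "bil \<phi> u (E A g) = ip v (E A g)" using uv gD by (simp add: spectral_integral_iff)
  finally have 1: "(\<lambda>n. bil (\<lambda>t. \<phi> t * indicator A t * indicator (trunc \<phi> n) t) u g) \<longlonglongrightarrow> ip v (E A g)"
    using u g by (simp add: bil_E_right mult.assoc mult.commute[of "indicator A _"])
  have 2: "(\<lambda>n. bil (\<lambda>t. \<phi> t * indicator A t * indicator (trunc \<phi> n) t) u g) \<longlonglongrightarrow> bil (\<lambda>t. \<phi> t * indicator A t) u g"
  proof (intro bil_lim[of _ "\<bar>K\<bar>"] tendsto_trunc u g)
    show "\<bar>\<phi> t * indicator A t * indicator (trunc \<phi> n) t\<bar> \<le> \<bar>K\<bar>" for n t
      using bA[of t] by (auto simp: indicator_def split: if_splits)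
  qed measurable
  show ?thesis by (rule LIMSEQ_unique[OF 1 2])
qed

lemma spectral_integral_cong:
  assumes "\<phi> \<in> borel_measurable borel" "\<psi> \<in> borel_measurable borel"
    and ae: "\<And>h. h \<in> H \<Longrightarrow> AE t in mu h. \<phi> t = \<psi> t"
  shows "spectral_integral M E \<phi> = spectral_integral M E \<psi>"
proof -
  have "integrable (mu h) (\<lambda>t. (\<phi> t)\<^sup>2) \<longleftrightarrow> integrable (mu h) (\<lambda>t. (\<psi> t)\<^sup>2)" if "h \<in> H" for h
    using ae[OF that] assms(1,2) by (intro integrable_cong_AE) auto
  then have d: "spectral_domain M E \<phi> = spectral_domain M E \<psi>" by (auto simp: spectral_domain_def)
  have "bil \<phi> u g = bil \<psi> u g" if "u \<in> H" "g \<in> H" for u g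
    using that assms by (intro bil_cong)
  then show ?thesis
    by (auto simp: spectral_integral_iff d) (auto simp: spectral_domain_def)
qed

text \<open>The rule \<phi>(T) \<psi>(T) u = \<rho>(T) u. It produces elements in the graph of an
  unbounded operator, for instance A A^(-1) g = g.\<close>

lemma spectral_integral_fc:
  assumes m: "\<phi> \<in> borel_measurable borel" and "\<psi> \<in> bdd_borel" "\<rho> \<in> bdd_borel" and u: "u \<in> H"
    and ae: "\<And>h. h \<in> H \<Longrightarrow> AE t in mu h. \<phi> t * \<psi> t = \<rho> t"
  shows "(fc \<psi> u, fc \<rho> u) \<in> spectral_integral M E \<phi>"
proof (rule spectral_integralI[OF m])
  fix n g assume g: "g \<in> H"
  have "ip (fc \<rho> u) (E (trunc \<phi> n) g) = bil (\<lambda>t. \<rho> t * indicator (trunc \<phi> n) t) u g"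
    using assms g by (simp add: fc_inner bil_E_right)
  also have "\<dots> = bil (\<lambda>t. \<phi> t * indicator (trunc \<phi> n) t * \<psi> t) u g"
  proof (rule bil_cong[OF _ _ u g])
    show "AE t in mu h. \<rho> t * indicator (trunc \<phi> n) t = \<phi> t * indicator (trunc \<phi> n) t * \<psi> t" if "h \<in> H" for h
      using ae[OF that] by eventually_elim (auto simp: indicator_def)
  qed (use assms in \<open>auto intro!: borel_measurable_times dest: bdd_borelD\<close>)
  also have "\<dots> = bil (\<lambda>t. \<phi> t * indicator (trunc \<phi> n) t) (fc \<psi> u) g"
    using assms g by (simp add: bil_fc)
  finally show "ip (fc \<rho> u) (E (trunc \<phi> n) g) = bil (\<lambda>t. \<phi> t * indicator (trunc \<phi> n) t) (fc \<psi> u) g" .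
qed (use assms in auto)

lemma spectral_integral_bdd:
  assumes "\<phi> \<in> bdd_borel" "(u, v) \<in> spectral_integral M E \<phi>" "g \<in> H"
  shows "ip v g = bil \<phi> u g"
proof -
  obtain K where K: "\<And>t. \<bar>\<phi> t\<bar> \<le> K" using bdd_borelE[OF assms(1)] by metis
  have "v \<in> H" using assms(2) by (simp add: spectral_integral_iff)
  then have "ip v g = ip v (E UNIV g)" using assms by (simp add: E_UNIV E_sym[symmetric])
  then show ?thesis
    using spectral_integral_trunc[OF bdd_borelD[OF assms(1)] assms(2) _ K assms(3), of UNIV] by simp
qed

text \<open>The bound is tested on the range of the projection onto \<open>[- n, c - 1 / (n + 1)]\<close>.\<close>

lemma concentrated_above:
  assumes ge: "\<And>u v. (u, v) \<in> spectral_integral M E (\<lambda>t. t) \<Longrightarrow> c * ip u u \<le> ip v u" and h: "h \<in> H"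
  shows "AE t in mu h. c \<le> t"
proof -
  interpret fin: finite_measure "mu h" by (rule finite_mu[OF h])
  have "AE t in mu h. t \<notin> {- real n .. c - 1 / real (Suc n)}" for n
  proof -
    \<comment> \<open>The lower end keeps t bounded on \<open>A\<close>; the gap below c makes any
      positive mass of \<open>A\<close> contradict the lower bound.\<close>
    define A where "A = {- real n .. c - 1 / real (Suc n)}"
    let ?i = "indicator A :: real \<Rightarrow> real"
    have [measurable]: "A \<in> sets borel" by (simp add: A_def)
    have b: "(\<lambda>t. t * ?i t) \<in> bdd_borel"
    proof (rule bdd_borelI[of _ "real n + \<bar>c\<bar>"])
      have "0 \<le> 1 / real (Suc n)" by simp
      then have "\<bar>t\<bar> \<le> real n + \<bar>c\<bar>" if "t \<in> A" for t
        using that unfolding A_def atLeastAtMost_iff by linarith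
      then show "\<bar>t * ?i t\<bar> \<le> real n + \<bar>c\<bar>" for t
        by (cases "t \<in> A") auto
    qed measurable
    have "(fc ?i h, fc (\<lambda>t. t * ?i t) h) \<in> spectral_integral M E (\<lambda>t. t)"
      using h b by (intro spectral_integral_fc) auto
    from ge[OF this] have "c * bil (\<lambda>t. ?i t * ?i t) h h \<le> bil (\<lambda>t. t * ?i t * ?i t) h h"
      using h b by (simp add: fc_fc_inner)
    also have "(\<lambda>t. t * ?i t * ?i t) = (\<lambda>t. t * ?i t)" by (auto simp: indicator_def)
    also have "bil (\<lambda>t. t * ?i t) h h \<le> bil (\<lambda>t. (c - 1 / real (Suc n)) * ?i t) h h"
    proof -
      have b': "(\<lambda>t. (c - 1 / real (Suc n)) * ?i t) \<in> bdd_borel" by (intro bdd_borel_mult) auto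
      have "t * ?i t \<le> (c - 1 / real (Suc n)) * ?i t" for t
        by (cases "t \<in> A") (auto simp: A_def)
      then have "(LINT t|mu h. t * ?i t) \<le> (LINT t|mu h. (c - 1 / real (Suc n)) * ?i t)"
        using h b b' by (intro integral_mono integrable_bdd) auto
      then show ?thesis by (simp only: bil_self[OF b h] bil_self[OF b' h])
    qed
    also have "\<dots> = (c - 1 / real (Suc n)) * bil ?i h h"
      using bil_lin_fun[of ?i ?i h h "c - 1 / real (Suc n)" 0] h by simp
    also have "(\<lambda>t. ?i t * ?i t) = ?i" by (auto simp: indicator_def)
    finally have "1 / real (Suc n) * bil ?i h h \<le> 0" by (simp add: algebra_simps)
    then have "bil ?i h h \<le> 0" by (simp add: divide_le_0_iff)
    then have "measure (mu h) A = 0"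
      using h E_nonneg[of A h] by (simp add: bil_indicator measure_mu)
    then have "emeasure (mu h) A = 0" by (simp add: fin.emeasure_eq_measure)
    then show ?thesis unfolding A_def[symmetric] by (intro AE_not_in) (simp add: null_sets_def)
  qed
  then have "AE t in mu h. \<forall>n. t \<notin> {- real n .. c - 1 / real (Suc n)}" by (simp add: AE_all_countable)
  then show ?thesis
  proof eventually_elim
    case (elim t)
    show ?case
    proof (rule ccontr)
      assume "\<not> c \<le> t"
      obtain n1 where n1: "\<bar>t\<bar> \<le> real n1" using real_arch_simple by blast
      obtain n2 where n2: "1 / (c - t) \<le> real n2" using real_arch_simple by blast
      define n where "n = max n1 n2"
      have "1 / (c - t) \<le> real (Suc n)" using n2 by (auto simp: n_def)
      then have "1 / real (Suc n) \<le> c - t" using \<open>\<not> c \<le> t\<close> by (simp add: field_simps)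
      moreover have "- real n \<le> t" using n1 by (auto simp: n_def)
      ultimately show False using elim by (auto dest: spec[of _ n])
    qed
  qed
qed

end

section \<open>The energy space\<close>

lemma sigma_finite_lebesgue: "sigma_finite_measure (lebesgue :: 'a::euclidean_space measure)"
proof
  obtain A :: "'a set set" where A: "countable A" "A \<subseteq> sets lborel" "\<Union> A = space lborel"
    "\<forall>a\<in>A. emeasure lborel a \<noteq> \<infinity>"
    using lborel.sigma_finite_countable by blast
  then show "\<exists>A::'a set set. countable A \<and> A \<subseteq> sets lebesgue \<and> \<Union> A = space lebesgue \<and>
      (\<forall>a\<in>A. emeasure lebesgue a \<noteq> \<infinity>)"
  proof (intro exI[of _ A] conjI ballI)
    show "A \<subseteq> sets lebesgue"
    proof
      fix B assume "B \<in> A"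
      then have "B \<in> sets lborel" using A(2) by blast
      then show "B \<in> sets lebesgue" by (rule sets_completionI_sets)
    qed
    show "emeasure lebesgue B \<noteq> \<infinity>" if "B \<in> A" for B
    proof -
      have "B \<in> sets lborel" using that A(2) by blast
      then have "emeasure lebesgue B = emeasure lborel B" by simp
      then show ?thesis using A(4) that by simp
    qed
  qed simp_all
qed

text \<open>The exceptional pairs lie in the null set
  \<open>N \<times> UNIV \<union> UNIV \<times> N\<close>. This carries a.e. convergence and a.e.
  equality over to the difference quotient of a function.\<close>

lemma AE_lebesgue_pair:
  assumes "AE x in lebesgue. P (x :: 'a::euclidean_space)"
  shows "AE p in lebesgue \<Otimes>\<^sub>M lebesgue. P (fst p) \<and> P (snd p)"
proof -
  interpret S: sigma_finite_measure "lebesgue :: 'a measure" by (rule sigma_finite_lebesgue)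
  obtain N where N: "N \<in> null_sets (lebesgue :: 'a measure)" "{x. \<not> P x} \<subseteq> N"
    using assms by (auto simp: eventually_ae_filter)
  have "N \<times> UNIV \<union> UNIV \<times> N \<in> null_sets ((lebesgue :: 'a measure) \<Otimes>\<^sub>M (lebesgue :: 'a measure))"
  proof (rule null_sets.Un)
    have n: "N \<in> sets lebesgue" "emeasure lebesgue N = 0" using N(1) by auto
    have u: "(UNIV :: 'a set) \<in> sets lebesgue" by simp
    show "N \<times> UNIV \<in> null_sets ((lebesgue :: 'a measure) \<Otimes>\<^sub>M (lebesgue :: 'a measure))"
      by (rule null_setsI[OF _ pair_measureI[OF n(1) u]])
        (simp only: S.emeasure_pair_measure_Times[OF n(1) u] n(2) mult_zero_left)
    show "UNIV \<times> N \<in> null_sets ((lebesgue :: 'a measure) \<Otimes>\<^sub>M (lebesgue :: 'a measure))"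
      by (rule null_setsI[OF _ pair_measureI[OF u n(1)]])
        (simp only: S.emeasure_pair_measure_Times[OF u n(1)] n(2) mult_zero_right)
  qed
  moreover have "{p \<in> space ((lebesgue :: 'a measure) \<Otimes>\<^sub>M (lebesgue :: 'a measure)). \<not> (P (fst p) \<and> P (snd p))} \<subseteq> N \<times> UNIV \<union> UNIV \<times> N"
    using N(2) by auto
  ultimately show ?thesis by (rule AE_I')
qed

section \<open>Restriction to a set and extension by zero\<close>

lemma zero_ext_indicator: "zero_ext S f = (\<lambda>x. indicator S x *\<^sub>R f x)"
  by (auto simp: zero_ext_def indicator_def)

lemma L2_on_measurable_iff:
  "S \<in> sets lebesgue \<Longrightarrow> f \<in> borel_measurable (lebesgue_on S) \<longleftrightarrow> zero_ext S f \<in> borel_measurable lebesgue"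
  unfolding zero_ext_indicator by (intro borel_measurable_restrict_space_iff) auto

lemma L2_on_iff:
  assumes "S \<in> sets lebesgue"
  shows "f \<in> L2_space (lebesgue_on S) \<longleftrightarrow> zero_ext S f \<in> L2_space lebesgue"
proof -
  have "(\<lambda>x. (zero_ext S f x)\<^sup>2) = (\<lambda>x. indicator S x *\<^sub>R (f x)\<^sup>2)"
    by (auto simp: zero_ext_def indicator_def)
  moreover have "integrable (lebesgue_on S) (\<lambda>x. (f x)\<^sup>2) \<longleftrightarrow> integrable lebesgue (\<lambda>x. indicator S x *\<^sub>R (f x)\<^sup>2)"
    using assms by (intro integrable_restrict_space) auto
  ultimately show ?thesis using L2_on_measurable_iff[OF assms] by (simp add: L2_space_def)
qed

lemma L2_inner_on:
  assumes "S \<in> sets lebesgue"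
  shows "L2_inner (lebesgue_on S) f g = L2_inner lebesgue (zero_ext S f) (zero_ext S g)"
proof -
  have "(\<lambda>x. zero_ext S f x * zero_ext S g x) = (\<lambda>x. indicator S x *\<^sub>R (f x * g x))"
    by (auto simp: zero_ext_def indicator_def)
  moreover have "(LINT x|lebesgue_on S. f x * g x) = (LINT x|lebesgue. indicator S x *\<^sub>R (f x * g x))"
    using assms by (intro integral_restrict_space) auto
  ultimately show ?thesis by (simp add: L2_inner_def)
qed

lemma zero_ext_subset: "T \<subseteq> S \<Longrightarrow> zero_ext T (zero_ext S f) = zero_ext T f"
  by (auto simp: zero_ext_def fun_eq_iff)

lemma zero_ext_superset: "T \<subseteq> S \<Longrightarrow> zero_ext S (zero_ext T f) = zero_ext T f"
  by (auto simp: zero_ext_def fun_eq_iff)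

lemma L2_zero_ext:
  assumes "f \<in> L2_space lebesgue" "S \<in> sets lebesgue"
  shows "zero_ext S f \<in> L2_space lebesgue"
proof -
  have "f \<in> borel_measurable (lebesgue_on S)"
    using L2_spaceD(1)[OF assms(1)] by (simp add: measurable_restrict_space1)
  moreover have "integrable lebesgue (\<lambda>x. indicator S x *\<^sub>R (f x)\<^sup>2)"
    using assms L2_spaceD(2)[OF assms(1)] by (intro integrable_mult_indicator) auto
  then have "integrable (lebesgue_on S) (\<lambda>x. (f x)\<^sup>2)"
    using assms by (subst integrable_restrict_space) auto
  ultimately have "f \<in> L2_space (lebesgue_on S)" by (simp add: L2_space_def)
  then show ?thesis by (rule L2_on_iff[OF assms(2), THEN iffD1])
qed

lemma L2_on_subset:
  assumes "f \<in> L2_space (lebesgue_on S)" "S \<in> sets lebesgue" "T \<in> sets lebesgue" "T \<subseteq> S"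
  shows "f \<in> L2_space (lebesgue_on T)"
  using L2_zero_ext[of "zero_ext S f" T] assms by (simp add: L2_on_iff zero_ext_subset)

lemma L2_on_if_L2:
  assumes "f \<in> L2_space lebesgue" "S \<in> sets lebesgue"
  shows "f \<in> L2_space (lebesgue_on S)"
  using L2_zero_ext[OF assms] assms(2) by (simp add: L2_on_iff)

lemma L2_inner_subset_le:
  assumes "f \<in> L2_space (lebesgue_on S)" "S \<in> sets lebesgue" "T \<in> sets lebesgue" "T \<subseteq> S"
  shows "L2_inner (lebesgue_on T) f f \<le> L2_inner (lebesgue_on S) f f"
proof -
  have "L2_inner lebesgue (zero_ext T f) (zero_ext T f) \<le> L2_inner lebesgue (zero_ext S f) (zero_ext S f)"
    unfolding L2_inner_def using assms(4) L2_on_subset[OF assms] assms(1)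
    by (intro integral_mono L2_integrable_mult)
      (auto simp: L2_on_iff[OF assms(2)] L2_on_iff[OF assms(3)], auto simp: zero_ext_def)
  then show ?thesis by (simp add: L2_inner_on assms)
qed

lemma AE_lebesgue_on_iff:
  "S \<in> sets lebesgue \<Longrightarrow> (AE x in lebesgue_on S. P x) \<longleftrightarrow> (AE x in lebesgue. x \<in> S \<longrightarrow> P x)"
  by (intro AE_restrict_space_iff) auto

text \<open>The exponent is halved so that the seminorm of \<open>H\<^sup>s\<close> becomes the L2 norm of \<open>gagliardo s u\<close>.\<close>

definition gagliardo :: "real \<Rightarrow> ('a::euclidean_space \<Rightarrow> real) \<Rightarrow> 'a \<times> 'a \<Rightarrow> real" where
  "gagliardo s u = (\<lambda>(x, y). (u x - u y) / norm (x - y) powr ((real DIM('a) + 2 * s) / 2))"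

lemma gagliardo_mult:
  fixes u v :: "'a::euclidean_space \<Rightarrow> real"
  shows "gagliardo s u p * gagliardo s v p =
    (case p of (x, y) \<Rightarrow> (u x - u y) * (v x - v y) / norm (x - y) powr (real DIM('a) + 2 * s))"
proof -
  have "r powr q = r powr (q / 2) * r powr (q / 2)" for r q :: real
    by (simp flip: powr_add)
  from this[of "norm (fst p - snd p)" "real DIM('a) + 2 * s"] show ?thesis
    unfolding gagliardo_def case_prod_beta by simp
qed

lemma gagliardo_lin: "gagliardo s (\<lambda>x. a * u x + b * v x) = (\<lambda>p. a * gagliardo s u p + b * gagliardo s v p)"
  by (auto simp: gagliardo_def algebra_simps add_divide_distrib diff_divide_distrib)

lemma gagliardo_measurable:
  fixes u :: "'a::euclidean_space \<Rightarrow> real"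
  assumes [measurable]: "u \<in> borel_measurable lebesgue"
  shows "gagliardo s u \<in> borel_measurable (lebesgue \<Otimes>\<^sub>M lebesgue)"
proof -
  have [measurable]: "(\<lambda>x::'a. x) \<in> borel_measurable lebesgue"
    by (intro measurable_completion) simp
  have [measurable]: "(\<lambda>p. fst p) \<in> borel_measurable ((lebesgue :: 'a measure) \<Otimes>\<^sub>M (lebesgue :: 'a measure))"
    by (rule measurable_compose[OF measurable_fst \<open>(\<lambda>x. x) \<in> _\<close>])
  have [measurable]: "(\<lambda>p. snd p) \<in> borel_measurable ((lebesgue :: 'a measure) \<Otimes>\<^sub>M (lebesgue :: 'a measure))"
    by (rule measurable_compose[OF measurable_snd \<open>(\<lambda>x. x) \<in> _\<close>])
  show ?thesis unfolding gagliardo_def case_prod_beta by measurable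
qed

lemma fracSobolev_iff:
  "u \<in> fracSobolev s \<longleftrightarrow> u \<in> L2_space lebesgue \<and> gagliardo s u \<in> L2_space (lebesgue \<Otimes>\<^sub>M lebesgue)"
  using gagliardo_measurable[of u s]
  by (auto simp: fracSobolev_def L2_space_def power2_eq_square gagliardo_mult case_prod_beta')

lemma H0s_form_eq:
  fixes u :: "'a::euclidean_space \<Rightarrow> real"
  shows "H0s_form \<Omega> s u v = L2_inner (lebesgue_on \<Omega>) u v +
    fracLap_const DIM('a) s / 2 * L2_inner (lebesgue \<Otimes>\<^sub>M lebesgue) (gagliardo s u) (gagliardo s v)"
  by (simp add: H0s_form_def L2_inner_def gagliardo_mult)

lemma fracLap_const_pos: "0 < s \<Longrightarrow> s < 1 \<Longrightarrow> 0 < fracLap_const N s"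
  unfolding fracLap_const_def
  by (intro divide_pos_pos mult_pos_pos Gamma_real_pos) (auto simp: add_nonneg_pos)

section \<open>The space \<open>H0s\<close>: lower semicontinuity of the energy and
  completeness\<close>

locale frac_domain =
  fixes \<Omega> :: "'a::euclidean_space set" and s :: real
  assumes \<Omega>[measurable]: "\<Omega> \<in> sets lebesgue" and s: "0 < s" "s < 1"
begin

abbreviation "V \<equiv> H0s \<Omega> s"
abbreviation "a \<equiv> H0s_form \<Omega> s"
abbreviation "ip\<^sub>\<Omega> \<equiv> L2_inner (lebesgue_on \<Omega>)"
abbreviation "H\<^sub>\<Omega> \<equiv> L2_space (lebesgue_on \<Omega>)"

sublocale O: semi_hilbert "H\<^sub>\<Omega>" "ip\<^sub>\<Omega>" by (rule L2_semi_hilbert)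

sublocale G: semi_ip "L2_space ((lebesgue :: 'a measure) \<Otimes>\<^sub>M (lebesgue :: 'a measure))"
  "L2_inner ((lebesgue :: 'a measure) \<Otimes>\<^sub>M (lebesgue :: 'a measure))" by (rule L2_semi_ip)

lemma V_iff: "u \<in> V \<longleftrightarrow> u \<in> L2_space lebesgue \<and>
    gagliardo s u \<in> L2_space (lebesgue \<Otimes>\<^sub>M lebesgue) \<and> (AE x in lebesgue. x \<notin> \<Omega> \<longrightarrow> u x = 0)"
  by (auto simp: H0s_def fracSobolev_iff)

lemma V_L2: "u \<in> V \<Longrightarrow> u \<in> L2_space lebesgue" by (simp add: V_iff)

lemma V_H [simp]: "u \<in> V \<Longrightarrow> u \<in> H\<^sub>\<Omega>"
  by (rule L2_on_if_L2[OF V_L2 \<Omega>])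

sublocale V: semi_ip V a
proof
  let ?c = "fracLap_const DIM('a) s / 2"
  have c: "0 \<le> ?c" using fracLap_const_pos[OF s] by (simp add: less_imp_le)
  interpret W: semi_ip "L2_space (lebesgue :: 'a measure)" "L2_inner lebesgue" by (rule L2_semi_ip)
  show "(\<lambda>x. 0) \<in> V" using G.zero_in W.zero_in by (simp add: V_iff gagliardo_def case_prod_beta')
  show "(\<lambda>x. b * f x + d * g x) \<in> V" if fg: "f \<in> V" "g \<in> V" for f g b d
  proof -
    have "AE x in lebesgue. x \<notin> \<Omega> \<longrightarrow> f x = 0" "AE x in lebesgue. x \<notin> \<Omega> \<longrightarrow> g x = 0"
      using fg by (auto simp: V_iff)
    then have "AE x in lebesgue. x \<notin> \<Omega> \<longrightarrow> b * f x + d * g x = 0" by eventually_elim simp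
    then show ?thesis using fg by (auto simp: V_iff gagliardo_lin intro: G.lin_in W.lin_in)
  qed
  show "a f g = a g f" if "f \<in> V" "g \<in> V" for f g
    using that by (simp add: H0s_form_eq O.sym[of f g] G.sym[of "gagliardo s f" "gagliardo s g"] V_iff)
  show "a (\<lambda>x. b * f x + d * g x) h = b * a f h + d * a g h" if "f \<in> V" "g \<in> V" "h \<in> V" for f g h b d
  proof -
    have "gagliardo s w \<in> L2_space (lebesgue \<Otimes>\<^sub>M lebesgue)" if "w \<in> V" for w using that by (simp add: V_iff)
    with that show ?thesis
      by (simp add: H0s_form_eq gagliardo_lin G.lin O.lin algebra_simps)
  qed
  show "0 \<le> a f f" if "f \<in> V" for f
    using that c O.nonneg[of f] G.nonneg[of "gagliardo s f"] V_iff[of f] by (simp add: H0s_form_eq)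
qed

lemma H_le_V: "u \<in> V \<Longrightarrow> ip\<^sub>\<Omega> u u \<le> a u u"
  using fracLap_const_pos[OF s, of "DIM('a)"] G.nonneg[of "gagliardo s u"]
  by (simp add: H0s_form_eq V_iff)

text \<open>A subsequence converges a.e., hence so do its difference quotients, and Fatou applies to
  them. The limit is given on \<Omega> only, so the conclusion concerns its extension. Besides
  completeness, this yields independence of the representative and the energy bound for
  A^(-1/2).\<close>

lemma V_lower_semicontinuous:
  assumes v: "\<And>n. v n \<in> V" and f: "f \<in> H\<^sub>\<Omega>"
    and lim: "(\<lambda>n. ip\<^sub>\<Omega> (\<lambda>x. v n x - f x) (\<lambda>x. v n x - f x)) \<longlonglongrightarrow> 0"
    and C: "\<And>n. N \<le> n \<Longrightarrow> a (v n) (v n) \<le> C"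
  shows "zero_ext \<Omega> f \<in> V" "a (zero_ext \<Omega> f) (zero_ext \<Omega> f) \<le> C"
proof -
  let ?f = "zero_ext \<Omega> f"
  define c where "c = fracLap_const DIM('a) s / 2"
  have c: "0 < c" using fracLap_const_pos[OF s] by (simp add: c_def)
  have d: "(\<lambda>x. v n x - f x) \<in> H\<^sub>\<Omega>" for n by (intro O.diff_in V_H v f)
  have "\<exists>r::nat\<Rightarrow>nat. strict_mono r \<and> (AE x in lebesgue_on \<Omega>. (\<lambda>n. (v (r n) x - f x)\<^sup>2) \<longlonglongrightarrow> 0)"
    using L2_spaceD(2)[OF d] lim
    by (intro tendsto_L1_AE_subseq) (auto simp: L2_inner_def power2_eq_square)
  then obtain r :: "nat \<Rightarrow> nat" where r: "strict_mono r"
    and "AE x in lebesgue_on \<Omega>. (\<lambda>n. (v (r n) x - f x)\<^sup>2) \<longlonglongrightarrow> 0" by blast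
  then have "AE x in lebesgue. x \<in> \<Omega> \<longrightarrow> (\<lambda>n. (v (r n) x - f x)\<^sup>2) \<longlonglongrightarrow> 0"
    by (simp add: AE_lebesgue_on_iff)
  moreover have "AE x in lebesgue. \<forall>n. x \<notin> \<Omega> \<longrightarrow> v n x = 0"
    unfolding AE_all_countable using v V_iff by blast
  ultimately have conv: "AE x in lebesgue. (\<lambda>n. v (r n) x) \<longlonglongrightarrow> ?f x"
  proof eventually_elim
    case (elim x)
    show ?case
    proof (cases "x \<in> \<Omega>")
      case True
      then have "(\<lambda>n. sqrt ((v (r n) x - f x)\<^sup>2)) \<longlonglongrightarrow> sqrt 0"
        using elim by (intro tendsto_real_sqrt) blast
      then have "(\<lambda>n. v (r n) x - f x) \<longlonglongrightarrow> 0" by (simp add: tendsto_rabs_zero_iff)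
      then show ?thesis using True by (simp add: zero_ext_def LIM_zero_iff)
    next
      case False
      then show ?thesis using elim by (simp add: zero_ext_def)
    qed
  qed
  from AE_lebesgue_pair[OF conv]
  have convG: "AE p in lebesgue \<Otimes>\<^sub>M lebesgue. (\<lambda>n. gagliardo s (v (r n)) p) \<longlonglongrightarrow> gagliardo s ?f p"
  proof eventually_elim
    case (elim p)
    then show ?case unfolding gagliardo_def case_prod_beta divide_inverse
      by (intro tendsto_intros) auto
  qed
  have fL2: "?f \<in> L2_space lebesgue" using f by (simp add: L2_on_iff[OF \<Omega>])
  then have Gm: "gagliardo s ?f \<in> borel_measurable (lebesgue \<Otimes>\<^sub>M lebesgue)"
    by (intro gagliardo_measurable L2_spaceD)
  have nf: "ip\<^sub>\<Omega> ?f ?f = ip\<^sub>\<Omega> f f" by (simp add: L2_inner_on[OF \<Omega>] zero_ext_subset)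
  have conv_ip: "(\<lambda>n. ip\<^sub>\<Omega> (v n) (v n)) \<longlonglongrightarrow> ip\<^sub>\<Omega> f f"
  proof -
    have "ip\<^sub>\<Omega> (v n) (v n) = ip\<^sub>\<Omega> (\<lambda>x. v n x - f x) (\<lambda>x. v n x - f x) + 2 * ip\<^sub>\<Omega> (v n) f - ip\<^sub>\<Omega> f f" for n
      using v f by (simp add: O.square_diff)
    moreover have "(\<lambda>n. ip\<^sub>\<Omega> (\<lambda>x. v n x - f x) (\<lambda>x. v n x - f x) + 2 * ip\<^sub>\<Omega> (v n) f - ip\<^sub>\<Omega> f f)
        \<longlonglongrightarrow> 0 + 2 * ip\<^sub>\<Omega> f f - ip\<^sub>\<Omega> f f"
      using v f by (intro tendsto_intros lim O.tendsto_left) auto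
    ultimately show ?thesis by simp
  qed
  have vG: "gagliardo s (v n) \<in> L2_space (lebesgue \<Otimes>\<^sub>M lebesgue)" for n using v V_iff by blast
  \<comment> \<open>Fatou asks for a bound of the Gagliardo part alone. The L2 part converges, so it
    eventually exceeds its limit minus e, and the remainder of C is left for the Gagliardo part; e
    tends to 0 at the end.\<close>
  have G: "gagliardo s ?f \<in> L2_space (lebesgue \<Otimes>\<^sub>M lebesgue) \<and>
      L2_inner (lebesgue \<Otimes>\<^sub>M lebesgue) (gagliardo s ?f) (gagliardo s ?f) \<le> (C - ip\<^sub>\<Omega> f f + e) / c"
    if e: "0 < e" for e
  proof -
    have "\<forall>\<^sub>F n in sequentially. ip\<^sub>\<Omega> f f - e < ip\<^sub>\<Omega> (v n) (v n)"
      using conv_ip e by (intro order_tendstoD) auto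
    then obtain N' where N': "\<And>n. N' \<le> n \<Longrightarrow> ip\<^sub>\<Omega> f f - e < ip\<^sub>\<Omega> (v n) (v n)"
      by (auto simp: eventually_sequentially)
    have b: "L2_inner (lebesgue \<Otimes>\<^sub>M lebesgue) (gagliardo s (v (r n))) (gagliardo s (v (r n)))
        \<le> (C - ip\<^sub>\<Omega> f f + e) / c" if "max N N' \<le> n" for n
    proof -
      have n: "N \<le> r n" "N' \<le> r n" using that seq_suble[OF r, of n] by auto
      have "c * L2_inner (lebesgue \<Otimes>\<^sub>M lebesgue) (gagliardo s (v (r n))) (gagliardo s (v (r n)))
          \<le> C - ip\<^sub>\<Omega> f f + e"
        using C[OF n(1)] N'[OF n(2)] by (simp add: H0s_form_eq c_def)
      then show ?thesis using c by (simp add: field_simps)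
    qed
    show ?thesis using L2_Fatou[OF vG Gm convG b] by blast
  qed
  have "AE x in lebesgue. x \<notin> \<Omega> \<longrightarrow> ?f x = 0" by (simp add: zero_ext_def)
  then show V: "?f \<in> V" using G[of 1] fL2 by (simp add: V_iff)
  have "a ?f ?f \<le> C + e" if "0 < e" for e
    using G[OF that] c by (simp add: H0s_form_eq nf field_simps flip: c_def)
  then show "a ?f ?f \<le> C" by (rule field_le_epsilon)
qed

text \<open>Lower semicontinuity along the constant sequence u.\<close>

lemma V_zero_ext:
  assumes u: "u \<in> V"
  shows "zero_ext \<Omega> u \<in> V"
  using V_lower_semicontinuous(1)[OF u V_H[OF u], of 0 "a u u"] by (simp add: L2_inner_def)

text \<open>The constant sequence 0 converges to u in L2(\<Omega>), so lower semicontinuity makes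
  the energy of the extension of u vanish. The extension agrees with u a.e., and Cauchy-Schwarz does
  the rest.\<close>

lemma V_null:
  assumes u: "u \<in> V" and ae: "AE x in lebesgue_on \<Omega>. u x = 0" and v: "v \<in> V"
  shows "a u v = 0"
proof -
  have "ip\<^sub>\<Omega> u u = 0" using ae u by (simp add: L2_inner_self_eq_0)
  then have lim: "(\<lambda>n::nat. ip\<^sub>\<Omega> (\<lambda>x. 0 - u x) (\<lambda>x. 0 - u x)) \<longlonglongrightarrow> 0"
    by (simp add: L2_inner_def)
  have z: "a (\<lambda>x. 0) (\<lambda>x. 0) = 0" by (rule V.zero_left) (rule V.zero_in)
  have *: "zero_ext \<Omega> u \<in> V" "a (zero_ext \<Omega> u) (zero_ext \<Omega> u) \<le> 0"
    using V_lower_semicontinuous[OF V.zero_in V_H[OF u] lim, of 0 0] z by auto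
  have "AE x in lebesgue. x \<notin> \<Omega> \<longrightarrow> u x = 0" using u V_iff by blast
  then have "AE x in lebesgue. zero_ext \<Omega> u x = u x"
    by eventually_elim (auto simp: zero_ext_def)
  from AE_lebesgue_pair[OF this]
  have uz: "AE p in lebesgue \<Otimes>\<^sub>M lebesgue. gagliardo s (zero_ext \<Omega> u) p = gagliardo s u p"
    by eventually_elim (auto simp: gagliardo_def)
  have "a u u = a (zero_ext \<Omega> u) (zero_ext \<Omega> u)"
  proof -
    have "L2_inner (lebesgue \<Otimes>\<^sub>M lebesgue) (gagliardo s (zero_ext \<Omega> u)) (gagliardo s (zero_ext \<Omega> u))
      = L2_inner (lebesgue \<Otimes>\<^sub>M lebesgue) (gagliardo s u) (gagliardo s u)"
      using *(1) u by (intro L2_inner_cong_AE uz gagliardo_measurable L2_spaceD(1)[OF V_L2])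
    then show ?thesis by (simp add: H0s_form_eq L2_inner_on[OF \<Omega>] zero_ext_subset)
  qed
  then have "a u u = 0" using * V.nonneg[OF u] by simp
  then show ?thesis by (rule V.null_left[OF u v])
qed

lemma V_cong:
  assumes "u \<in> V" "u' \<in> V" "AE x in lebesgue_on \<Omega>. u x = u' x" "v \<in> V"
  shows "a u v = a u' v"
  using V_null[OF V.diff_in[OF assms(1,2)] _ assms(4)] assms by (simp add: V.diff_left)

sublocale V: semi_hilbert V a
proof
  fix X :: "nat \<Rightarrow> 'a \<Rightarrow> real"
  assume X: "\<And>n. X n \<in> V"
    and Cauchy: "\<And>e. 0 < e \<Longrightarrow> \<exists>N. \<forall>m\<ge>N. \<forall>n\<ge>N. a (\<lambda>x. X m x - X n x) (\<lambda>x. X m x - X n x) < e"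
  have d: "(\<lambda>x. X m x - X n x) \<in> V" for m n by (intro V.diff_in X)
  have "\<exists>N. \<forall>m\<ge>N. \<forall>n\<ge>N. ip\<^sub>\<Omega> (\<lambda>x. X m x - X n x) (\<lambda>x. X m x - X n x) < e" if "0 < e" for e
  proof -
    obtain N where N: "\<forall>m\<ge>N. \<forall>n\<ge>N. a (\<lambda>x. X m x - X n x) (\<lambda>x. X m x - X n x) < e"
      using Cauchy[OF \<open>0 < e\<close>] by blast
    show ?thesis using N by (intro exI[of _ N] allI impI le_less_trans[OF H_le_V[OF d]]) blast
  qed
  from O.complete[OF V_H[OF X] this] obtain f where f: "f \<in> H\<^sub>\<Omega>"
    and lim: "(\<lambda>n. ip\<^sub>\<Omega> (\<lambda>x. X n x - f x) (\<lambda>x. X n x - f x)) \<longlonglongrightarrow> 0" by blast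
  \<comment> \<open>For fixed m the differences \<open>X m - X n\<close> converge in L2(\<Omega>) to
    \<open>X m - f\<close>, and lower semicontinuity carries over their Cauchy bound.\<close>
  have close: "zero_ext \<Omega> (\<lambda>x. X m x - f x) \<in> V \<and>
      a (zero_ext \<Omega> (\<lambda>x. X m x - f x)) (zero_ext \<Omega> (\<lambda>x. X m x - f x)) \<le> e"
    if e: "\<And>n. N \<le> n \<Longrightarrow> a (\<lambda>x. X m x - X n x) (\<lambda>x. X m x - X n x) \<le> e" for m N e
  proof -
    have "(\<lambda>n. ip\<^sub>\<Omega> (\<lambda>x. (X m x - X n x) - (X m x - f x)) (\<lambda>x. (X m x - X n x) - (X m x - f x))) \<longlonglongrightarrow> 0"
      using lim by (simp add: L2_inner_def algebra_simps)
    then show ?thesis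
      using V_lower_semicontinuous[of "\<lambda>n x. X m x - X n x" "\<lambda>x. X m x - f x" N e] e d
        O.diff_in[OF V_H[OF X] f] by blast
  qed
  have z: "zero_ext \<Omega> f \<in> V"
  proof -
    obtain N where "\<forall>m\<ge>N. \<forall>n\<ge>N. a (\<lambda>x. X m x - X n x) (\<lambda>x. X m x - X n x) < 1" using Cauchy[of 1] by auto
    then have "\<And>n. N \<le> n \<Longrightarrow> a (\<lambda>x. X N x - X n x) (\<lambda>x. X N x - X n x) \<le> 1" by (simp add: less_imp_le)
    from close[OF this] have "zero_ext \<Omega> (\<lambda>x. X N x - f x) \<in> V" by blast
    then have "(\<lambda>x. X N x - zero_ext \<Omega> (\<lambda>x. X N x - f x) x) \<in> V" by (intro V.diff_in X)
    from V_zero_ext[OF this]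
    have "zero_ext \<Omega> (\<lambda>x. X N x - zero_ext \<Omega> (\<lambda>x. X N x - f x) x) \<in> V" .
    moreover have "zero_ext \<Omega> (\<lambda>x. X N x - zero_ext \<Omega> (\<lambda>x. X N x - f x) x) = zero_ext \<Omega> f"
      by (auto simp: zero_ext_def)
    ultimately show ?thesis by simp
  qed
  moreover have "(\<lambda>n. a (\<lambda>x. X n x - zero_ext \<Omega> f x) (\<lambda>x. X n x - zero_ext \<Omega> f x)) \<longlonglongrightarrow> 0"
  proof (rule LIMSEQ_I)
    fix e :: real assume "0 < e"
    then obtain N where N: "\<forall>m\<ge>N. \<forall>n\<ge>N. a (\<lambda>x. X m x - X n x) (\<lambda>x. X m x - X n x) < e / 2"
      using Cauchy[of "e / 2"] by auto
    have "norm (a (\<lambda>x. X m x - zero_ext \<Omega> f x) (\<lambda>x. X m x - zero_ext \<Omega> f x) - 0) < e" if m: "N \<le> m" for m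
    proof -
      \<comment> \<open>\<open>close\<close> controls the extension of the difference, while the
        goal asks for the difference with the extension. They agree on \<Omega>, which by
        \<open>V_cong\<close> is all that the form sees.\<close>
      let ?g = "zero_ext \<Omega> (\<lambda>x. X m x - f x)" and ?h = "\<lambda>x. X m x - zero_ext \<Omega> f x"
      have *: "?g \<in> V" "a ?g ?g \<le> e / 2" using close[of N m "e / 2"] N m by (auto simp: less_imp_le)
      have h: "?h \<in> V" by (rule V.diff_in[OF X z])
      have ae: "AE x in lebesgue_on \<Omega>. ?h x = ?g x"
        by (simp add: AE_lebesgue_on_iff zero_ext_def)
      have "a ?h ?h = a ?g ?h" by (rule V_cong[OF h *(1) ae h])
      also have "\<dots> = a ?h ?g" by (rule V.sym[OF *(1) h])
      also have "\<dots> = a ?g ?g" by (rule V_cong[OF h *(1) ae *(1)])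
      finally show ?thesis using * V.nonneg[OF h] \<open>0 < e\<close> by simp
    qed
    then show "\<exists>no. \<forall>n\<ge>no. norm (a (\<lambda>x. X n x - zero_ext \<Omega> f x) (\<lambda>x. X n x - zero_ext \<Omega> f x) - 0) < e"
      by blast
  qed
  ultimately show "\<exists>f\<in>V. (\<lambda>n. a (\<lambda>x. X n x - f x) (\<lambda>x. X n x - f x)) \<longlonglongrightarrow> 0" by blast
qed

end

section \<open>The Tikhonov functional and its Euler-Lagrange equation\<close>

locale tikhonov_setup = frac_domain \<Omega> s for \<Omega> :: "'a::euclidean_space set" and s +
  fixes \<omega> :: "'a set" and \<alpha> :: real
  assumes \<omega>: "\<omega> \<in> sets lebesgue" "\<omega> \<subseteq> \<Omega>" and \<alpha>: "0 < \<alpha>"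
begin

abbreviation "ip\<^sub>\<omega> \<equiv> L2_inner (lebesgue_on \<omega>)"
abbreviation "H\<^sub>\<omega> \<equiv> L2_space (lebesgue_on \<omega>)"

definition Q where "Q u v = ip\<^sub>\<omega> u v + \<alpha> * a u v"

sublocale W: semi_hilbert "H\<^sub>\<omega>" "ip\<^sub>\<omega>" by (rule L2_semi_hilbert)

lemma V_W [simp]: "u \<in> V \<Longrightarrow> u \<in> H\<^sub>\<omega>"
  by (rule L2_on_if_L2[OF V_L2 \<omega>(1)])

lemma W_le_V: "u \<in> V \<Longrightarrow> ip\<^sub>\<omega> u u \<le> a u u"
  using L2_inner_subset_le[OF V_H \<Omega> \<omega>] H_le_V order_trans by blast

lemma V_le_Q: "u \<in> V \<Longrightarrow> \<alpha> * a u u \<le> Q u u"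
  using W.nonneg[of u] by (simp add: Q_def)

text \<open>Completeness is inherited from the energy form, since \<alpha> a \<le> Q \<le> (1 +
  \<alpha>) a on the diagonal.\<close>

sublocale Q: semi_hilbert V Q
proof
  show "Q f g = Q g f" if "f \<in> V" "g \<in> V" for f g
    using that W.sym[of f g] V.sym[of f g] by (simp add: Q_def)
  show "Q (\<lambda>x. b * f x + d * g x) h = b * Q f h + d * Q g h" if "f \<in> V" "g \<in> V" "h \<in> V" for f g h b d
    using that W.lin[of f g h b d] V.lin[of f g h b d] by (simp add: Q_def algebra_simps)
  show "0 \<le> Q f f" if "f \<in> V" for f
    using that W.nonneg[of f] V.nonneg[of f] \<alpha> by (simp add: Q_def)
next
  fix X :: "nat \<Rightarrow> 'a \<Rightarrow> real"
  assume X: "\<And>n. X n \<in> V"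
    and Cauchy: "\<And>e. 0 < e \<Longrightarrow> \<exists>N. \<forall>m\<ge>N. \<forall>n\<ge>N. Q (\<lambda>x. X m x - X n x) (\<lambda>x. X m x - X n x) < e"
  have "\<exists>N. \<forall>m\<ge>N. \<forall>n\<ge>N. a (\<lambda>x. X m x - X n x) (\<lambda>x. X m x - X n x) < e" if e: "0 < e" for e
  proof -
    obtain N where N: "\<And>m n. N \<le> m \<Longrightarrow> N \<le> n \<Longrightarrow> Q (\<lambda>x. X m x - X n x) (\<lambda>x. X m x - X n x) < \<alpha> * e"
      using Cauchy[OF mult_pos_pos[OF \<alpha> e]] by blast
    have "a (\<lambda>x. X m x - X n x) (\<lambda>x. X m x - X n x) < e" if "N \<le> m" "N \<le> n" for m n
      using le_less_trans[OF V_le_Q[OF V.diff_in[OF X X], of m n] N[OF that]] \<alpha> by simp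
    then show ?thesis by blast
  qed
  from V.complete[OF X this] obtain f where f: "f \<in> V"
    and lim: "(\<lambda>n. a (\<lambda>x. X n x - f x) (\<lambda>x. X n x - f x)) \<longlonglongrightarrow> 0" by blast
  have "(\<lambda>n. Q (\<lambda>x. X n x - f x) (\<lambda>x. X n x - f x)) \<longlonglongrightarrow> 0"
  proof (rule Lim_null_comparison)
    show "\<forall>\<^sub>F n in sequentially. norm (Q (\<lambda>x. X n x - f x) (\<lambda>x. X n x - f x))
        \<le> (1 + \<alpha>) * a (\<lambda>x. X n x - f x) (\<lambda>x. X n x - f x)"
    proof (intro always_eventually allI)
      fix n
      have "(\<lambda>x. X n x - f x) \<in> V" by (rule V.diff_in[OF X f])
      then show "norm (Q (\<lambda>x. X n x - f x) (\<lambda>x. X n x - f x)) \<le> (1 + \<alpha>) * a (\<lambda>x. X n x - f x) (\<lambda>x. X n x - f x)"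
        using W_le_V W.nonneg V_W V.nonneg \<alpha> by (simp add: Q_def algebra_simps)
    qed
    show "(\<lambda>n. (1 + \<alpha>) * a (\<lambda>x. X n x - f x) (\<lambda>x. X n x - f x)) \<longlonglongrightarrow> 0"
      using tendsto_mult_right_zero[OF lim] .
  qed
  then show "\<exists>f\<in>V. (\<lambda>n. Q (\<lambda>x. X n x - f x) (\<lambda>x. X n x - f x)) \<longlonglongrightarrow> 0" using f by blast
qed (fact V.zero_in V.lin_in)+

text \<open>Without differentiation: Riesz yields a solution v of the equation, and completing the
  square exhibits v as a minimizer. Since \<open>arg_min\<close> may choose another one, it remains
  that any minimizer differs from v by a null vector of \<open>Q\<close>, to which the equation is
  insensitive.\<close>

lemma tikhonov_Euler:
  assumes y: "y \<in> H\<^sub>\<omega>"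
  defines "u \<equiv> tikhonov \<Omega> s \<omega> \<alpha> y"
  shows "u \<in> V" "\<And>v. v \<in> V \<Longrightarrow> Q u v = ip\<^sub>\<omega> y v"
proof -
  let ?J = "\<lambda>u. 1 / 2 * (L2_norm (lebesgue_on \<omega>) (\<lambda>x. u x - y x))\<^sup>2 + \<alpha> / 2 * (H0s_norm \<Omega> s u)\<^sup>2"
  have "\<exists>v\<in>V. \<forall>g\<in>V. Q v g = ip\<^sub>\<omega> y g"
  proof (rule Q.Riesz[of _ "ip\<^sub>\<omega> y y"])
    show "ip\<^sub>\<omega> y (\<lambda>x. b * f x + d * g x) = b * ip\<^sub>\<omega> y f + d * ip\<^sub>\<omega> y g" if "f \<in> V" "g \<in> V" for f g b d
      using that y by (simp add: W.lin_right)
    show "(ip\<^sub>\<omega> y g)\<^sup>2 \<le> ip\<^sub>\<omega> y y * Q g g" if "g \<in> V" for g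
    proof -
      have "(ip\<^sub>\<omega> y g)\<^sup>2 \<le> ip\<^sub>\<omega> y y * ip\<^sub>\<omega> g g" using W.Cauchy_Schwarz that y by simp
      also have "\<dots> \<le> ip\<^sub>\<omega> y y * Q g g"
        using that \<alpha> V.nonneg[OF that] W.nonneg[OF y] by (intro mult_left_mono) (auto simp: Q_def)
      finally show ?thesis .
    qed
  qed
  then obtain v where v: "v \<in> V" "\<And>g. g \<in> V \<Longrightarrow> Q v g = ip\<^sub>\<omega> y g" by blast
  have J: "?J f = Q (\<lambda>x. f x - v x) (\<lambda>x. f x - v x) / 2 - Q v v / 2 + ip\<^sub>\<omega> y y / 2" if f: "f \<in> V" for f
  proof -
    have "(L2_norm (lebesgue_on \<omega>) (\<lambda>x. f x - y x))\<^sup>2 = ip\<^sub>\<omega> f f - 2 * ip\<^sub>\<omega> f y + ip\<^sub>\<omega> y y"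
    proof -
      have "(L2_norm (lebesgue_on \<omega>) (\<lambda>x. f x - y x))\<^sup>2 = ip\<^sub>\<omega> (\<lambda>x. f x - y x) (\<lambda>x. f x - y x)"
        unfolding L2_norm_def by (rule real_sqrt_pow2[OF W.nonneg[OF W.diff_in[OF V_W[OF f] y]]])
      then show ?thesis by (simp only: W.square_diff[OF V_W[OF f] y])
    qed
    moreover have "(H0s_norm \<Omega> s f)\<^sup>2 = a f f" using f by (simp add: H0s_norm_def V.nonneg)
    moreover have "ip\<^sub>\<omega> f y = Q f v" using f y v by (simp add: W.sym[of f y] Q.sym[of f v])
    ultimately show ?thesis
      unfolding Q.square_diff[OF f v(1)] by (simp add: Q_def[of f f] field_simps)
  qed
  have min: "?J v \<le> ?J f" if "f \<in> V" for f
    using J[OF that] J[OF v(1)] Q.nonneg[OF V.diff_in[OF that v(1)]] Q.square_diff[OF v(1) v(1)] by simp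
  have "is_arg_min ?J (\<lambda>u. u \<in> V) v"
    using min v(1) by (auto simp: is_arg_min_linorder)
  then have "is_arg_min ?J (\<lambda>u. u \<in> V) u"
    unfolding u_def tikhonov_def arg_min_def by (rule someI[of "is_arg_min ?J (\<lambda>u. u \<in> V)" v])
  then have u: "u \<in> V" "?J u \<le> ?J v"
    using v(1) by (auto simp: is_arg_min_linorder)
  then show "u \<in> V" by blast
  have d: "(\<lambda>x. u x - v x) \<in> V" by (rule V.diff_in[OF u(1) v(1)])
  have "Q (\<lambda>x. u x - v x) (\<lambda>x. u x - v x) = 0"
    using u J[OF u(1)] J[OF v(1)] Q.nonneg[OF d] Q.square_diff[OF v(1) v(1)] by simp
  then have "Q (\<lambda>x. u x - v x) g = 0" if "g \<in> V" for g by (rule Q.null_left[OF d that])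
  then show "Q u g = ip\<^sub>\<omega> y g" if "g \<in> V" for g
    using that u(1) v by (simp add: Q.diff_left)
qed

text \<open>Expand ||y - 2 u||^2 \<ge> 0 on \<omega> and replace <y, u> by Q u u. The coefficient 2
  cancels the term ||u||^2 and gives the 1/4 that becomes C2 = 1/2 after the doubling in
  \<open>tikhonov_error_bound\<close>.\<close>

lemma noise_bound:
  assumes u: "u \<in> V" and y: "y \<in> H\<^sub>\<omega>" and eq: "\<And>v. v \<in> V \<Longrightarrow> Q u v = ip\<^sub>\<omega> y v"
  shows "a u u \<le> ip\<^sub>\<omega> y y / (4 * \<alpha>)"
proof -
  have "0 \<le> ip\<^sub>\<omega> (\<lambda>x. 1 * y x + (- 2) * u x) (\<lambda>x. 1 * y x + (- 2) * u x)"
    using u y by (intro W.nonneg W.lin_in) auto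
  also have "\<dots> = ip\<^sub>\<omega> y y - 4 * (Q u u - ip\<^sub>\<omega> u u)"
    using u y eq[OF u] by (subst W.square_lin) auto
  also have "\<dots> = ip\<^sub>\<omega> y y - 4 * \<alpha> * a u u" by (simp add: Q_def)
  finally show ?thesis using \<alpha> by (simp add: field_simps)
qed

end

section \<open>Fractional powers and error bounds\<close>

text \<open>As \<open>A \<ge> 1\<close>, the powers \<open>A\<^sup>-\<^sup>1\<close> and \<open>A\<^sup>-\<^sup>1\<^sup>/\<^sup>2\<close> are bounded functions of \<open>A\<close> once \<open>1 / t\<close> and
  \<open>t powr (- 1 / 2)\<close> are cut off below \<open>1\<close>.\<close>

definition inv_above_1 :: "real \<Rightarrow> real" where
  "inv_above_1 t = (if 1 \<le> t then 1 / t else 0)"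

definition inv_sqrt_above_1 :: "real \<Rightarrow> real" where
  "inv_sqrt_above_1 t = (if 1 \<le> t then t powr (- 1 / 2) else 0)"

lemma inv_above_1_range: "0 \<le> inv_above_1 t" "inv_above_1 t \<le> 1"
  by (auto simp: inv_above_1_def)

lemma inv_sqrt_above_1_eq: "inv_sqrt_above_1 t = sqrt (inv_above_1 t)"
  by (simp add: inv_sqrt_above_1_def inv_above_1_def powr_minus_divide powr_half_sqrt real_sqrt_divide)

lemma inv_sqrt_above_1_square: "inv_sqrt_above_1 t * inv_sqrt_above_1 t = inv_above_1 t"
  using inv_above_1_range[of t] by (simp add: inv_sqrt_above_1_eq)

lemma inv_sqrt_above_1_range: "0 \<le> inv_sqrt_above_1 t" "inv_sqrt_above_1 t \<le> 1"
  using inv_above_1_range[of t] by (simp_all add: inv_sqrt_above_1_eq)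

lemma inv_above_1_bdd [simp]: "inv_above_1 \<in> bdd_borel"
proof (rule bdd_borelI)
  show "inv_above_1 \<in> borel_measurable borel" unfolding inv_above_1_def[abs_def] by measurable
  show "\<bar>inv_above_1 t\<bar> \<le> 1" for t using inv_above_1_range[of t] by simp
qed

lemma inv_sqrt_above_1_bdd [simp]: "inv_sqrt_above_1 \<in> bdd_borel"
proof (rule bdd_borelI)
  show "inv_sqrt_above_1 \<in> borel_measurable borel" unfolding inv_sqrt_above_1_def[abs_def] by measurable
  show "\<bar>inv_sqrt_above_1 t\<bar> \<le> 1" for t using inv_sqrt_above_1_range[of t] by simp
qed

lemma (in pvm) spectral_integral_weak_right:
  assumes "\<phi> \<in> borel_measurable borel" "(u, v) \<in> spectral_integral M E \<phi>" "v' \<in> H"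
    and "\<And>g. g \<in> H \<Longrightarrow> ip v g = ip v' g"
  shows "(u, v') \<in> spectral_integral M E \<phi>"
  using assms spectral_domainD(1)[OF assms(1)] by (simp add: spectral_integral_iff)

lemma (in pvm) bil_sum:
  fixes \<phi> :: "nat \<Rightarrow> real \<Rightarrow> real"
  assumes "\<And>i. \<phi> i \<in> bdd_borel" "u \<in> H" "g \<in> H"
  shows "(\<lambda>t. \<Sum>i\<le>n. c i * \<phi> i t) \<in> bdd_borel \<and>
    bil (\<lambda>t. \<Sum>i\<le>n. c i * \<phi> i t) u g = (\<Sum>i\<le>n. c i * bil (\<phi> i) u g)"
proof (induction n)
  case 0
  then show ?case
    using assms bdd_borel_lin[of "\<phi> 0" "\<phi> 0" "c 0" 0] bil_lin_fun[of "\<phi> 0" "\<phi> 0" u g "c 0" 0] by simp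
next
  case (Suc n)
  then show ?case
    using assms bdd_borel_lin[of "\<lambda>t. \<Sum>i\<le>n. c i * \<phi> i t" "\<phi> (Suc n)" 1 "c (Suc n)"]
      bil_lin_fun[of "\<lambda>t. \<Sum>i\<le>n. c i * \<phi> i t" "\<phi> (Suc n)" u g 1 "c (Suc n)"] by simp
qed

lemma L2_inner_zero_ext:
  assumes "S \<in> sets lebesgue" "T \<subseteq> S" "T \<in> sets lebesgue"
  shows "L2_inner (lebesgue_on S) f (zero_ext T g) = L2_inner (lebesgue_on T) f g"
    and "L2_inner (lebesgue_on S) (zero_ext T f) g = L2_inner (lebesgue_on T) f g"
proof -
  have eq: "(\<lambda>x. zero_ext S f x * zero_ext T g x) = (\<lambda>x. zero_ext T f x * zero_ext T g x)"
    "(\<lambda>x. zero_ext T f x * zero_ext S g x) = (\<lambda>x. zero_ext T f x * zero_ext T g x)"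
    using assms(2) by (auto simp: zero_ext_def fun_eq_iff)
  show "L2_inner (lebesgue_on S) f (zero_ext T g) = L2_inner (lebesgue_on T) f g"
    "L2_inner (lebesgue_on S) (zero_ext T f) g = L2_inner (lebesgue_on T) f g"
    by (simp_all only: L2_inner_on[OF assms(1)] L2_inner_on[OF assms(3)] zero_ext_superset[OF assms(2)])
      (simp_all only: L2_inner_def eq)
qed

section \<open>Inverse powers of A for a given spectral resolution\<close>

locale A_resolution = frac_domain \<Omega> s for \<Omega> :: "'a::euclidean_space set" and s +
  fixes E :: "real set \<Rightarrow> ('a \<Rightarrow> real) \<Rightarrow> 'a \<Rightarrow> real"
  assumes resolution: "spectral_resolution (lebesgue_on \<Omega>) E (A_op \<Omega> s)"
begin

sublocale pvm "lebesgue_on \<Omega>" E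
  using resolution by unfold_locales (simp add: spectral_resolution_def)

text \<open>\<open>S\<close> and \<open>R\<close> are A^(-1/2) and A^(-1).\<close>

abbreviation "S \<equiv> fc inv_sqrt_above_1"
abbreviation "R \<equiv> fc inv_above_1"

lemma A_eq: "A_op \<Omega> s = spectral_integral (lebesgue_on \<Omega>) E (\<lambda>t. t)"
  using resolution by (simp add: spectral_resolution_def)

text \<open>The L2 term of the form gives <A u, u> \<ge> ||u||^2.\<close>

lemma ge_1: "AE t in mu h. 1 \<le> t" if "h \<in> H"
proof (rule concentrated_above[OF _ that])
  fix u v assume "(u, v) \<in> spectral_integral (lebesgue_on \<Omega>) E (\<lambda>t. t)"
  then have *: "zero_ext \<Omega> u \<in> V" "H0s_form \<Omega> s (zero_ext \<Omega> u) (zero_ext \<Omega> u) = ip v (zero_ext \<Omega> u)"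
    by (auto simp: A_op_def simp flip: A_eq)
  show "1 * ip u u \<le> ip v u"
    using H_le_V[OF *(1)] *(2) by (simp add: L2_inner_zero_ext[OF \<Omega> order_refl \<Omega>])
qed

lemma R_A:
  assumes g: "g \<in> H"
  shows "(R g, g) \<in> A_op \<Omega> s"
proof -
  have "(R g, fc (\<lambda>t. 1) g) \<in> spectral_integral (lebesgue_on \<Omega>) E (\<lambda>t. t)"
  proof (intro spectral_integral_fc g)
    show "AE t in mu h. t * inv_above_1 t = 1" if "h \<in> H" for h
      using ge_1[OF that] by eventually_elim (simp add: inv_above_1_def)
  qed auto
  then have "(R g, g) \<in> spectral_integral (lebesgue_on \<Omega>) E (\<lambda>t. t)"
    by (rule spectral_integral_weak_right[rotated]) (use g in \<open>auto simp: fc_inner bil_const_one\<close>)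
  then show ?thesis by (simp add: A_eq)
qed

lemma R_V: "g \<in> H \<Longrightarrow> zero_ext \<Omega> (R g) \<in> V"
  using R_A[of g] by (auto simp: A_op_def)

lemma R_form: "g \<in> H \<Longrightarrow> v \<in> V \<Longrightarrow> H0s_form \<Omega> s (zero_ext \<Omega> (R g)) v = ip g v"
  using R_A[of g] by (auto simp: A_op_def)

lemma inv_sqrt_eq:
  "spectral_integral (lebesgue_on \<Omega>) E (\<lambda>t. t powr (- 1 / 2)) = spectral_integral (lebesgue_on \<Omega>) E inv_sqrt_above_1"
proof (rule spectral_integral_cong)
  show "AE t in mu h. t powr (- 1 / 2) = inv_sqrt_above_1 t" if "h \<in> H" for h
    using ge_1[OF that] by eventually_elim (simp add: inv_sqrt_above_1_def)
  show "inv_sqrt_above_1 \<in> borel_measurable borel" by (rule bdd_borelD) simp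
qed measurable

lemma inv_sqrtD:
  assumes "(f, e) \<in> spectral_integral (lebesgue_on \<Omega>) E (\<lambda>t. t powr (- 1 / 2))"
  shows "f \<in> H" "e \<in> H" "\<And>k. k \<in> H \<Longrightarrow> ip e k = bil inv_sqrt_above_1 f k"
proof -
  have *: "(f, e) \<in> spectral_integral (lebesgue_on \<Omega>) E inv_sqrt_above_1" using assms unfolding inv_sqrt_eq .
  then show "f \<in> H" "e \<in> H" by (simp_all add: spectral_integral_iff spectral_domain_def)
  show "ip e k = bil inv_sqrt_above_1 f k" if "k \<in> H" for k
    by (rule spectral_integral_bdd[OF inv_sqrt_above_1_bdd * that])
qed

text \<open>A^(-1/2) A^(-1/2) = A^(-1). These pairs are the ones on which the adjoint of B is tested
  in \<open>bias\<close>.\<close>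

lemma inv_sqrt_S:
  assumes "g \<in> H"
  shows "(S g, R g) \<in> spectral_integral (lebesgue_on \<Omega>) E (\<lambda>t. t powr (- 1 / 2))"
  unfolding inv_sqrt_eq
  by (rule spectral_integral_fc) (use assms in \<open>auto simp: inv_sqrt_above_1_square bdd_borelD\<close>)

text \<open>Turns z = A^(1/2) u into u = A^(-1/2) z. On [1, n] the factors t^(1/2) and t^(-1/2) are
  bounded and cancel; then n tends to infinity, and [1, \<infinity>) carries the whole spectral
  measure.\<close>

lemma sqrtD:
  assumes uz: "(u, z) \<in> spectral_integral (lebesgue_on \<Omega>) E (\<lambda>t. t powr (1 / 2))" and k: "k \<in> H"
  shows "ip u k = bil inv_sqrt_above_1 z k"
proof -
  let ?I = "\<lambda>n. indicator {1..real n} :: real \<Rightarrow> real"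
  have m: "(\<lambda>t::real. t powr (1 / 2)) \<in> borel_measurable borel" by measurable
  have u: "u \<in> H" and z: "z \<in> H" using uz by (auto simp: spectral_integral_iff spectral_domain_def)
  have eq: "bil (\<lambda>t. inv_sqrt_above_1 t * ?I n t) k z = bil (?I n) k u" for n
  proof -
    have b: "(\<lambda>t. t powr (1 / 2) * ?I n t) \<in> bdd_borel"
    proof (rule bdd_borelI)
      show "\<bar>t powr (1 / 2) * ?I n t\<bar> \<le> real n powr (1 / 2)" for t
        by (cases "t \<in> {1..real n}") (auto intro: powr_mono2)
    qed measurable
    have "bil (\<lambda>t. inv_sqrt_above_1 t * ?I n t) k z = bil inv_sqrt_above_1 k (E {1..real n} z)"
      using k z by (simp add: bil_E_right)
    also have "\<dots> = ip (S k) (E {1..real n} z)" using k z by (simp add: fc_inner)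
    also have "\<dots> = ip z (E {1..real n} (S k))" using k z by (simp add: O.sym[of "S k"] E_sym)
    also have "\<dots> = bil (\<lambda>t. t powr (1 / 2) * ?I n t) u (S k)"
      using k by (intro spectral_integral_trunc[OF m uz, of _ "real n powr (1 / 2)"]) (auto intro: powr_mono2)
    also have "\<dots> = bil (\<lambda>t. t powr (1 / 2) * ?I n t * inv_sqrt_above_1 t) k u"
      using k u b by (simp add: bil_sym[of _ u] bil_fc)
    also have "(\<lambda>t. t powr (1 / 2) * ?I n t * inv_sqrt_above_1 t) = ?I n"
      by (auto simp: indicator_def inv_sqrt_above_1_def powr_minus_divide)
    finally show ?thesis .
  qed
  have I: "(\<lambda>n. ?I n t) \<longlonglongrightarrow> indicator {1..} t" for t
  proof (rule tendsto_eventually)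
    obtain N where "t \<le> real N" using real_arch_simple by blast
    then show "\<forall>\<^sub>F n in sequentially. ?I n t = indicator {1..} t"
      by (intro eventually_sequentiallyI[of N]) (auto simp: indicator_def)
  qed
  have ptw: "inv_sqrt_above_1 t * indicator {1..} t = inv_sqrt_above_1 t" for t
    by (simp add: inv_sqrt_above_1_def)
  have "(\<lambda>n. bil (\<lambda>t. inv_sqrt_above_1 t * ?I n t) k z) \<longlonglongrightarrow> bil inv_sqrt_above_1 k z"
  proof (rule bil_lim[of _ 1])
    show "(\<lambda>n. inv_sqrt_above_1 t * ?I n t) \<longlonglongrightarrow> inv_sqrt_above_1 t" for t
      using tendsto_mult_left[OF I, of "inv_sqrt_above_1 t" t] by (simp only: ptw)
    show "\<bar>inv_sqrt_above_1 t * ?I n t\<bar> \<le> 1" for n t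
      using inv_sqrt_above_1_range[of t] by (simp add: indicator_def)
    show "(\<lambda>t. inv_sqrt_above_1 t * ?I n t) \<in> borel_measurable borel" for n
      by (intro borel_measurable_times bdd_borelD) auto
  qed (use k z in auto)
  moreover have "(\<lambda>n. bil (?I n) k u) \<longlonglongrightarrow> bil (indicator {1..}) k u"
    using k u by (intro bil_lim[of _ 1] I) (auto simp: indicator_def)
  moreover have "bil (indicator {1..}) k u = bil (\<lambda>t. 1) k u"
  proof (rule bil_cong)
    show "AE t in mu h. indicator {1..} t = (1 :: real)" if "h \<in> H" for h
      using ge_1[OF that] by eventually_elim simp
  qed (use k u in auto)
  ultimately have "bil inv_sqrt_above_1 k z = ip k u"
    using k u LIMSEQ_unique unfolding eq by (metis bil_const_one)
  then show ?thesis using k u z by (simp add: bil_sym[of _ z] O.sym[of u])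
qed

text \<open>Let g_n be A^(1/2) f cut off to the spectral interval [1, n + 1]. Then v_n = A^(-1) g_n
  lies in \<open>V\<close> as a value of the resolvent, its energy <g_n, A^(-1) g_n> is the mass
  that f has on that interval, hence at most ||f||^2, and v_n tends to e in L2(\<Omega>). Lower
  semicontinuity concludes.\<close>

lemma inv_sqrt_form_le:
  assumes fe: "(f, e) \<in> spectral_integral (lebesgue_on \<Omega>) E (\<lambda>t. t powr (- 1 / 2))"
  shows "zero_ext \<Omega> e \<in> V" "H0s_form \<Omega> s (zero_ext \<Omega> e) (zero_ext \<Omega> e) \<le> ip f f"
proof -
  note f = inv_sqrtD(1)[OF fe] and e = inv_sqrtD(2)[OF fe]
  define q where "q n t = t powr (1 / 2) * indicator {1..real (Suc n)} t" for n and t :: real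
  have q: "q n \<in> bdd_borel" for n
    unfolding q_def[abs_def]
  proof (rule bdd_borelI)
    show "\<bar>t powr (1 / 2) * indicator {1..real (Suc n)} t\<bar> \<le> real (Suc n) powr (1 / 2)" for t
      by (cases "t \<in> {1..real (Suc n)}") (auto intro: powr_mono2)
  qed measurable
  define d where "d n t = 1 * (inv_above_1 t * q n t) + (- 1) * inv_sqrt_above_1 t" for n t
  have d: "d n \<in> bdd_borel" for n
    unfolding d_def[abs_def] by (intro bdd_borel_lin bdd_borel_mult q) auto
  have powr_simps: "t powr (1/2) * t powr (1/2) = t" "t powr (- 1/2) = t powr (1/2) / t" if "1 \<le> t" for t :: real
  proof -
    show "t powr (1/2) * t powr (1/2) = t" using that by (simp flip: powr_add)
    then show "t powr (- 1/2) = t powr (1/2) / t" using that by (simp add: powr_minus_divide field_simps)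
  qed
  define g where "g n = fc (q n) f" for n
  have g: "g n \<in> H" for n using q f by (simp add: g_def)
  let ?v = "\<lambda>n. zero_ext \<Omega> (R (g n))"
  have bound: "H0s_form \<Omega> s (?v n) (?v n) \<le> ip f f" for n
  proof -
    have "H0s_form \<Omega> s (?v n) (?v n) = ip (g n) (R (g n))"
      using R_form[OF g R_V[OF g]] by (simp add: L2_inner_zero_ext[OF \<Omega> order_refl \<Omega>])
    also have "\<dots> = bil inv_above_1 (g n) (g n)"
      using g by (simp add: O.sym[of "g n"] fc_inner)
    also have "\<dots> = bil (\<lambda>t. inv_above_1 t * q n t) (g n) f"
      using bil_fc[OF inv_above_1_bdd q f g, of n n] bil_sym[OF bdd_borel_mult[OF inv_above_1_bdd q] f g, of n n]
      by (simp add: g_def)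
    also have "\<dots> = bil (\<lambda>t. inv_above_1 t * q n t * q n t) f f"
      unfolding g_def by (rule bil_fc[OF bdd_borel_mult[OF inv_above_1_bdd q] q f f])
    also have "\<dots> \<le> 1 * ip f f"
    proof (intro bil_self_le f bdd_borel_mult q)
      show "inv_above_1 t * q n t * q n t \<le> 1" for t
        by (auto simp: q_def inv_above_1_def indicator_def powr_simps)
    qed simp
    finally show ?thesis by simp
  qed
  have weak: "ip (\<lambda>x. ?v n x - e x) k = ip (fc (d n) f) k" if k: "k \<in> H" for n k
  proof -
    have "ip (\<lambda>x. ?v n x - e x) k = ip (R (g n)) k - ip e k"
      using k g e R_V[OF g] by (simp add: O.diff_left L2_inner_zero_ext[OF \<Omega> order_refl \<Omega>])
    also have "\<dots> = bil (\<lambda>t. inv_above_1 t * q n t) f k - bil inv_sqrt_above_1 f k"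
      using fc_inner[OF inv_above_1_bdd g k, of n] bil_fc[OF inv_above_1_bdd q f k, of n] inv_sqrtD(3)[OF fe k]
      by (simp add: g_def)
    also have "\<dots> = bil (d n) f k"
      using k f q unfolding d_def[abs_def] by (subst bil_lin_fun) auto
    finally show ?thesis using k f d by (simp add: fc_inner)
  qed
  have D: "(\<lambda>x. ?v n x - e x) \<in> H" for n by (rule O.diff_in[OF V_H[OF R_V[OF g]] e])
  have small: "ip (\<lambda>x. ?v n x - e x) (\<lambda>x. ?v n x - e x) \<le> 1 / real (Suc n) * ip f f" for n
  proof -
    have "ip (\<lambda>x. ?v n x - e x) (\<lambda>x. ?v n x - e x) = ip (fc (d n) f) (fc (d n) f)"
      by (simp only: weak[OF D] weak[OF fc_in[OF d f]] O.sym[OF fc_in[OF d f] D])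
    also have "\<dots> = bil (\<lambda>t. d n t * d n t) f f" using d f by (simp add: fc_fc_inner)
    also have "\<dots> \<le> 1 / real (Suc n) * ip f f"
    proof (intro bil_self_le f bdd_borel_mult d)
      fix t
      consider "t < 1" | "1 \<le> t" "t \<le> real (Suc n)" | "1 \<le> t" "real (Suc n) < t" by linarith
      then show "d n t * d n t \<le> 1 / real (Suc n)"
      proof cases
        case 3
        then have "d n t * d n t = inv_above_1 t"
          unfolding inv_sqrt_above_1_square[symmetric] by (simp add: d_def q_def)
        also have "\<dots> \<le> 1 / real (Suc n)" using 3 unfolding inv_above_1_def by (simp add: frac_le)
        finally show ?thesis .
      next
        case 2
        then have "d n t = 0"
          using powr_simps(2)[OF 2(1)] by (simp add: d_def q_def inv_above_1_def inv_sqrt_above_1_def)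
        then show ?thesis by simp
      qed (auto simp: d_def q_def inv_above_1_def inv_sqrt_above_1_def)
    qed
    finally show ?thesis .
  qed
  have lim: "(\<lambda>n. ip (\<lambda>x. ?v n x - e x) (\<lambda>x. ?v n x - e x)) \<longlonglongrightarrow> 0"
  proof (rule tendsto_sandwich[OF _ _ tendsto_const])
    show "(\<lambda>n. 1 / real (Suc n) * ip f f) \<longlonglongrightarrow> 0"
      using tendsto_mult_left_zero[OF LIMSEQ_inverse_real_of_nat, of "ip f f"]
      by (simp only: inverse_eq_divide)
  qed (intro always_eventually allI small O.nonneg[OF D])+
  show "zero_ext \<Omega> e \<in> V" "H0s_form \<Omega> s (zero_ext \<Omega> e) (zero_ext \<Omega> e) \<le> ip f f"
    using V_lower_semicontinuous[OF R_V[OF g] e lim, of 0 "ip f f"] bound by auto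
qed

end

text \<open>Since \<open>A\<close> determines its resolvent \<open>A\<^sup>-\<^sup>1\<close>, and the square root is a uniform limit of
  polynomials on \<open>[0,1]\<close>, \<open>A\<^sup>-\<^sup>1\<^sup>/\<^sup>2\<close> does not depend on the choice of the spectral resolution.\<close>

lemma inv_sqrt_unique:
  assumes "A_resolution \<Omega> s E" "A_resolution \<Omega> s E'"
    and f: "f \<in> L2_space (lebesgue_on \<Omega>)" and k: "k \<in> L2_space (lebesgue_on \<Omega>)"
  shows "pvm.bil (lebesgue_on \<Omega>) E inv_sqrt_above_1 f k = pvm.bil (lebesgue_on \<Omega>) E' inv_sqrt_above_1 f k"
proof -
  interpret E: A_resolution \<Omega> s E by fact
  interpret E': A_resolution \<Omega> s E' by fact
  \<comment> \<open>Both resolvents solve the same variational problem, so their difference has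
    energy 0.\<close>
  have R: "E.ip (E.R g) k = E.ip (E'.R g) k" if g: "g \<in> E.H" and k: "k \<in> E.H" for g k
  proof -
    let ?d = "\<lambda>x. zero_ext \<Omega> (E.R g) x - zero_ext \<Omega> (E'.R g) x"
    have d: "?d \<in> E.V" by (intro E.V.diff_in E.R_V E'.R_V g)
    have "H0s_form \<Omega> s ?d ?d = 0"
      by (simp only: E.V.diff_left[OF E.R_V[OF g] E'.R_V[OF g] d] E.R_form[OF g d] E'.R_form[OF g d] diff_self)
    then have "E.ip ?d ?d = 0" using E.H_le_V[OF d] E.O.nonneg[OF E.V_H[OF d]] by simp
    then have "E.ip ?d k = 0" by (rule E.O.null_left[OF E.V_H[OF d] k])
    then show ?thesis
      by (simp add: E.O.diff_left[OF E.V_H[OF E.R_V[OF g]] E.V_H[OF E'.R_V[OF g]] k]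
          L2_inner_zero_ext[OF E.\<Omega> order_refl E.\<Omega>])
  qed
  \<comment> \<open>One factor is split off as \<open>E.R\<close>, and the induction hypothesis
    passes to the other resolution for the remaining power; moving that power onto k lets
    \<open>R\<close> exchange the resolvents.\<close>
  have pow: "E.bil (\<lambda>t. inv_above_1 t ^ n) g k = E'.bil (\<lambda>t. inv_above_1 t ^ n) g k"
    if "g \<in> E.H" "k \<in> E.H" for n g k
    using that
  proof (induction n arbitrary: g)
    case 0
    then show ?case by (simp add: E.bil_const_one E'.bil_const_one)
  next
    case (Suc n)
    let ?p = "\<lambda>t. inv_above_1 t ^ n"
    have p: "?p \<in> bdd_borel" by simp
    have "E.bil (\<lambda>t. inv_above_1 t ^ Suc n) g k = E.bil ?p (E.R g) k"
      using Suc.prems by (subst E.bil_fc) (auto simp: mult.commute)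
    also have "\<dots> = E'.bil ?p (E.R g) k" using Suc by simp
    also have "\<dots> = E.ip (E'.fc ?p k) (E.R g)"
      using Suc.prems p by (simp add: E'.bil_sym[OF p] E'.fc_inner)
    also have "\<dots> = E.ip (E'.fc ?p k) (E'.R g)"
      using Suc.prems p R[of g "E'.fc ?p k"] by (simp add: E.O.sym[of "E'.fc ?p k"])
    also have "\<dots> = E'.bil ?p (E'.R g) k"
      using Suc.prems p by (simp add: E'.bil_sym[OF p, of "E'.R g"] E'.fc_inner)
    also have "\<dots> = E'.bil (\<lambda>t. inv_above_1 t ^ Suc n) g k"
      using Suc.prems by (subst E'.bil_fc) (auto simp: mult.commute)
    finally show ?case .
  qed
  have "\<exists>p. real_polynomial_function p \<and> (\<forall>x\<in>{0..1}. \<bar>sqrt x - p x\<bar> < 1 / real (Suc n))" for n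
  proof -
    have "continuous_on {0..1::real} sqrt" by (intro continuous_intros)
    then obtain p :: "real \<Rightarrow> real" where "real_polynomial_function p"
      "\<And>x. x \<in> {0..1} \<Longrightarrow> \<bar>sqrt x - p x\<bar> < 1 / real (Suc n)"
      using Stone_Weierstrass_real_polynomial_function[of "{0..1::real}" sqrt "1 / real (Suc n)"] by auto
    then show ?thesis by blast
  qed
  then obtain p where p: "\<And>n. real_polynomial_function (p n)"
    "\<And>n x. x \<in> {0..1} \<Longrightarrow> \<bar>sqrt x - p n x\<bar> < 1 / real (Suc n)" by metis
  let ?q = "\<lambda>n t. p n (inv_above_1 t)"
  have q: "?q n \<in> bdd_borel \<and> E.bil (?q n) f k = E'.bil (?q n) f k" for n
  proof -
    obtain c m where "p n = (\<lambda>x. \<Sum>i\<le>m. c i * x ^ i)" using p(1)[of n] real_polynomial_function_iff_sum by blast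
    then show ?thesis
      using E.bil_sum[of "\<lambda>i t. inv_above_1 t ^ i" f k, where n=m and c=c] E'.bil_sum[of "\<lambda>i t. inv_above_1 t ^ i" f k, where n=m and c=c] f k
      by (simp add: pow)
  qed
  have close: "\<bar>inv_sqrt_above_1 t - ?q n t\<bar> < 1 / real (Suc n)" for n t
    using p(2)[of "inv_above_1 t" n] inv_above_1_range[of t] by (simp add: inv_sqrt_above_1_eq)
  have lim: "(\<lambda>n. ?q n t) \<longlonglongrightarrow> inv_sqrt_above_1 t" for t
  proof -
    have "(\<lambda>n. inv_sqrt_above_1 t - ?q n t) \<longlonglongrightarrow> 0"
      using close[of t] by (intro Lim_null_comparison[OF _ LIMSEQ_inverse_real_of_nat])
        (auto simp: inverse_eq_divide less_imp_le)
    from tendsto_diff[OF tendsto_const[of "inv_sqrt_above_1 t"] this] show ?thesis by simp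
  qed
  have bound: "\<bar>?q n t\<bar> \<le> 2" for n t
  proof -
    have "1 / real (Suc n) \<le> 1" by simp
    then show ?thesis using close[of t n] inv_sqrt_above_1_range[of t] by linarith
  qed
  have "(\<lambda>n. E.bil (?q n) f k) \<longlonglongrightarrow> E.bil inv_sqrt_above_1 f k"
    using q by (intro E.bil_lim[OF _ bound lim f k] bdd_borelD) blast
  moreover have "(\<lambda>n. E'.bil (?q n) f k) \<longlonglongrightarrow> E'.bil inv_sqrt_above_1 f k"
    using q by (intro E'.bil_lim[OF _ bound lim f k] bdd_borelD) blast
  ultimately show ?thesis using q LIMSEQ_unique by simp
qed

section \<open>The supremum of the filter function\<close>

lemma c_beta_nonneg: "0 \<le> c_beta \<beta>"
  by (simp add: c_beta_def)

text \<open>Weighted arithmetic-geometric mean with weights \<beta> and 1 - \<beta> for t / \<beta>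
  and \<alpha> / (1 - \<beta>), whose weighted mean is t + \<alpha>. Equality at t = \<alpha>
  \<beta> / (1 - \<beta>) explains the form of \<open>c_beta\<close>.\<close>

lemma c_beta_bound:
  assumes "0 < \<beta>" "\<beta> \<le> 1" "0 < \<alpha>" "0 \<le> t"
  shows "\<alpha> * t powr \<beta> / (t + \<alpha>) \<le> c_beta \<beta> * \<alpha> powr \<beta>"
proof (cases "\<beta> = 1 \<or> t = 0")
  case True
  then show ?thesis
  proof
    assume "\<beta> = 1"
    then show ?thesis using assms by (simp add: c_beta_def field_simps)
  qed (use assms c_beta_nonneg in simp)
next
  case False
  then have b: "\<beta> < 1" and t: "0 < t" using assms by auto
  have "(t / \<beta>) powr \<beta> * (\<alpha> / (1 - \<beta>)) powr (1 - \<beta>) \<le> \<beta> * (t / \<beta>) + (1 - \<beta>) * (\<alpha> / (1 - \<beta>))"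
    using assms b t by (intro Youngs_inequality_0) auto
  also have "\<dots> = t + \<alpha>" using assms b by simp
  finally have "t powr \<beta> * \<alpha> powr (1 - \<beta>) \<le> c_beta \<beta> * (t + \<alpha>)"
    using assms b t by (simp add: c_beta_def powr_divide field_simps)
  then have "\<alpha> powr \<beta> * (t powr \<beta> * \<alpha> powr (1 - \<beta>)) \<le> \<alpha> powr \<beta> * (c_beta \<beta> * (t + \<alpha>))"
    by (intro mult_left_mono) auto
  also have "\<alpha> powr \<beta> * (t powr \<beta> * \<alpha> powr (1 - \<beta>)) = \<alpha> * t powr \<beta>"
    using assms by (simp add: powr_diff)
  finally show ?thesis using assms t by (simp add: field_simps)
qed

section \<open>Bias, measurability of the error, and the error bound for fixed noise\<close>

context tikhonov_setup
begin

text \<open>The filter p solves t p(t) = - \<alpha> t^\<beta> - \<alpha> p(t), which is the equation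
  B* B f = - \<alpha> z - \<alpha> f. That f lies in the graph of B* B is what makes B f, and with
  it A^(-1/2) f, available in \<open>bias\<close>.\<close>

lemma filtered_source:
  assumes wz: "(w, z) \<in> L2_op_power (lebesgue_on \<Omega>) (BB_op \<Omega> s \<omega>) \<beta>" and \<beta>: "0 < \<beta>" "\<beta> \<le> 1"
  obtains f where "f \<in> H\<^sub>\<Omega>" "ip\<^sub>\<Omega> f f \<le> (c_beta \<beta> * \<alpha> powr \<beta>)\<^sup>2 * ip\<^sub>\<Omega> w w"
    "(f, \<lambda>x. (- \<alpha>) * z x + (- \<alpha>) * f x) \<in> BB_op \<Omega> s \<omega>"
proof -
  obtain E where E: "projection_valued_measure (lebesgue_on \<Omega>) E"
    and BB: "BB_op \<Omega> s \<omega> = spectral_integral (lebesgue_on \<Omega>) E (\<lambda>t. t)"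
    and wz': "(w, z) \<in> spectral_integral (lebesgue_on \<Omega>) E (\<lambda>t. t powr \<beta>)"
    using wz by (auto simp: L2_op_power_def spectral_resolution_def)
  interpret E: pvm "lebesgue_on \<Omega>" E by unfold_locales fact
  have nonneg: "AE t in E.mu h. 0 \<le> t" if "h \<in> H\<^sub>\<Omega>" for h
  proof (rule E.concentrated_above[OF _ that])
    fix u v assume "(u, v) \<in> spectral_integral (lebesgue_on \<Omega>) E (\<lambda>t. t)"
    then obtain k where "(u, k) \<in> B_op \<Omega> s \<omega>"
      "(k, v) \<in> L2_adjoint (lebesgue_on \<Omega>) (lebesgue_on \<omega>) (B_op \<Omega> s \<omega>)"
      by (auto simp: BB_op_def simp flip: BB)
    \<comment> \<open>The adjoint relation tested with the pair (u, k) itself: ||B u||^2 = <u, B* B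
      u>.\<close>
    then have "ip\<^sub>\<omega> k k = ip\<^sub>\<Omega> u v" by (auto simp: L2_adjoint_def)
    then show "0 * ip\<^sub>\<Omega> u u \<le> ip\<^sub>\<Omega> v u"
      by (simp add: L2_inner_def mult.commute) (metis integral_nonneg_AE AE_I2 zero_le_square)
  qed
  \<comment> \<open>On negative t the real power is meaningless and t + \<alpha> may vanish. The
    spectral measures do not charge this part, so \<open>r\<close> and \<open>p\<close> are set to 0
    there, which keeps \<open>p\<close> bounded.\<close>
  define r where "r t = (if 0 \<le> t then t powr \<beta> else 0)" for t :: real
  define p where "p t = - (if 0 \<le> t then \<alpha> * t powr \<beta> / (t + \<alpha>) else 0)" for t :: real
  let ?K = "c_beta \<beta> * \<alpha> powr \<beta>"
  have pK: "\<bar>p t\<bar> \<le> ?K" for t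
    using c_beta_bound[OF \<beta> \<alpha>, of t] c_beta_nonneg[of \<beta>] \<alpha> by (auto simp: p_def abs_mult)
  have r[measurable]: "r \<in> borel_measurable borel" unfolding r_def[abs_def] by measurable
  have [measurable]: "p \<in> borel_measurable borel" unfolding p_def[abs_def] by measurable
  have p: "p \<in> bdd_borel" using pK by (intro bdd_borelI) auto
  have w: "w \<in> H\<^sub>\<Omega>" and z: "z \<in> H\<^sub>\<Omega>" using wz' by (auto simp: E.spectral_integral_iff spectral_domain_def)
  have wr: "(w, z) \<in> spectral_integral (lebesgue_on \<Omega>) E r"
  proof -
    have "AE t in E.mu h. t powr \<beta> = r t" if "h \<in> H\<^sub>\<Omega>" for h
      using nonneg[OF that] by eventually_elim (simp add: r_def)
    then have "spectral_integral (lebesgue_on \<Omega>) E (\<lambda>t. t powr \<beta>) = spectral_integral (lebesgue_on \<Omega>) E r"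
      by (intro E.spectral_integral_cong) auto
    then show ?thesis using wz' by simp
  qed
  define f where "f = E.fc p w"
  have f: "f \<in> H\<^sub>\<Omega>" using p w by (simp add: f_def)
  have "(f, \<lambda>x. (- \<alpha>) * z x + (- \<alpha>) * f x) \<in> spectral_integral (lebesgue_on \<Omega>) E (\<lambda>t. t)"
  proof (rule E.spectral_integralI)
    fix n g assume g: "g \<in> H\<^sub>\<Omega>"
    let ?T = "E.trunc (\<lambda>t. t) n"
    let ?i = "indicator ?T :: real \<Rightarrow> real"
    have T: "?T \<in> sets borel" by simp
    have rK: "\<bar>r t\<bar> \<le> real n powr \<beta>" if "t \<in> ?T" for t
      using that \<beta> by (auto simp: r_def E.trunc_def intro!: powr_mono2)
    have b: "(\<lambda>t. r t * ?i t) \<in> bdd_borel"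
    proof (rule bdd_borelI)
      show "\<bar>r t * ?i t\<bar> \<le> real n powr \<beta>" for t using rK[of t] by (cases "t \<in> ?T") auto
    qed measurable
    have b': "(\<lambda>t. p t * ?i t) \<in> bdd_borel" using p by simp
    have b'': "(\<lambda>t. t * ?i t) \<in> bdd_borel" by (intro E.bdd_trunc) simp
    have "ip\<^sub>\<Omega> (\<lambda>x. (- \<alpha>) * z x + (- \<alpha>) * f x) (E ?T g) = (- \<alpha>) * ip\<^sub>\<Omega> z (E ?T g) + (- \<alpha>) * ip\<^sub>\<Omega> f (E ?T g)"
      using z f g by (intro O.lin E.E_in) auto
    also have "ip\<^sub>\<Omega> z (E ?T g) = E.bil (\<lambda>t. r t * ?i t) w g"
      by (rule E.spectral_integral_trunc[OF r wr T rK g])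
    also have "ip\<^sub>\<Omega> f (E ?T g) = E.bil (\<lambda>t. p t * ?i t) w g"
      using p w g by (simp add: f_def E.fc_inner E.bil_E_right)
    also have "(- \<alpha>) * E.bil (\<lambda>t. r t * ?i t) w g + (- \<alpha>) * E.bil (\<lambda>t. p t * ?i t) w g
        = E.bil (\<lambda>t. (- \<alpha>) * (r t * ?i t) + (- \<alpha>) * (p t * ?i t)) w g"
      by (rule E.bil_lin_fun[OF b b' w g, symmetric])
    also have "(\<lambda>t. (- \<alpha>) * (r t * ?i t) + (- \<alpha>) * (p t * ?i t)) = (\<lambda>t. t * ?i t * p t)"
    proof
      fix t
      have "(- \<alpha>) * r t + (- \<alpha>) * p t = t * p t"
      proof (cases "0 \<le> t")
        case True
        then have "t + \<alpha> \<noteq> 0" using \<alpha> by linarith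
        then show ?thesis using True by (simp add: r_def p_def field_simps)
      qed (simp add: r_def p_def)
      then show "(- \<alpha>) * (r t * ?i t) + (- \<alpha>) * (p t * ?i t) = t * ?i t * p t"
        by (simp add: indicator_def)
    qed
    also have "E.bil (\<lambda>t. t * ?i t * p t) w g = E.bil (\<lambda>t. t * ?i t) f g"
      unfolding f_def by (rule E.bil_fc[OF b'' p w g, symmetric])
    finally show "ip\<^sub>\<Omega> (\<lambda>x. (- \<alpha>) * z x + (- \<alpha>) * f x) (E ?T g) = E.bil (\<lambda>t. t * ?i t) f g" .
  qed (use f O.lin_in[OF z f, of "- \<alpha>" "- \<alpha>"] in auto)
  moreover have "ip\<^sub>\<Omega> f f \<le> ?K\<^sup>2 * ip\<^sub>\<Omega> w w"
  proof -
    have "ip\<^sub>\<Omega> f f = E.bil (\<lambda>t. p t * p t) w w" using p w by (simp add: f_def E.fc_fc_inner)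
    also have "\<dots> \<le> ?K\<^sup>2 * ip\<^sub>\<Omega> w w"
    proof (intro E.bil_self_le w bdd_borel_mult p)
      show "p t * p t \<le> ?K\<^sup>2" for t
        using power_mono[OF pK abs_ge_zero, of t 2] by (simp add: power2_eq_square)
    qed
    finally show ?thesis .
  qed
  ultimately show ?thesis using that f by (simp add: BB)
qed

text \<open>The equation for \<open>e\<close> is first obtained for test functions \<open>A\<^sup>-\<^sup>1 g\<close> only. As \<open>A\<^sup>-\<^sup>1\<close> is
  symmetric, it then says \<open>\<alpha> (u + e) = - A\<^sup>-\<^sup>1 (1\<^sub>\<omega> e)\<close>, which implies the equation for all test
  functions without a density argument.\<close>

lemma bias:
  assumes u: "u \<in> V" and uz: "(u, z) \<in> L2_op_power (lebesgue_on \<Omega>) (A_op \<Omega> s) (1 / 2)"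
    and wz: "(w, z) \<in> L2_op_power (lebesgue_on \<Omega>) (BB_op \<Omega> s \<omega>) \<beta>" and \<beta>: "0 < \<beta>" "\<beta> \<le> 1"
  obtains e where "e \<in> V" "a e e \<le> (c_beta \<beta> * \<alpha> powr \<beta>)\<^sup>2 * ip\<^sub>\<Omega> w w"
    "\<And>v. v \<in> V \<Longrightarrow> Q e v = - \<alpha> * a u v"
proof -
  obtain E where E: "spectral_resolution (lebesgue_on \<Omega>) E (A_op \<Omega> s)"
    and uzE: "(u, z) \<in> spectral_integral (lebesgue_on \<Omega>) E (\<lambda>t. t powr (1 / 2))"
    using uz by (auto simp: L2_op_power_def)
  obtain f where f: "f \<in> H\<^sub>\<Omega>" "ip\<^sub>\<Omega> f f \<le> (c_beta \<beta> * \<alpha> powr \<beta>)\<^sup>2 * ip\<^sub>\<Omega> w w"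
    and fBB: "(f, \<lambda>x. (- \<alpha>) * z x + (- \<alpha>) * f x) \<in> BB_op \<Omega> s \<omega>"
    using filtered_source[OF wz \<beta>] by blast
  define m where "m = (\<lambda>x. (- \<alpha>) * z x + (- \<alpha>) * f x)"
  obtain k where fk: "(f, k) \<in> B_op \<Omega> s \<omega>"
    and adj: "(k, m) \<in> L2_adjoint (lebesgue_on \<Omega>) (lebesgue_on \<omega>) (B_op \<Omega> s \<omega>)"
    using fBB by (auto simp: BB_op_def m_def)
  \<comment> \<open>The resolution hidden in \<open>B_op\<close>, possibly different from the one
    behind \<open>z\<close>.\<close>
  obtain e' E' where E': "spectral_resolution (lebesgue_on \<Omega>) E' (A_op \<Omega> s)"
    and fe: "(f, e') \<in> spectral_integral (lebesgue_on \<Omega>) E' (\<lambda>t. t powr (- 1 / 2))"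
    and k: "k \<in> H\<^sub>\<omega>" "AE x in lebesgue_on \<omega>. k x = e' x"
    using fk by (auto simp: B_op_def L2_op_power_def K_op_def)
  interpret E: A_resolution \<Omega> s E by unfold_locales fact
  interpret E': A_resolution \<Omega> s E' by unfold_locales fact
  note e' = E'.inv_sqrtD(2)[OF fe]
  have e'\<omega>: "e' \<in> H\<^sub>\<omega>" by (rule L2_on_subset[OF e' \<Omega> \<omega>])
  have uH: "u \<in> H\<^sub>\<Omega>" using u by simp
  have z: "z \<in> H\<^sub>\<Omega>" using uzE by (simp add: E.spectral_integral_iff)
  define e where "e = zero_ext \<Omega> e'"
  have e: "e \<in> V" "a e e \<le> ip\<^sub>\<Omega> f f" unfolding e_def by (rule E'.inv_sqrt_form_le[OF fe])+
  \<comment> \<open>The adjoint of the restriction to \<omega>, applied to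
    \<open>e'\<close>.\<close>
  define j where "j = zero_ext \<omega> e'"
  have j: "j \<in> H\<^sub>\<Omega>"
    using e'\<omega> by (simp add: j_def L2_on_iff \<Omega> \<omega> zero_ext_superset)
  \<comment> \<open>B maps \<open>S g\<close> to the restriction of \<open>R g\<close>, so the
    adjoint relation reads <R g, e'> on \<omega> = <S g, m> on \<Omega>. Both sides become inner
    products with g: moving \<open>S\<close> onto z gives u, and moving it onto f gives
    \<open>e'\<close>, the latter across the two resolutions.\<close>
  have key: "ip\<^sub>\<Omega> (E.R j) g = ip\<^sub>\<Omega> (\<lambda>x. (- \<alpha>) * u x + (- \<alpha>) * e' x) g" if g: "g \<in> H\<^sub>\<Omega>" for g
  proof -
    have "(E.S g, E.R g) \<in> L2_op_power (lebesgue_on \<Omega>) (A_op \<Omega> s) (- 1 / 2)"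
      using E.inv_sqrt_S[OF g] E by (auto simp: L2_op_power_def)
    moreover have "(E.R g, E.R g) \<in> K_op \<Omega> s \<omega>"
      using E.R_V[OF g] g L2_on_subset[OF _ \<Omega> \<omega>] by (auto simp: K_op_def)
    ultimately have "(E.S g, E.R g) \<in> B_op \<Omega> s \<omega>" by (auto simp: B_op_def)
    then have "ip\<^sub>\<omega> (E.R g) k = ip\<^sub>\<Omega> (E.S g) m" using adj by (auto simp: L2_adjoint_def)
    moreover have "ip\<^sub>\<omega> (E.R g) k = ip\<^sub>\<omega> (E.R g) e'"
    proof (rule L2_inner_cong_AE)
      have "E.R g \<in> H\<^sub>\<omega>" using g by (intro L2_on_subset[OF _ \<Omega> \<omega>]) simp
      from L2_spaceD(1)[OF this] show "E.R g \<in> borel_measurable (lebesgue_on \<omega>)" .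
      then show "E.R g \<in> borel_measurable (lebesgue_on \<omega>)" .
    qed (simp_all add: k L2_spaceD(1)[OF k(1)] L2_spaceD(1)[OF e'\<omega>])
    moreover have "ip\<^sub>\<omega> (E.R g) e' = ip\<^sub>\<Omega> (E.R g) j"
      by (simp add: j_def L2_inner_zero_ext \<Omega> \<omega>)
    moreover have "ip\<^sub>\<Omega> (E.R g) j = ip\<^sub>\<Omega> (E.R j) g"
      using g j by (simp add: E.fc_inner E.bil_sym)
    moreover have "ip\<^sub>\<Omega> (E.S g) m = (- \<alpha>) * ip\<^sub>\<Omega> (E.S g) z + (- \<alpha>) * ip\<^sub>\<Omega> (E.S g) f"
      using g z f unfolding m_def by (intro O.lin_right) auto
    moreover have "ip\<^sub>\<Omega> (E.S g) z = ip\<^sub>\<Omega> u g"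
      using g z by (simp add: E.sqrtD[OF uzE g] E.fc_inner E.bil_sym[of _ g])
    moreover have "ip\<^sub>\<Omega> (E.S g) f = ip\<^sub>\<Omega> e' g"
      using g f inv_sqrt_unique[OF E.A_resolution_axioms E'.A_resolution_axioms f(1) g]
      by (simp add: E'.inv_sqrtD(3)[OF fe g] E.fc_inner E.bil_sym[of _ g])
    ultimately show ?thesis using O.lin[OF uH e' g, of "- \<alpha>" "- \<alpha>"] by simp
  qed
  have ae: "AE x in lebesgue_on \<Omega>. E.R j x = (- \<alpha>) * u x + (- \<alpha>) * e' x"
    using j uH e' by (intro L2_weak_eqD key O.lin_in) auto
  have "Q e v = - \<alpha> * a u v" if v: "v \<in> V" for v
  proof -
    let ?c = "\<lambda>x. (- \<alpha>) * u x + (- \<alpha>) * e x"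
    have c: "?c \<in> V" by (intro V.lin_in u e)
    have "AE x in lebesgue_on \<Omega>. x \<in> \<Omega>" using \<Omega> by (simp add: AE_lebesgue_on_iff)
    with ae have "AE x in lebesgue_on \<Omega>. zero_ext \<Omega> (E.R j) x = ?c x"
      by eventually_elim (simp add: e_def zero_ext_def)
    then have "a ?c v = a (zero_ext \<Omega> (E.R j)) v" by (intro V_cong[symmetric] E.R_V j c v)
    also have "\<dots> = ip\<^sub>\<Omega> j v" by (rule E.R_form[OF j v])
    also have "\<dots> = ip\<^sub>\<omega> e' v" by (simp add: j_def L2_inner_zero_ext \<Omega> \<omega>)
    also have "\<dots> = ip\<^sub>\<omega> e v" by (simp add: e_def L2_inner_on \<omega> zero_ext_subset)
    finally have "(- \<alpha>) * a u v + (- \<alpha>) * a e v = ip\<^sub>\<omega> e v"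
      by (simp only: V.lin[OF u e(1) v])
    then show ?thesis by (simp add: Q_def)
  qed
  then show ?thesis using that e f by (meson order_trans)
qed

text \<open>By linearity the difference of two reconstructions solves the pure noise equation with
  data y - y', so \<open>noise_bound\<close> is the Lipschitz estimate, and the triangle inequality
  transfers it to the error.\<close>

lemma tikhonov_error_Lipschitz:
  assumes u: "u \<in> V" and y: "y \<in> H\<^sub>\<omega>" "y' \<in> H\<^sub>\<omega>"
  defines "T \<equiv> \<lambda>y. tikhonov \<Omega> s \<omega> \<alpha> (\<lambda>x. u x + y x)"
  shows "\<bar>H0s_norm \<Omega> s (\<lambda>x. T y x - u x) - H0s_norm \<Omega> s (\<lambda>x. T y' x - u x)\<bar>
    \<le> L2_norm (lebesgue_on \<omega>) (\<lambda>x. y x - y' x) / sqrt (4 * \<alpha>)"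
proof -
  have T: "T y \<in> V" "\<And>v. v \<in> V \<Longrightarrow> Q (T y) v = ip\<^sub>\<omega> (\<lambda>x. u x + y x) v" if "y \<in> H\<^sub>\<omega>" for y
    unfolding T_def using that u by (auto intro!: tikhonov_Euler W.add_in)
  have *: "H0s_norm \<Omega> s (\<lambda>x. T y x - u x) - H0s_norm \<Omega> s (\<lambda>x. T y' x - u x)
      \<le> L2_norm (lebesgue_on \<omega>) (\<lambda>x. y x - y' x) / sqrt (4 * \<alpha>)"
    if y: "y \<in> H\<^sub>\<omega>" "y' \<in> H\<^sub>\<omega>" for y y'
  proof -
    let ?d = "\<lambda>x. T y x - T y' x"
    have d: "?d \<in> V" by (intro V.diff_in T y)
    have "Q ?d v = ip\<^sub>\<omega> (\<lambda>x. y x - y' x) v" if "v \<in> V" for v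
      using that T y u by (simp add: Q.diff_left W.add_left W.diff_left)
    then have "a ?d ?d \<le> ip\<^sub>\<omega> (\<lambda>x. y x - y' x) (\<lambda>x. y x - y' x) / (4 * \<alpha>)"
      by (intro noise_bound d W.diff_in y)
    then have "sqrt (a ?d ?d) \<le> L2_norm (lebesgue_on \<omega>) (\<lambda>x. y x - y' x) / sqrt (4 * \<alpha>)"
      unfolding L2_norm_def real_sqrt_divide[symmetric] by (rule real_sqrt_le_mono)
    moreover have "H0s_norm \<Omega> s (\<lambda>x. T y x - u x) \<le> sqrt (a ?d ?d) + H0s_norm \<Omega> s (\<lambda>x. T y' x - u x)"
      using V.norm_triangle[OF d V.diff_in[OF T(1)[OF y(2)] u]] by (simp add: H0s_norm_def)
    ultimately show ?thesis by simp
  qed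
  have "L2_norm (lebesgue_on \<omega>) (\<lambda>x. y' x - y x) = L2_norm (lebesgue_on \<omega>) (\<lambda>x. y x - y' x)"
    by (simp add: L2_norm_def L2_inner_def algebra_simps)
  then show ?thesis using *[OF y] *[OF y(2,1)] by (simp add: abs_le_iff)
qed

text \<open>\<open>arg_min\<close> selects representatives without any regularity, so measurability
  is shown for the scalar error: preimages of open sets are open in L2(\<omega>), and these generate
  \<open>L2_borel\<close>.\<close>

lemma tikhonov_error_measurable:
  assumes u: "u \<in> V"
  shows "(\<lambda>y. H0s_norm \<Omega> s (\<lambda>x. tikhonov \<Omega> s \<omega> \<alpha> (\<lambda>x. u x + y x) x - u x))
    \<in> borel_measurable (L2_borel (lebesgue_on \<omega>))" (is "?F \<in> _")
proof (rule borel_measurableI)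
  fix S :: "real set" assume S: "open S"
  have sub: "{U. L2_open (lebesgue_on \<omega>) U} \<subseteq> Pow H\<^sub>\<omega>" by (auto simp: L2_open_def)
  have sp: "space (L2_borel (lebesgue_on \<omega>)) = H\<^sub>\<omega>"
    unfolding L2_borel_def using sub by (simp add: space_measure_of)
  have "L2_open (lebesgue_on \<omega>) (?F -` S \<inter> H\<^sub>\<omega>)"
    unfolding L2_open_def
  proof (intro conjI ballI)
    fix y assume y: "y \<in> ?F -` S \<inter> H\<^sub>\<omega>"
    then obtain e where e: "0 < e" "\<And>r. dist r (?F y) < e \<Longrightarrow> r \<in> S"
      using S by (auto simp: open_dist)
    show "\<exists>e>0. \<forall>g\<in>H\<^sub>\<omega>. L2_norm (lebesgue_on \<omega>) (\<lambda>x. g x - y x) < e \<longrightarrow> g \<in> ?F -` S \<inter> H\<^sub>\<omega>"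
    proof (intro exI[of _ "e * sqrt (4 * \<alpha>)"] conjI ballI impI)
      show "0 < e * sqrt (4 * \<alpha>)" using e(1) \<alpha> by simp
      fix g assume g: "g \<in> H\<^sub>\<omega>" "L2_norm (lebesgue_on \<omega>) (\<lambda>x. g x - y x) < e * sqrt (4 * \<alpha>)"
      have "\<bar>?F g - ?F y\<bar> \<le> L2_norm (lebesgue_on \<omega>) (\<lambda>x. g x - y x) / sqrt (4 * \<alpha>)"
        using y g by (intro tikhonov_error_Lipschitz u) auto
      also have "\<dots> < e" using g(2) \<alpha> by (simp add: pos_divide_less_eq)
      finally show "g \<in> ?F -` S \<inter> H\<^sub>\<omega>" using e(2) g(1) by (simp add: dist_real_def)
    qed
  qed auto
  then show "?F -` S \<inter> space (L2_borel (lebesgue_on \<omega>)) \<in> sets (L2_borel (lebesgue_on \<omega>))"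
    unfolding sp L2_borel_def using sub by (auto simp: sets_measure_of)
qed

lemma tikhonov_error_bound:
  assumes u: "u \<in> V" and uz: "(u, z) \<in> L2_op_power (lebesgue_on \<Omega>) (A_op \<Omega> s) (1 / 2)"
    and wz: "(w, z) \<in> L2_op_power (lebesgue_on \<Omega>) (BB_op \<Omega> s \<omega>) \<beta>" and \<beta>: "0 < \<beta>" "\<beta> \<le> 1"
    and w: "w \<in> H\<^sub>\<Omega>" and y: "y \<in> H\<^sub>\<omega>"
  shows "(H0s_norm \<Omega> s (\<lambda>x. tikhonov \<Omega> s \<omega> \<alpha> (\<lambda>x. u x + y x) x - u x))\<^sup>2
    \<le> 2 * (c_beta \<beta>)\<^sup>2 * (L2_norm (lebesgue_on \<Omega>) w)\<^sup>2 * \<alpha> powr (2 * \<beta>)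
      + 1 / (2 * \<alpha>) * (L2_norm (lebesgue_on \<omega>) y)\<^sup>2"
proof -
  obtain e where e: "e \<in> V" "a e e \<le> (c_beta \<beta> * \<alpha> powr \<beta>)\<^sup>2 * ip\<^sub>\<Omega> w w"
    "\<And>v. v \<in> V \<Longrightarrow> Q e v = - \<alpha> * a u v"
    using bias[OF u uz wz \<beta>] by blast
  define T where "T = tikhonov \<Omega> s \<omega> \<alpha> (\<lambda>x. u x + y x)"
  have T: "T \<in> V" "\<And>v. v \<in> V \<Longrightarrow> Q T v = ip\<^sub>\<omega> (\<lambda>x. u x + y x) v"
    unfolding T_def using y u by (auto intro!: tikhonov_Euler W.add_in)
  have Tu: "(\<lambda>x. T x - u x) \<in> V" by (intro V.diff_in T u)
  let ?n = "\<lambda>x. (T x - u x) - e x"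
  have n: "?n \<in> V" by (intro V.diff_in Tu e)
  have "Q ?n v = ip\<^sub>\<omega> y v" if v: "v \<in> V" for v
  proof -
    \<comment> \<open>Q T v contains <u, v> on \<omega>, and Q u v has the additional term \<alpha>
      a(u, v); subtracting the bias equation cancels the latter, and only the noise is left.\<close>
    have "Q ?n v = Q T v - Q u v - Q e v"
      using v T u e Tu by (simp add: Q.diff_left[OF Tu e(1) v] Q.diff_left)
    then show ?thesis
      using v T u e y by (simp add: W.add_left Q_def[of u v])
  qed
  then have nb: "a ?n ?n \<le> ip\<^sub>\<omega> y y / (4 * \<alpha>)" by (intro noise_bound n y)
  have "(H0s_norm \<Omega> s (\<lambda>x. T x - u x))\<^sup>2 = a (\<lambda>x. ?n x + e x) (\<lambda>x. ?n x + e x)"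
    using V.nonneg[OF Tu] by (simp add: H0s_norm_def)
  \<comment> \<open>This doubling is the factor 2 in C1, and it turns the 1/4 of the noise part into
    1/2.\<close>
  also have "\<dots> \<le> 2 * a ?n ?n + 2 * a e e" by (rule V.square_add_le[OF n e(1)])
  also have "\<dots> \<le> 2 * (ip\<^sub>\<omega> y y / (4 * \<alpha>)) + 2 * ((c_beta \<beta> * \<alpha> powr \<beta>)\<^sup>2 * ip\<^sub>\<Omega> w w)"
    using nb e(2) by simp
  also have "\<dots> = 2 * (c_beta \<beta>)\<^sup>2 * (L2_norm (lebesgue_on \<Omega>) w)\<^sup>2 * \<alpha> powr (2 * \<beta>)
      + 1 / (2 * \<alpha>) * (L2_norm (lebesgue_on \<omega>) y)\<^sup>2"
  proof -
    have "(\<alpha> powr \<beta>)\<^sup>2 = \<alpha> powr (2 * \<beta>)" by (simp add: power2_eq_square flip: powr_add)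
    then show ?thesis
      using O.nonneg[OF w] W.nonneg[OF y] \<alpha> by (simp add: L2_norm_def power_mult_distrib)
  qed
  finally show ?thesis by (simp add: T_def)
qed

end

text \<open>The exponent is the one that makes \<alpha>^(2 \<beta>) and \<delta>^2 / \<alpha>
  equal.\<close>

lemma a_priori_choice:
  fixes \<delta> \<beta> c :: real
  assumes "0 < \<delta>" "0 < \<beta>"
  defines "\<alpha> \<equiv> \<delta> powr (2 / (2 * \<beta> + 1))"
  shows "c * \<alpha> powr (2 * \<beta>) + 1 / 2 * \<delta>\<^sup>2 / \<alpha> = (c + 1 / 2) * \<delta> powr (4 * \<beta> / (2 * \<beta> + 1))"
proof -
  have "\<alpha> powr (2 * \<beta>) = \<delta> powr (4 * \<beta> / (2 * \<beta> + 1))"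
    using assms(2) unfolding \<alpha>_def powr_powr by (simp add: field_simps)
  moreover have "\<delta>\<^sup>2 / \<alpha> = \<delta> powr (4 * \<beta> / (2 * \<beta> + 1))"
  proof -
    have "\<delta>\<^sup>2 / \<alpha> = \<delta> powr (2 - 2 / (2 * \<beta> + 1))"
      using assms(1) by (simp add: \<alpha>_def powr_diff)
    also have "2 - 2 / (2 * \<beta> + 1) = 4 * \<beta> / (2 * \<beta> + 1)"
      using assms(2) by (simp add: field_simps)
    finally show ?thesis .
  qed
  ultimately show ?thesis by (simp add: algebra_simps)
qed

theorem theorem4p1:
  fixes \<Omega> \<omega> :: "'a::euclidean_space set" and s \<delta> \<beta> :: real
    and P :: "'p measure" and \<eta> :: "'p \<Rightarrow> 'a \<Rightarrow> real"
    and u_true z_true w :: "'a \<Rightarrow> real"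
  assumes "bounded_Lipschitz_domain \<Omega>"
    and "0 < s" "s < 1"
    and "\<omega> \<in> sets lebesgue" "\<omega> \<subseteq> \<Omega>" "emeasure lebesgue \<omega> > 0"
    and "u_true \<in> H0s \<Omega> s"
    and "0 < \<delta>"
    and "prob_space P"
    and "\<eta> \<in> measurable P (L2_borel (lebesgue_on \<omega>))"
    and "integrable P (\<lambda>\<xi>. (L2_norm (lebesgue_on \<omega>) (\<eta> \<xi>))\<^sup>2)"
    and "prob_space.expectation P (\<lambda>\<xi>. (L2_norm (lebesgue_on \<omega>) (\<eta> \<xi>))\<^sup>2) \<le> \<delta>\<^sup>2"
    and "(u_true, z_true) \<in> L2_op_power (lebesgue_on \<Omega>) (A_op \<Omega> s) (1 / 2)"
    and "0 < \<beta>" "\<beta> \<le> 1"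
    and "w \<in> L2_space (lebesgue_on \<Omega>)"
    and "(w, z_true) \<in> L2_op_power (lebesgue_on \<Omega>) (BB_op \<Omega> s \<omega>) \<beta>"
  defines "err \<equiv> \<lambda>\<alpha> \<xi>. (H0s_norm \<Omega> s
      (\<lambda>x. tikhonov \<Omega> s \<omega> \<alpha> (\<lambda>x. u_true x + \<eta> \<xi> x) x - u_true x))\<^sup>2"
    and "C1 \<equiv> 2 * (c_beta \<beta>)\<^sup>2 * (L2_norm (lebesgue_on \<Omega>) w)\<^sup>2"
    and "C2 \<equiv> 1 / 2"
    and "C_opt \<equiv> 2 * (c_beta \<beta>)\<^sup>2 * (L2_norm (lebesgue_on \<Omega>) w)\<^sup>2 + 1 / 2"
  shows "(\<forall>\<alpha>>0. integrable P (err \<alpha>) \<and>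
           prob_space.expectation P (err \<alpha>) \<le> C1 * \<alpha> powr (2 * \<beta>) + C2 * \<delta>\<^sup>2 / \<alpha>) \<and>
         prob_space.expectation P (err (\<delta> powr (2 / (2 * \<beta> + 1))))
           \<le> C_opt * \<delta> powr (4 * \<beta> / (2 * \<beta> + 1))"
proof -
  interpret P: prob_space P by fact
  have \<Omega>: "\<Omega> \<in> sets lebesgue"
    using assms(1) by (auto simp: bounded_Lipschitz_domain_def intro: sets_completionI_sets)
  let ?N = "\<lambda>\<xi>. (L2_norm (lebesgue_on \<omega>) (\<eta> \<xi>))\<^sup>2"
  have *: "integrable P (err \<alpha>) \<and>
      P.expectation (err \<alpha>) \<le> C1 * \<alpha> powr (2 * \<beta>) + C2 * \<delta>\<^sup>2 / \<alpha>" if \<alpha>: "0 < \<alpha>" for \<alpha>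
  proof -
    interpret tikhonov_setup \<Omega> s \<omega> \<alpha>
      using assms(2-5) \<Omega> \<alpha> by unfold_locales
    have \<eta>: "\<eta> \<xi> \<in> L2_space (lebesgue_on \<omega>)" if "\<xi> \<in> space P" for \<xi>
    proof -
      have "{U. L2_open (lebesgue_on \<omega>) U} \<subseteq> Pow (L2_space (lebesgue_on \<omega>))" by (auto simp: L2_open_def)
      then show ?thesis
        using measurable_space[OF assms(10) that] by (simp add: L2_borel_def space_measure_of)
    qed
    have bound: "err \<alpha> \<xi> \<le> C1 * \<alpha> powr (2 * \<beta>) + 1 / (2 * \<alpha>) * ?N \<xi>" if "\<xi> \<in> space P" for \<xi>
      unfolding err_def C1_def
      by (rule tikhonov_error_bound[OF assms(7,13,17,14,15,16) \<eta>[OF that]])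
    have int: "integrable P (\<lambda>\<xi>. C1 * \<alpha> powr (2 * \<beta>) + 1 / (2 * \<alpha>) * ?N \<xi>)"
      using assms(11) by simp
    \<comment> \<open>The error is a measurable function of the noise; domination by an affine
      function of the squared noise norm then gives integrability.\<close>
    have "err \<alpha> \<in> borel_measurable P"
      unfolding err_def
      using measurable_compose[OF assms(10) tikhonov_error_measurable[OF assms(7)]]
      by (intro borel_measurable_power)
    then have err: "integrable P (err \<alpha>)"
    proof (rule Bochner_Integration.integrable_bound[OF int])
      show "AE \<xi> in P. norm (err \<alpha> \<xi>) \<le> norm (C1 * \<alpha> powr (2 * \<beta>) + 1 / (2 * \<alpha>) * ?N \<xi>)"
      proof (rule AE_I2)
        fix \<xi> assume "\<xi> \<in> space P"
        moreover have "0 \<le> err \<alpha> \<xi>" by (simp add: err_def)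
        ultimately show "norm (err \<alpha> \<xi>) \<le> norm (C1 * \<alpha> powr (2 * \<beta>) + 1 / (2 * \<alpha>) * ?N \<xi>)"
          using bound[of \<xi>] by simp
      qed
    qed
    have "P.expectation (err \<alpha>) \<le> P.expectation (\<lambda>\<xi>. C1 * \<alpha> powr (2 * \<beta>) + 1 / (2 * \<alpha>) * ?N \<xi>)"
      by (rule integral_mono[OF err int bound])
    also have "\<dots> = C1 * \<alpha> powr (2 * \<beta>) + 1 / (2 * \<alpha>) * P.expectation ?N"
      using assms(11) by (simp add: P.prob_space)
    also have "\<dots> \<le> C1 * \<alpha> powr (2 * \<beta>) + 1 / (2 * \<alpha>) * \<delta>\<^sup>2"
      using assms(12) \<alpha> by (intro add_left_mono mult_left_mono) auto
    also have "\<dots> = C1 * \<alpha> powr (2 * \<beta>) + C2 * \<delta>\<^sup>2 / \<alpha>" by (simp add: C2_def)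
    finally show ?thesis using err by blast
  qed
  have "P.expectation (err (\<delta> powr (2 / (2 * \<beta> + 1)))) \<le> C_opt * \<delta> powr (4 * \<beta> / (2 * \<beta> + 1))"
    using *[of "\<delta> powr (2 / (2 * \<beta> + 1))"] assms(8) a_priori_choice[OF assms(8,14), of C1]
    by (simp add: C1_def C2_def C_opt_def)
  then show ?thesis using * by blast
qed

end
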